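(* Assume Selberg's conjectures (A), (B), (C) stated in the context. Let $F\in\mathcal{S}$. If $n_F=1$, then $F$ is primitive.
   Context: Write $\sigma=\Re s$, and for a function $\Phi$ put $\overline{\Phi}(s)=\overline{\Phi(\overline{s})}$. The Selberg class $\mathcal{S}$ is the set of Dirichlet series $F(s)=\sum_{n=1}^{\infty} a_n n^{-s}$ satisfying: (1) Analyticity: $(s-1)^mF(s)$ is (continues to) an entire function of finite order for some non-negative integer $m$. (2) Ramanujan hypothesis: $a_n\ll_\epsilon n^{\epsilon}$ for any fixed $\epsilon>0$. (3) Functional equation: there is a function $\gamma_F(s)=\epsilon Q^s\prod_{i=1}^{k}\Gamma(w_is+\mu_i)$ with $|\epsilon|=1$, $Q>0$, $w_i>0$, $\Re\mu_i\ge 0$ (the product of gamma functions may be empty) such that $\Phi(s)=\gamma_F(s)F(s)$ satisfies $\Phi(s)=\overline{\Phi}(1-s)$. (4) Euler product: $a_1=1$ and $\log F(s)=\sum_{n=1}^{\infty} b_n n^{-s}$ (for $\sigma>1$), where $b_n=0$ unless $n$ is a positive power of a prime, and $b_n\ll n^{\theta}$ for some $\theta<1/2$. $F\in\mathcal{S}$, $F\ne 1$, is primitive if $F=F_1F_2$ with $F_1,F_2\in\mathcal{S}$ implies $F_1=1$ or $F_2=1$. For a primitive Dirichlet character $\chi$, $F^\chi(s)=\sum_{n\ge1} a_n\chi(n)n^{-s}$. Sums over $p$ are over primes. Selberg's conjectures: (A) Regularity of distribution: for each $F\in\mathcal{S}$ with coefficients $a_n$ there is an integer $n_F$ such that $\sum_{p\le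 x}|a_p|^2/p=n_F\log\log x+O(1)$. (B) Orthonormality: if $F$ and $F'$ (with coefficients $a_n$ and $a'_n$) are distinct and primitive, then $n_F=1$ and $\sum_{p\le x}a_p\overline{a'_p}/p=O(1)$. (C) $GL(1)$ twists: if $\chi$ is a primitive Dirichlet character, $F$ and $F^\chi$ are in $\mathcal{S}$, and $F=\prod_{i=1}^kF_i$ with the $F_i$ primitive, then $F^\chi=\prod_{i=1}^kF_i^\chi$ and the $F_i^\chi$ are also primitive elements of $\mathcal{S}$. *)

theory Defs
  imports
    "HOL-Complex_Analysis.Complex_Analysis"
    "HOL-Number_Theory.Number_Theory"
    "HOL-Library.Landau_Symbols"
    "HOL-Real_Asymp.Real_Asymp"
begin

text \<open>
  A Dirichlet series is given by its coefficients \<open>a :: nat \<Rightarrow> complex\<close>; the value \<open>a 0\<close> is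
  never used. Identities between Dirichlet series (\<open>F = 1\<close>, \<open>F = F\<^sub>1 F\<^sub>2\<close>, \<open>F = F'\<close>) are read as
  identities of functions on the half-plane \<open>Re s > 1\<close>, where all the series
  considered converge absolutely.
\<close>

definition dser :: "(nat \<Rightarrow> complex) \<Rightarrow> complex \<Rightarrow> complex" where
  "dser a s = (\<Sum>n. a (Suc n) / of_nat (Suc n) powr s)"

definition dser_equals :: "(nat \<Rightarrow> complex) \<Rightarrow> (complex \<Rightarrow> complex) \<Rightarrow> bool" where
  "dser_equals a f \<longleftrightarrow> (\<forall>s. Re s > 1 \<longrightarrow> dser a s = f s)"

definition entire_finite_order :: "(complex \<Rightarrow> complex) \<Rightarrow> bool" where
  "entire_finite_order g \<longleftrightarrow>
     g holomorphic_on UNIV \<and>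
     (\<exists>\<rho>::real. eventually (\<lambda>s. norm (g s) \<le> exp (norm s powr \<rho>)) at_infinity)"

text \<open>
  In the analyticity and functional equation axioms \<open>F\<close> is the continuation of the Dirichlet series to the plane
  without the point 1.
\<close>

definition selberg_analyticity :: "(complex \<Rightarrow> complex) \<Rightarrow> bool" where
  "selberg_analyticity F \<longleftrightarrow>
     (\<exists>(m::nat) g. entire_finite_order g \<and> (\<forall>s. s \<noteq> 1 \<longrightarrow> g s = (s - 1) ^ m * F s))"

text \<open>
  \<open>\<Phi>(s) = \<Phi>\<^sup>*(1 - s)\<close>, with \<open>\<Phi>\<^sup>*(s) = cnj (\<Phi> (cnj s))\<close>, is an identity of meromorphic functions.
  It is required off a sparse set only, since at poles the HOL functions take junk values.
\<close>

definition gamma_factor ::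
  "complex \<Rightarrow> real \<Rightarrow> nat \<Rightarrow> (nat \<Rightarrow> real) \<Rightarrow> (nat \<Rightarrow> complex) \<Rightarrow> complex \<Rightarrow> complex" where
  "gamma_factor \<epsilon> Q k w \<mu> s =
     \<epsilon> * of_real Q powr s * (\<Prod>i<k. Gamma (of_real (w i) * s + \<mu> i))"

definition selberg_functional_equation :: "(complex \<Rightarrow> complex) \<Rightarrow> bool" where
  "selberg_functional_equation F \<longleftrightarrow>
     (\<exists>\<epsilon> Q k w \<mu>. norm \<epsilon> = 1 \<and> Q > 0 \<and> (\<forall>i<k. w i > 0 \<and> Re (\<mu> i) \<ge> 0) \<and>
        (let \<Phi> = (\<lambda>s. gamma_factor \<epsilon> Q k w \<mu> s * F s)
         in eventually (\<lambda>s. \<Phi> s = cnj (\<Phi> (cnj (1 - s)))) (cosparse UNIV)))"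

definition ramanujan_hypothesis :: "(nat \<Rightarrow> complex) \<Rightarrow> bool" where
  "ramanujan_hypothesis a \<longleftrightarrow>
     (\<forall>\<epsilon>>0. (\<lambda>n. norm (a n)) \<in> O(\<lambda>n. real n powr \<epsilon>))"

text \<open>
  The branch of \<open>log F\<close> is not prescribed: a convergent series \<open>\<Sum> b\<^sub>n n\<^sup>-\<^sup>s\<close> whose exponential
  is \<open>F\<close> is automatically a holomorphic logarithm of \<open>F\<close> on \<open>Re s > 1\<close>, and as \<open>b\<^sub>1 = 0\<close> it is
  the one that tends to 0 as \<open>Re s\<close> tends to infinity.
\<close>

definition selberg_euler_product :: "(nat \<Rightarrow> complex) \<Rightarrow> bool" where
  "selberg_euler_product a \<longleftrightarrow>
     a 1 = 1 \<and>
     (\<exists>b. (\<forall>s. Re s > 1 \<longrightarrow>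
             summable (\<lambda>n. b (Suc n) / of_nat (Suc n) powr s) \<and> exp (dser b s) = dser a s) \<and>
          (\<forall>n\<ge>1. b n \<noteq> 0 \<longrightarrow> (\<exists>p k. prime p \<and> k > 0 \<and> n = p ^ k)) \<and>
          (\<exists>\<theta><1/2. (\<lambda>n. norm (b n)) \<in> O(\<lambda>n. real n powr \<theta>)))"

definition selberg_class :: "(nat \<Rightarrow> complex) set" where
  "selberg_class =
     {a. ramanujan_hypothesis a \<and> selberg_euler_product a \<and>
         (\<exists>F. F holomorphic_on - {1} \<and> dser_equals a F \<and>
              selberg_analyticity F \<and> selberg_functional_equation F)}"

definition selberg_primitive :: "(nat \<Rightarrow> complex) \<Rightarrow> bool" where
  "selberg_primitive a \<longleftrightarrow>
     a \<in> selberg_class \<and> \<not> dser_equals a (\<lambda>_. 1) \<and>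
     (\<forall>a1\<in>selberg_class. \<forall>a2\<in>selberg_class.
        dser_equals a (\<lambda>s. dser a1 s * dser a2 s) \<longrightarrow>
        dser_equals a1 (\<lambda>_. 1) \<or> dser_equals a2 (\<lambda>_. 1))"

definition dirichlet_character :: "nat \<Rightarrow> (nat \<Rightarrow> complex) \<Rightarrow> bool" where
  "dirichlet_character q \<psi> \<longleftrightarrow>
     q > 0 \<and> (\<forall>n. \<psi> (n + q) = \<psi> n) \<and> (\<forall>m n. \<psi> (m * n) = \<psi> m * \<psi> n) \<and>
     (\<forall>n. \<psi> n = 0 \<longleftrightarrow> \<not> coprime n q)"

definition primitive_dirichlet_character :: "nat \<Rightarrow> (nat \<Rightarrow> complex) \<Rightarrow> bool" where
  "primitive_dirichlet_character q \<psi> \<longleftrightarrow>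
     dirichlet_character q \<psi> \<and>
     \<not> (\<exists>d \<psi>'. d dvd q \<and> d < q \<and> dirichlet_character d \<psi>' \<and>
               (\<forall>n. coprime n q \<longrightarrow> \<psi> n = \<psi>' n))"

definition twist :: "(nat \<Rightarrow> complex) \<Rightarrow> (nat \<Rightarrow> complex) \<Rightarrow> nat \<Rightarrow> complex" where
  "twist \<psi> a n = a n * \<psi> n"

definition selberg_regular :: "(nat \<Rightarrow> complex) \<Rightarrow> int \<Rightarrow> bool" where
  "selberg_regular a n \<longleftrightarrow>
     (\<lambda>x::real. (\<Sum>p | prime p \<and> real p \<le> x. (norm (a p))\<^sup>2 / real p) - of_int n * ln (ln x))
       \<in> O[at_top](\<lambda>_. 1)"

definition selberg_n :: "(nat \<Rightarrow> complex) \<Rightarrow> int" where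
  "selberg_n a = (THE n. selberg_regular a n)"

lemma selberg_n_eqI:
  assumes "selberg_regular a n"
  shows "selberg_n a = n"
  unfolding selberg_n_def
proof (rule the_equality)
  fix m assume "selberg_regular a m"
  hence "(\<lambda>x::real. of_int (m - n) * ln (ln x)) \<in> O[at_top](\<lambda>_. 1)"
    using sum_in_bigo(2)[OF assms[unfolded selberg_regular_def],
        of "\<lambda>x. (\<Sum>p | prime p \<and> real p \<le> x. (norm (a p))\<^sup>2 / real p) - of_int m * ln (ln x)"]
    by (simp add: selberg_regular_def algebra_simps)
  moreover have "(\<lambda>x::real. ln (ln x)) \<notin> O[at_top](\<lambda>_. 1)"
  proof
    assume *: "(\<lambda>x::real. ln (ln x)) \<in> O[at_top](\<lambda>_. 1)"
    have "(\<lambda>_. 1) \<in> o[at_top](\<lambda>x::real. ln (ln x))"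
      by real_asymp
    from landau_o.big_small_trans[OF * this] have "eventually (\<lambda>x::real. ln (ln x) = 0) at_top"
      by (simp add: landau_o.small_refl_iff)
    moreover have "eventually (\<lambda>x::real. ln (ln x) > 0) at_top"
      by real_asymp
    ultimately have "eventually (\<lambda>_::real. False) at_top"
      by eventually_elim simp
    thus False by simp
  qed
  ultimately show "m = n"
    by (cases "m = n") (simp_all flip: of_int_diff)
qed fact

definition selberg_conjecture_A :: bool where
  "selberg_conjecture_A \<longleftrightarrow> (\<forall>a\<in>selberg_class. \<exists>n. selberg_regular a n)"

definition selberg_conjecture_B :: bool where
  "selberg_conjecture_B \<longleftrightarrow>
     (\<forall>a a'. selberg_primitive a \<and> selberg_primitive a' \<and> \<not> dser_equals a (dser a') \<longrightarrow>
        selberg_n a = 1 \<and>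
        (\<lambda>x::real. \<Sum>p | prime p \<and> real p \<le> x. a p * cnj (a' p) / of_nat p) \<in> O[at_top](\<lambda>_. 1))"

definition selberg_conjecture_C :: bool where
  "selberg_conjecture_C \<longleftrightarrow>
     (\<forall>q \<psi> a k f. primitive_dirichlet_character q \<psi> \<and>
        a \<in> selberg_class \<and> twist \<psi> a \<in> selberg_class \<and>
        (\<forall>i<k. selberg_primitive (f i)) \<and> dser_equals a (\<lambda>s. \<Prod>i<k. dser (f i) s) \<longrightarrow>
        dser_equals (twist \<psi> a) (\<lambda>s. \<Prod>i<k. dser (twist \<psi> (f i)) s) \<and>
        (\<forall>i<k::nat. selberg_primitive (twist \<psi> (f i))))"

end

theory Submission
  imports Defs "HOL-Probability.Sinc_Integral"
begin

text \<open>
  The functional equation and the product formula for the Gamma function show that for each large fixed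
  \<open>A\<close> the continuation of \<open>F\<close> has size about \<open>|t|\<^bsup>d A\<^esup>\<close> on the line \<open>Re s = -A\<close>, up to a factor
  \<open>|t|\<^bsup>O(1)\<^esup>\<close> with the exponent independent of \<open>A\<close>. This makes the degree \<open>d\<close> intrinsic and additive. If
  \<open>d < 1/2\<close>, a contour shift shows that the coefficients decay faster than every power of \<open>n\<close>, so that \<open>F\<close> is
  bounded on vertical lines and hence \<open>d = 0\<close>; then \<open>F\<close> is a Dirichlet polynomial, and comparing the mean
  values of \<open>log |F|\<close> on \<open>Re s = 1/2 \<plusminus> \<delta>\<close> by the functional equation shows that the conductor is 1, so
  \<open>F = 1\<close>. Therefore a factorization has boundedly many nontrivial factors and primitive factorizations exist.
  By orthonormality, \<open>n\<^sub>F\<close> is the sum of \<open>n\<close> of the factors over the pairs of equal factors, which is 1 only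
  if there is exactly one factor.
\<close>

section \<open>Absolutely convergent Dirichlet series\<close>

text \<open>The data of a gamma factor are not unique, so no invariant can simply be read off them.
  What survives is the growth of \<open>F\<close> far to the left, and there an error of
  \<open>O(1)\<close> in the exponent is harmless because \<open>A\<close> is free; this is why the
  product formula and the recurrence of Gamma suffice in place of Stirling's formula. The threshold
  1/2 comes from isolating one coefficient: neighbouring values of \<open>ln n\<close> are about
  \<open>1/n\<close> apart, separating them with an exponentially small error uses the height scale
  \<open>n^2\<close>, and this turns a growth exponent \<open>\<kappa>\<close> into a loss
  \<open>n^(2 \<kappa>)\<close> against the gain \<open>n^(-A)\<close>. With
  \<open>\<kappa> = d A + O(1)\<close> the gain wins for large \<open>A\<close> when
  \<open>2 d < 1\<close>. Degree 0 by itself does not exclude Dirichlet polynomials; here the Euler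
  product enters, since \<open>\<theta> < 1/2\<close> lets \<open>log F\<close> converge to the left
  of the critical line. Finally, (B) gives \<open>n = 1\<close> for a factor only in the presence of
  a second, different primitive element, so equal factors have to be counted separately.\<close>

definition dser_abs :: "(nat \<Rightarrow> complex) \<Rightarrow> real \<Rightarrow> bool" where
  "dser_abs a \<sigma> \<longleftrightarrow> summable (\<lambda>n. norm (a (Suc n)) / real (Suc n) powr \<sigma>)"

lemma norm_dser_term:
  "norm (a (Suc n) / of_nat (Suc n) powr s) = norm (a (Suc n)) / real (Suc n) powr Re s"
  unfolding norm_divide by (subst norm_powr_real_powr) auto

lemma dser_term_exp:
  fixes s :: complex
  shows "a (Suc n) / of_nat (Suc n) powr s = a (Suc n) * exp (- (of_real (ln (real (Suc n))) * s))"
proof -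
  have "of_nat (Suc n) powr s = exp (s * of_real (ln (real (Suc n))))"
    unfolding powr_def by (simp add: Ln_of_nat del: of_nat_Suc)
  thus ?thesis by (simp add: exp_minus field_simps del: of_nat_Suc)
qed

lemma dser_abs_bound_term:
  assumes "\<sigma> \<le> Re s"
  shows "norm (a (Suc n) / of_nat (Suc n) powr s) \<le> norm (a (Suc n)) / real (Suc n) powr \<sigma>"
  unfolding norm_dser_term using assms
  by (intro divide_left_mono powr_mono mult_pos_pos) auto

lemma dser_abs_mono:
  assumes "dser_abs a \<sigma>" "\<sigma> \<le> \<tau>"
  shows "dser_abs a \<tau>"
  using assms(1) unfolding dser_abs_def
proof (rule summable_comparison_test'[where N = 0])
  fix n show "norm (norm (a (Suc n)) / real (Suc n) powr \<tau>) \<le> norm (a (Suc n)) / real (Suc n) powr \<sigma>"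
    using dser_abs_bound_term[of \<sigma> "of_real \<tau>" a n] assms(2) by (simp add: norm_dser_term del: of_nat_Suc)
qed

lemma dser_abs_norm_summable:
  assumes "dser_abs a \<sigma>" "\<sigma> \<le> Re s"
  shows "summable (\<lambda>n. norm (a (Suc n) / of_nat (Suc n) powr s))"
  using dser_abs_mono[OF assms] unfolding dser_abs_def norm_dser_term .

lemma norm_dser_le:
  assumes "dser_abs a \<sigma>" "\<sigma> \<le> Re s"
  shows "norm (dser a s) \<le> (\<Sum>n. norm (a (Suc n)) / real (Suc n) powr \<sigma>)"
proof -
  have "norm (dser a s) \<le> (\<Sum>n. norm (a (Suc n) / of_nat (Suc n) powr s))"
    unfolding dser_def by (rule summable_norm[OF dser_abs_norm_summable[OF assms]])
  also have "\<dots> \<le> (\<Sum>n. norm (a (Suc n)) / real (Suc n) powr \<sigma>)"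
    using assms dser_abs_norm_summable[OF assms]
    by (intro suminf_le dser_abs_bound_term) (auto simp: dser_abs_def)
  finally show ?thesis .
qed

text \<open>Every term of index at least 2 gains a factor of at most
  \<open>2 powr (\<sigma> - Re s)\<close>. This puts \<open>F\<close> near 1 far to the right, which
  turns the functional equation into a growth statement on the left.\<close>

lemma dser_minus_first_le:
  assumes "dser_abs a \<sigma>"
  shows "\<exists>C>0. \<forall>s. Re s \<ge> \<sigma> \<longrightarrow> norm (dser a s - a 1) \<le> C * 2 powr (\<sigma> - Re s)"
proof -
  define B where "B n = norm (a (Suc n)) / real (Suc n) powr \<sigma>" for n
  have B: "summable B" "\<And>n. B n \<ge> 0"
    using assms by (auto simp: dser_abs_def B_def[abs_def] simp del: of_nat_Suc)
  have "norm (dser a s - a 1) \<le> ((\<Sum>n. B n) + 1) * 2 powr (\<sigma> - Re s)" if s: "Re s \<ge> \<sigma>" for s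
  proof -
    define t where "t n = a (Suc n) / of_nat (Suc n) powr s" for n
    have sm: "summable (\<lambda>n. norm (t n))"
      unfolding t_def by (rule dser_abs_norm_summable[OF assms s])
    have "dser a s - a 1 = (\<Sum>n. t (Suc n))"
      using suminf_split_head[OF summable_norm_cancel[OF sm]] by (simp add: dser_def t_def)
    also have "norm \<dots> \<le> (\<Sum>n. norm (t (Suc n)))"
      using sm by (intro summable_norm) (subst summable_Suc_iff)
    also have "\<dots> \<le> (\<Sum>n. B (Suc n) * 2 powr (\<sigma> - Re s))"
    proof (rule suminf_le)
      fix n
      have "norm (t (Suc n)) = B (Suc n) * real (Suc (Suc n)) powr (\<sigma> - Re s)"
        unfolding t_def norm_dser_term B_def by (simp add: powr_diff del: of_nat_Suc)
      also have "\<dots> \<le> B (Suc n) * 2 powr (\<sigma> - Re s)"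
        using s B(2) by (intro mult_left_mono powr_mono2') auto
      finally show "norm (t (Suc n)) \<le> B (Suc n) * 2 powr (\<sigma> - Re s)" .
    next
      show "summable (\<lambda>n. norm (t (Suc n)))" using sm by (subst summable_Suc_iff)
      show "summable (\<lambda>n. B (Suc n) * 2 powr (\<sigma> - Re s))"
        using B(1) by (intro summable_mult2) (subst summable_Suc_iff)
    qed
    also have "\<dots> = (\<Sum>n. B (Suc n)) * 2 powr (\<sigma> - Re s)"
      using B(1) by (intro suminf_mult2[symmetric]) (subst summable_Suc_iff)
    also have "\<dots> \<le> ((\<Sum>n. B n) + 1) * 2 powr (\<sigma> - Re s)"
      using suminf_split_head[OF B(1)] B(2)[of 0] by (intro mult_right_mono) auto
    finally show ?thesis .
  qed
  moreover have "(\<Sum>n. B n) + 1 > 0" using suminf_nonneg[OF B] by simp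
  ultimately show ?thesis by blast
qed

lemma dser_abs_ln:
  assumes "dser_abs a \<sigma>" "\<sigma> < \<tau>"
  shows "dser_abs (\<lambda>n. of_real (ln (real n)) * a n) \<tau>"
  unfolding dser_abs_def
proof (rule summable_comparison_test'[where N = 0])
  define \<delta> where "\<delta> = \<tau> - \<sigma>"
  have d: "\<delta> > 0" using assms by (simp add: \<delta>_def)
  show "summable (\<lambda>n. (1 / \<delta>) * (norm (a (Suc n)) / real (Suc n) powr \<sigma>))"
    using assms(1) unfolding dser_abs_def by (rule summable_mult)
  fix n
  have ln: "ln (real (Suc n)) \<le> real (Suc n) powr \<delta> / \<delta>"
    using d by (intro ln_powr_bound) auto
  have "norm (norm (of_real (ln (real (Suc n))) * a (Suc n)) / real (Suc n) powr \<tau>)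
        = ln (real (Suc n)) * (norm (a (Suc n)) / real (Suc n) powr \<tau>)"
    by (simp add: norm_mult del: of_nat_Suc)
  also have "\<dots> \<le> (real (Suc n) powr \<delta> / \<delta>) * (norm (a (Suc n)) / real (Suc n) powr \<tau>)"
    by (intro mult_right_mono ln) auto
  also have "\<dots> = (1 / \<delta>) * (norm (a (Suc n)) / real (Suc n) powr \<sigma>)"
    by (simp add: \<delta>_def powr_diff del: of_nat_Suc)
  finally show "norm (norm (of_real (ln (real (Suc n))) * a (Suc n)) / real (Suc n) powr \<tau>)
        \<le> (1 / \<delta>) * (norm (a (Suc n)) / real (Suc n) powr \<sigma>)" .
qed

lemma has_field_derivative_dser:
  assumes "dser_abs a \<sigma>" "\<sigma> < Re s"
  shows "(dser a has_field_derivative - dser (\<lambda>n. of_real (ln (real n)) * a n) s) (at s)"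
proof -
  \<comment> \<open>The gap from \<open>\<sigma>\<close> to \<open>\<tau>\<close> absorbs the
    logarithm produced by differentiation; the gap from \<open>\<tau>\<close> to \<open>Re s\<close>
    makes \<open>s\<close> an interior point of the half-plane of uniform convergence.\<close>
  define \<tau> where "\<tau> = (\<sigma> + Re s) / 2"
  have \<tau>: "\<sigma> < \<tau>" "\<tau> < Re s" using assms(2) by (auto simp: \<tau>_def)
  define S where "S = {s. \<tau> \<le> Re s}"
  define l where "l n = of_real (ln (real n)) * a n" for n
  note abs_l = dser_abs_ln[OF assms(1) \<tau>(1), folded l_def]
  have "((\<lambda>s. \<Sum>n. a (Suc n) / of_nat (Suc n) powr s) has_field_derivative
          (\<Sum>n. - (l (Suc n) / of_nat (Suc n) powr s))) (at s)"
  proof (rule has_field_derivative_series'(2)[where S = S and x = s and x0 = s])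
    show "convex S" unfolding S_def by (rule convex_halfspace_Re_ge)
    show "s \<in> S" using \<tau> by (simp add: S_def)
    show "s \<in> interior S"
      using \<tau> by (intro interiorI[where T = "{s. \<tau> < Re s}"]) (auto simp: open_halfspace_Re_gt S_def)
    show "summable (\<lambda>n. a (Suc n) / of_nat (Suc n) powr s)"
      using dser_abs_norm_summable[OF assms(1), of s] assms(2)
      by (intro summable_norm_cancel[OF dser_abs_norm_summable[OF assms(1)]]) simp
    show "uniformly_convergent_on S (\<lambda>n x. \<Sum>i<n. - (l (Suc i) / of_nat (Suc i) powr x))"
    proof (rule Weierstrass_m_test')
      fix n x assume "x \<in> S"
      thus "norm (- (l (Suc n) / of_nat (Suc n) powr x)) \<le> norm (l (Suc n)) / real (Suc n) powr \<tau>"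
        using dser_abs_bound_term[of \<tau> x l n] by (simp add: S_def del: of_nat_Suc)
    qed (use abs_l in \<open>simp add: dser_abs_def\<close>)
    fix n x assume "x \<in> S"
    show "((\<lambda>s. a (Suc n) / of_nat (Suc n) powr s) has_field_derivative
            - (l (Suc n) / of_nat (Suc n) powr x)) (at x within S)"
      unfolding dser_term_exp by (auto intro!: derivative_eq_intros simp: l_def simp del: of_nat_Suc)
  qed
  moreover have "(\<Sum>n. - (l (Suc n) / of_nat (Suc n) powr s)) = - dser l s"
    unfolding dser_def using \<tau>
    by (intro suminf_minus summable_norm_cancel[OF dser_abs_norm_summable[OF abs_l]]) simp
  ultimately show ?thesis
    unfolding l_def dser_def[abs_def] by simp
qed

lemma holomorphic_dser:
  assumes "dser_abs a \<sigma>" "S \<subseteq> {s. \<sigma> < Re s}"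
  shows "dser a holomorphic_on S"
  unfolding holomorphic_on_def field_differentiable_def
proof
  fix s assume "s \<in> S"
  hence "\<sigma> < Re s" using assms(2) by auto
  from has_field_derivative_dser[OF assms(1) this]
  show "\<exists>f'. (dser a has_field_derivative f') (at s within S)"
    by (intro exI) (rule has_field_derivative_at_within)
qed

section \<open>Mean values on vertical lines and recovery of coefficients\<close>

lemma integral_cis:
  fixes \<omega> :: real
  assumes "T \<ge> 0"
  shows "integral {0..T} (\<lambda>t. exp (\<i> * of_real (\<omega> * t))) =
         (if \<omega> = 0 then of_real T else (exp (\<i> * of_real (\<omega> * T)) - 1) / (\<i> * of_real \<omega>))"
proof (cases "\<omega> = 0")
  case True
  thus ?thesis using assms by (simp add: scaleR_conv_of_real)
next
  case False
  have "((\<lambda>t. exp (\<i> * of_real (\<omega> * t))) has_integral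
          (exp (\<i> * of_real (\<omega> * T)) / (\<i> * of_real \<omega>) - exp (\<i> * of_real (\<omega> * 0)) / (\<i> * of_real \<omega>))) {0..T}"
    using assms False
    by (intro fundamental_theorem_of_calculus)
       (auto intro!: derivative_eq_intros has_vector_derivative_real_field
             simp: field_simps simp flip: has_real_derivative_iff_has_vector_derivative)
  thus ?thesis using False by (simp add: integral_unique diff_divide_distrib)
qed

text \<open>Oscillating terms average to 0 and every mean has modulus at most 1, so the absolutely
  convergent coefficients dominate and Tannery's theorem moves the limit inside the sum.\<close>

lemma mean_value_exp_series:
  fixes c :: "nat \<Rightarrow> complex" and \<omega> :: "nat \<Rightarrow> real"
  assumes "summable (\<lambda>n. norm (c n))"
  shows "((\<lambda>T. integral {0..T} (\<lambda>t. \<Sum>n. c n * exp (\<i> * of_real (\<omega> n * t))) / of_real T)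
            \<longlongrightarrow> (\<Sum>n. if \<omega> n = 0 then c n else 0)) at_top"
proof -
  \<comment> \<open>The mean of the \<open>n\<close>-th exponential over
    \<open>[0, T]\<close>.\<close>
  define k where "k n T = (if \<omega> n = 0 then 1 else (exp (\<i> * of_real (\<omega> n * T)) - 1) / (\<i> * of_real (\<omega> n * T)))" for n T
  have k_eq: "integral {0..T} (\<lambda>t. exp (\<i> * of_real (\<omega> n * t))) = of_real T * k n T" if "T > 0" for n T
    unfolding k_def integral_cis[OF less_imp_le[OF that]] using that by simp
  have k_le: "norm (k n T) \<le> 1" if "T > 0" for n T
  proof -
    have "norm (integral {0..T} (\<lambda>t. exp (\<i> * of_real (\<omega> n * t)))) \<le> integral {0..T} (\<lambda>t. 1)"
      by (intro integral_norm_bound_integral integrable_continuous_interval continuous_intros) auto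
    thus ?thesis using that unfolding k_eq[OF that] by (simp add: norm_mult)
  qed
  have k_lim: "((\<lambda>T. k n T) \<longlongrightarrow> (if \<omega> n = 0 then 1 else 0)) at_top" for n
  proof (cases "\<omega> n = 0")
    case False
    have "((\<lambda>T. k n T) \<longlongrightarrow> 0) at_top"
    proof (rule Lim_null_comparison)
      show "eventually (\<lambda>T. norm (k n T) \<le> (2 / \<bar>\<omega> n\<bar>) / T) at_top"
        using eventually_gt_at_top[of "0::real"]
      proof eventually_elim
        case (elim T)
        have "norm (exp (\<i> * of_real (\<omega> n * T)) - 1) \<le> 2"
          using norm_triangle_ineq4[of "exp (\<i> * of_real (\<omega> n * T))" 1] by simp
        thus ?case using False elim by (simp add: k_def norm_divide norm_mult abs_mult divide_right_mono)
      qed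
      show "((\<lambda>T. (2 / \<bar>\<omega> n\<bar>) / T) \<longlongrightarrow> 0) at_top" by real_asymp
    qed
    thus ?thesis using False by simp
  qed (simp add: k_def)
  have "((\<lambda>T. (\<Sum>n. c n * k n T)) \<longlongrightarrow> (\<Sum>n. c n * (if \<omega> n = 0 then 1 else 0))) at_top"
  proof (rule tannerys_theorem[where M = "\<lambda>n. norm (c n)", THEN conjunct2, THEN conjunct2])
    show "((\<lambda>T. c n * k n T) \<longlongrightarrow> c n * (if \<omega> n = 0 then 1 else 0)) at_top" for n
      by (intro tendsto_mult tendsto_const k_lim)
    have "eventually (\<lambda>(n::nat, T::real). T > 0) (at_top \<times>\<^sub>F at_top)"
      using eventually_prodI[OF eventually_True[of "at_top :: nat filter"] eventually_gt_at_top[of "0::real"]]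
      by (simp add: case_prod_unfold)
    thus "eventually (\<lambda>(n, T). norm (c n * k n T) \<le> norm (c n)) (at_top \<times>\<^sub>F at_top)"
    proof eventually_elim
      case (elim x)
      thus ?case using k_le[of "snd x" "fst x"] by (auto simp: norm_mult mult_left_le split: prod.splits)
    qed
  qed (use assms in auto)
  also have "(\<lambda>n. c n * (if \<omega> n = 0 then 1 else 0)) = (\<lambda>n. if \<omega> n = 0 then c n else 0)"
    by auto
  finally have lim: "((\<lambda>T. \<Sum>n. c n * k n T) \<longlongrightarrow> (\<Sum>n. if \<omega> n = 0 then c n else 0)) at_top" .
  have "eventually (\<lambda>T. (\<Sum>n. c n * k n T) = integral {0..T} (\<lambda>t. \<Sum>n. c n * exp (\<i> * of_real (\<omega> n * t))) / of_real T) at_top"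
    using eventually_gt_at_top[of "0::real"]
  proof eventually_elim
    case (elim T)
    have ul: "uniform_limit {0..T} (\<lambda>N t. \<Sum>n<N. c n * exp (\<i> * of_real (\<omega> n * t)))
        (\<lambda>t. \<Sum>n. c n * exp (\<i> * of_real (\<omega> n * t))) sequentially"
      by (rule Weierstrass_m_test[OF _ assms]) (simp add: norm_mult)
    obtain I J where IJ: "\<And>N. ((\<lambda>t. \<Sum>n<N. c n * exp (\<i> * of_real (\<omega> n * t))) has_integral I N) {0..T}"
        "((\<lambda>t. \<Sum>n. c n * exp (\<i> * of_real (\<omega> n * t))) has_integral J) {0..T}" "I \<longlonglongrightarrow> J"
      by (rule uniform_limit_integral[OF ul]) (auto intro!: continuous_intros)
    have "I N = (\<Sum>n<N. of_real T * (c n * k n T))" for N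
    proof -
      have "I N = integral {0..T} (\<lambda>t. \<Sum>n<N. c n * exp (\<i> * of_real (\<omega> n * t)))"
        by (rule integral_unique[OF IJ(1), symmetric])
      also have "\<dots> = (\<Sum>n<N. integral {0..T} (\<lambda>t. c n * exp (\<i> * of_real (\<omega> n * t))))"
        by (intro integral_sum integrable_continuous_interval continuous_intros) auto
      also have "\<dots> = (\<Sum>n<N. of_real T * (c n * k n T))"
        by (intro sum.cong refl) (simp add: k_eq[OF elim] mult.left_commute del: of_real_mult)
      finally show ?thesis .
    qed
    hence "I = (\<lambda>N. \<Sum>n<N. of_real T * (c n * k n T))" by (intro ext)
    hence "(\<lambda>n. of_real T * (c n * k n T)) sums J"
      using IJ(3) unfolding sums_def by simp
    hence "J = (\<Sum>n. of_real T * (c n * k n T))" by (simp add: sums_iff)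
    also have "\<dots> = of_real T * (\<Sum>n. c n * k n T)"
    proof (rule suminf_mult)
      show "summable (\<lambda>n. c n * k n T)"
        by (rule summable_comparison_test'[OF assms, of 0])
           (use k_le elim in \<open>auto simp: norm_mult mult_left_le\<close>)
    qed
    finally have "J / of_real T = (\<Sum>n. c n * k n T)" using elim by simp
    thus ?case using integral_unique[OF IJ(2)] by simp
  qed
  with lim show ?thesis by (rule Lim_transform_eventually)
qed

text \<open>The extra exponential gives the \<open>m\<close>-th term the frequency
  \<open>ln n - ln m\<close>, which vanishes only for \<open>m = n\<close>.\<close>

lemma dser_mean_value:
  assumes "dser_abs a \<sigma>" "n \<ge> 1"
  shows "((\<lambda>T. integral {0..T} (\<lambda>t. dser a (Complex \<sigma> t) * exp (\<i> * of_real (ln (real n) * t))) / of_real T)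
            \<longlongrightarrow> a n / of_real (real n powr \<sigma>)) at_top"
proof -
  define c where "c m = a (Suc m) / of_real (real (Suc m) powr \<sigma>)" for m
  define \<omega> where "\<omega> m = ln (real n) - ln (real (Suc m))" for m
  have c: "summable (\<lambda>m. norm (c m))"
    using assms(1) by (simp add: dser_abs_def c_def norm_divide del: of_nat_Suc)
  have eq: "dser a (Complex \<sigma> t) * exp (\<i> * of_real (ln (real n) * t)) =
        (\<Sum>m. c m * exp (\<i> * of_real (\<omega> m * t)))" for t
  proof -
    have sm: "summable (\<lambda>m. a (Suc m) / of_nat (Suc m) powr Complex \<sigma> t)"
      by (intro summable_norm_cancel[OF dser_abs_norm_summable[OF assms(1)]]) simp
    have "a (Suc m) / of_nat (Suc m) powr Complex \<sigma> t * exp (\<i> * of_real (ln (real n) * t)) =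
          c m * exp (\<i> * of_real (\<omega> m * t))" for m
    proof -
      have "of_real (real (Suc m) powr \<sigma>) = exp (of_real (\<sigma> * ln (real (Suc m))) :: complex)"
        by (simp add: powr_def del: of_nat_Suc of_real_mult flip: exp_of_real)
      hence c: "c m = a (Suc m) * exp (- of_real (\<sigma> * ln (real (Suc m))))"
        by (simp add: c_def exp_minus field_simps del: of_nat_Suc)
      have "- (of_real (ln (real (Suc m))) * Complex \<sigma> t) + \<i> * of_real (ln (real n) * t) =
            - of_real (\<sigma> * ln (real (Suc m))) + \<i> * of_real (\<omega> m * t)"
        by (simp add: \<omega>_def complex_eq_iff algebra_simps del: of_nat_Suc)
      thus ?thesis unfolding dser_term_exp c by (simp add: mult.assoc flip: exp_add del: of_nat_Suc)
    qed
    thus ?thesis unfolding dser_def by (simp add: suminf_mult2[OF sm] del: of_nat_Suc)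
  qed
  \<comment> \<open>The series is indexed from 0, so the coefficient of \<open>n\<close> sits at
    position \<open>n - 1\<close>.\<close>
  have "(\<Sum>m. if \<omega> m = 0 then c m else 0) = (\<Sum>m. if m = n - 1 then c m else 0)"
    using assms(2) by (intro arg_cong[where f = suminf] ext) (auto simp: \<omega>_def simp del: of_nat_Suc)
  also have "\<dots> = c (n - 1)" using sums_single[of "n - 1" c] by (simp add: sums_iff)
  also have "\<dots> = a n / of_real (real n powr \<sigma>)" using assms(2) by (simp add: c_def)
  finally show ?thesis
    using mean_value_exp_series[OF c, of \<omega>] unfolding eq by simp
qed

lemma continuous_on_dser_line:
  assumes "dser_abs a \<sigma>0" "\<sigma>0 < \<sigma>"
  shows "continuous_on S (\<lambda>t. dser a (Complex \<sigma> t))"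
proof -
  have "continuous_on {s. \<sigma>0 < Re s} (dser a)"
    by (intro holomorphic_on_imp_continuous_on holomorphic_dser[OF assms(1)]) auto
  moreover have "continuous_on S (\<lambda>t. Complex \<sigma> t)"
    unfolding Complex_eq by (intro continuous_intros)
  ultimately show ?thesis
    by (rule continuous_on_compose2) (use assms in auto)
qed

text \<open>A Cauchy-type estimate: the coefficient is a mean value, hence controlled by the
  supremum over the line. Applied on lines far to the left it makes coefficients vanish in degree
  0.\<close>

lemma dser_coeff_bound:
  assumes "dser_abs a \<sigma>0" "\<sigma>0 < \<sigma>" "\<And>t. norm (dser a (Complex \<sigma> t)) \<le> M" "n \<ge> 1"
  shows "norm (a n) \<le> M * real n powr \<sigma>"
proof -
  have "norm (a n / of_real (real n powr \<sigma>)) \<le> M"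
  proof (rule Lim_norm_ubound)
    show "((\<lambda>T. integral {0..T} (\<lambda>t. dser a (Complex \<sigma> t) * exp (\<i> * of_real (ln (real n) * t))) / of_real T)
            \<longlongrightarrow> a n / of_real (real n powr \<sigma>)) at_top"
      using dser_mean_value[OF dser_abs_mono[OF assms(1)], of \<sigma> n] assms by auto
    show "eventually (\<lambda>T. norm (integral {0..T} (\<lambda>t. dser a (Complex \<sigma> t) *
             exp (\<i> * of_real (ln (real n) * t))) / of_real T) \<le> M) at_top"
      using eventually_gt_at_top[of "0::real"]
    proof eventually_elim
      case (elim T)
      have "norm (integral {0..T} (\<lambda>t. dser a (Complex \<sigma> t) * exp (\<i> * of_real (ln (real n) * t))))
            \<le> integral {0..T} (\<lambda>t. M)"
        by (intro integral_norm_bound_integral integrable_continuous_interval continuous_intros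
              continuous_on_dser_line[OF assms(1,2)]) (auto simp: norm_mult assms(3))
      thus ?case using elim by (simp add: norm_divide field_simps)
    qed
  qed auto
  thus ?thesis using assms(4) by (simp add: norm_divide field_simps)
qed

lemma dser_unique:
  assumes "dser_abs a \<sigma>" "dser_abs b \<sigma>" "\<And>s. Re s > \<sigma> \<Longrightarrow> dser a s = dser b s" "n \<ge> 1"
  shows "a n = b n"
proof -
  \<comment> \<open>Agreement is assumed only strictly to the right of \<open>\<sigma>\<close>, so
    the coefficients are compared on the line \<open>\<sigma> + 1\<close>.\<close>
  note ab = assms(1,2)[THEN dser_abs_mono, of "\<sigma> + 1"]
  have "((\<lambda>T. integral {0..T} (\<lambda>t. dser a (Complex (\<sigma>+1) t) * exp (\<i> * of_real (ln (real n) * t))) / of_real T)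
            \<longlongrightarrow> a n / of_real (real n powr (\<sigma>+1))) at_top"
    using ab assms(4) by (intro dser_mean_value) auto
  moreover have "((\<lambda>T. integral {0..T} (\<lambda>t. dser b (Complex (\<sigma>+1) t) * exp (\<i> * of_real (ln (real n) * t))) / of_real T)
            \<longlongrightarrow> b n / of_real (real n powr (\<sigma>+1))) at_top"
    using ab assms(4) by (intro dser_mean_value) auto
  ultimately have "a n / of_real (real n powr (\<sigma>+1)) = b n / of_real (real n powr (\<sigma>+1))"
    using assms(3) by (intro tendsto_unique[of at_top]) auto
  thus ?thesis using assms(4) by simp
qed

section \<open>Dirichlet convolution and the logarithm of a Dirichlet series\<close>

definition dconv :: "(nat \<Rightarrow> complex) \<Rightarrow> (nat \<Rightarrow> complex) \<Rightarrow> nat \<Rightarrow> complex" where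
  "dconv a b n = (\<Sum>d | d dvd n. a d * b (n div d))"

lemma dconv_prime:
  assumes "prime p"
  shows "dconv a b p = a 1 * b p + a p * b 1"
proof -
  have "{d. d dvd p} = {1, p}" using assms by (auto simp: prime_nat_iff)
  moreover have "p \<noteq> 1" "p > 0" using assms prime_gt_0_nat by auto
  ultimately show ?thesis unfolding dconv_def by (simp del: One_nat_def)
qed

text \<open>Over the positive integers as an unordered index set, the double sum of a product can be
  regrouped by divisors without tracking partial sums.\<close>

lemma dser_has_sum:
  assumes "dser_abs a \<sigma>" "\<sigma> \<le> Re s"
  shows "((\<lambda>n. a n / of_nat n powr s) has_sum dser a s) {1..}"
proof -
  have "((\<lambda>n. a (Suc n) / of_nat (Suc n) powr s) has_sum dser a s) UNIV"
    unfolding dser_def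
    by (rule norm_summable_imp_has_sum[OF dser_abs_norm_summable[OF assms]])
       (rule summable_sums[OF summable_norm_cancel[OF dser_abs_norm_summable[OF assms]]])
  moreover have "bij_betw Suc UNIV {1..}"
    by (rule bij_betwI[where g = "\<lambda>n. n - 1"]) auto
  ultimately show ?thesis
    using has_sum_reindex_bij_betw[of Suc UNIV "{1..}" "\<lambda>n. a n / of_nat n powr s" "dser a s"] by simp
qed

lemma dser_abs_has_sumI:
  assumes "((\<lambda>n. a n / of_nat n powr s) has_sum S) {1..}"
  shows "dser_abs a (Re s)" "dser a s = S"
proof -
  have "bij_betw Suc UNIV {1..}"
    by (rule bij_betwI[where g = "\<lambda>n. n - 1"]) auto
  hence hs: "((\<lambda>n. a (Suc n) / of_nat (Suc n) powr s) has_sum S) UNIV"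
    using has_sum_reindex_bij_betw[of Suc UNIV "{1..}" "\<lambda>n. a n / of_nat n powr s" S] assms by simp
  hence "(\<lambda>n. norm (a (Suc n) / of_nat (Suc n) powr s)) summable_on UNIV"
    by (intro summable_on_iff_abs_summable_on_complex[THEN iffD1] has_sum_imp_summable)
  hence "summable (\<lambda>n. norm (a (Suc n) / of_nat (Suc n) powr s))"
    by (subst (asm) summable_on_UNIV_nonneg_real_iff) auto
  thus "dser_abs a (Re s)" by (simp only: dser_abs_def norm_dser_term)
  show "dser a s = S" using has_sum_imp_sums[OF hs] unfolding dser_def by (simp add: sums_iff)
qed

lemma dser_mult:
  assumes "dser_abs a (Re s)" "dser_abs b (Re s)"
  shows "dser_abs (dconv a b) (Re s)" "dser (dconv a b) s = dser a s * dser b s"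
proof -
  define P :: "nat set" where "P = {1..}"
  define f where "f n = a n / of_nat n powr s" for n :: nat
  define g where "g n = b n / of_nat n powr s" for n :: nat
  have f: "(f has_sum dser a s) P" and g: "(g has_sum dser b s) P"
    using assms[THEN dser_has_sum, of s] by (auto simp: f_def[abs_def] g_def[abs_def] P_def)
  have fa: "(\<lambda>n. norm (f n)) summable_on P" and ga: "(\<lambda>n. norm (g n)) summable_on P"
    by (rule summable_on_iff_abs_summable_on_complex[THEN iffD1, OF has_sum_imp_summable[OF f]],
        rule summable_on_iff_abs_summable_on_complex[THEN iffD1, OF has_sum_imp_summable[OF g]])
  have "(\<lambda>x. norm (case x of (m, n) \<Rightarrow> f m * g n)) summable_on (P \<times> P)"
  proof (rule Infinite_Sum.abs_summable_on_Sigma_iff[THEN iffD2], intro conjI ballI)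
    fix m show "(\<lambda>n. norm (case (m, n) of (m, n) \<Rightarrow> f m * g n)) summable_on P"
      using ga by (simp add: norm_mult summable_on_cmult_right)
    have "(\<lambda>m. norm (f m) * (\<Sum>\<^sub>\<infinity>n\<in>P. norm (g n))) summable_on P"
      using fa by (intro summable_on_cmult_left)
    thus "(\<lambda>m. norm (\<Sum>\<^sub>\<infinity>n\<in>P. norm (case (m, n) of (m, n) \<Rightarrow> f m * g n))) summable_on P"
      by (simp add: norm_mult infsum_cmult_right' infsum_nonneg)
  qed
  hence "(\<lambda>(m, n). f m * g n) summable_on (P \<times> P)"
    by (rule abs_summable_summable)
  hence "((\<lambda>(m, n). f m * g n) has_sum (dser a s * dser b s)) (P \<times> P)"
    by (intro has_sum_SigmaI[where g = "\<lambda>m. f m * dser b s"] has_sum_cmult_left f)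
       (auto intro: has_sum_cmult_right g)
  \<comment> \<open>Pairs of positive integers correspond to pairs of a product and one of its
    divisors through \<open>(m * n, m)\<close>; summing over the divisor yields the
    convolution.\<close>
  also have "?this \<longleftrightarrow> ((\<lambda>(n, d). f d * g (n div d)) has_sum (dser a s * dser b s)) (Sigma P (\<lambda>n. {d. d dvd n}))"
    by (intro has_sum_reindex_bij_witness[where j = "\<lambda>(m, n). (m * n, m)" and i = "\<lambda>(n, d). (d, n div d)"])
       (auto simp: P_def Suc_le_eq intro!: Nat.gr0I elim!: dvdE)
  finally have "((\<lambda>n. \<Sum>d | d dvd n. f d * g (n div d)) has_sum (dser a s * dser b s)) P"
    by (rule has_sum_SigmaD) (auto simp: P_def intro!: has_sum_finiteI)
  also have "?this \<longleftrightarrow> ((\<lambda>n. dconv a b n / of_nat n powr s) has_sum (dser a s * dser b s)) P"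
  proof (intro has_sum_cong)
    fix n assume n: "n \<in> P"
    have "f d * g (n div d) = a d * b (n div d) / of_nat n powr s" if "d dvd n" for d
    proof -
      from that obtain k where k: "n = d * k" by auto
      have "(of_nat n :: complex) powr s = of_nat d powr s * of_nat k powr s"
        unfolding k of_nat_mult by (rule powr_times_real) auto
      thus ?thesis using n by (simp add: f_def g_def k P_def)
    qed
    thus "(\<Sum>d | d dvd n. f d * g (n div d)) = dconv a b n / of_nat n powr s"
      unfolding dconv_def sum_divide_distrib by (intro sum.cong) auto
  qed
  finally show "dser_abs (dconv a b) (Re s)" "dser (dconv a b) s = dser a s * dser b s"
    unfolding P_def by (rule dser_abs_has_sumI)+
qed

text \<open>Differentiating \<open>exp B = A\<close> gives \<open>A' = A B'\<close>; a derivative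
  multiplies the coefficients by \<open>- ln n\<close>, and uniqueness compares both sides. It lets
  the vanishing of \<open>a\<close> on the powers of a prime pass to \<open>b\<close>.\<close>

lemma exp_dser_recursion:
  assumes "dser_abs a \<sigma>" "dser_abs b \<sigma>" "\<And>s. Re s > \<sigma> \<Longrightarrow> exp (dser b s) = dser a s" "n \<ge> 1"
  shows "of_real (ln (real n)) * a n = dconv a (\<lambda>n. of_real (ln (real n)) * b n) n"
proof -
  define la where "la = (\<lambda>n. of_real (ln (real n)) * a n)"
  define lb where "lb = (\<lambda>n. of_real (ln (real n)) * b n)"
  have absa: "dser_abs la \<tau>" and absb: "dser_abs lb \<tau>" if "\<tau> > \<sigma>" for \<tau>
    unfolding la_def lb_def using assms(1,2) that by (auto intro: dser_abs_ln)
  have eq: "dser la s = dser (dconv a lb) s" if s: "Re s > \<sigma>" for s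
  proof -
    have "((\<lambda>s. exp (dser b s)) has_field_derivative (exp (dser b s) * - dser lb s)) (at s)"
      unfolding lb_def by (intro DERIV_fun_exp has_field_derivative_dser[OF assms(2) s])
    hence "(dser a has_field_derivative (dser a s * - dser lb s)) (at s)"
      unfolding assms(3)[OF s] 
      by (rule has_field_derivative_transform_within_open[where S = "{s. \<sigma> < Re s}"])
         (use assms(3) s in \<open>auto simp: open_halfspace_Re_gt\<close>)
    moreover have "(dser a has_field_derivative (- dser la s)) (at s)"
      unfolding la_def by (rule has_field_derivative_dser[OF assms(1) s])
    ultimately have "dser la s = dser a s * dser lb s"
      using DERIV_unique by fastforce
    also have "\<dots> = dser (dconv a lb) s"
      using s by (intro dser_mult(2)[symmetric] absb dser_abs_mono[OF assms(1)]) auto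
    finally show ?thesis .
  qed
  have "dser_abs (dconv a lb) (Re (of_real (\<sigma> + 1)))"
    by (rule dser_mult(1)) (auto intro!: absb dser_abs_mono[OF assms(1)])
  with absa[of "\<sigma> + 1"] eq have "la n = dconv a lb n"
    by (intro dser_unique[of la "\<sigma> + 1" "dconv a lb"] assms(4)) auto
  thus ?thesis by (simp add: la_def lb_def)
qed

lemma dser_abs_bigo:
  assumes "(\<lambda>n. norm (a n)) \<in> O(\<lambda>n. real n powr \<theta>)" "\<sigma> > 1 + \<theta>"
  shows "dser_abs a \<sigma>"
proof -
  have "(\<lambda>n. norm (a n) / real n powr \<sigma>) \<in> O(\<lambda>n. real n powr (\<theta> - \<sigma>))"
    unfolding powr_diff by (intro landau_o.big.divide assms bigthetaD1 bigtheta_refl)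
      (use assms in \<open>auto simp: eventually_at_top_linorder intro!: exI[of _ 1]\<close>)
  moreover have "summable (\<lambda>n. norm (real n powr (\<theta> - \<sigma>)))"
    using assms(2) by (simp add: summable_real_powr_iff)
  ultimately have "summable (\<lambda>n. norm (a n) / real n powr \<sigma>)"
    by (rule summable_comparison_test_bigo[rotated])
  thus ?thesis unfolding dser_abs_def by (subst summable_Suc_iff)
qed

lemma dser_abs_ramanujan:
  assumes "ramanujan_hypothesis a" "\<sigma> > 1"
  shows "dser_abs a \<sigma>"
proof (rule dser_abs_bigo)
  show "(\<lambda>n. norm (a n)) \<in> O(\<lambda>n. real n powr ((\<sigma> - 1) / 2))"
    using assms by (auto simp: ramanujan_hypothesis_def)
qed (use assms in \<open>simp add: field_simps\<close>)

section \<open>Vertical growth of the gamma factors\<close>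

text \<open>
  By the product formula, \<open>|\<Gamma>(x + iy)| / \<Gamma>(x)\<close> is the infinite product of the
  factors \<open>(x + j) / |x + j + iy|\<close>, each of which increases with \<open>x\<close>.
\<close>

lemma norm_Gamma_ratio_mono:
  fixes x x' y :: real
  assumes "0 < x" "x \<le> x'"
  shows "norm (Gamma (Complex x y)) / Gamma x \<le> norm (Gamma (Complex x' y)) / Gamma x'"
proof (rule LIMSEQ_le)
  have lim: "(\<lambda>n. norm (Gamma_series (Complex u y) n) / Gamma_series u n)
        \<longlonglongrightarrow> norm (Gamma (Complex u y)) / Gamma u" if "u > 0" for u
    using Gamma_real_pos[OF that] by (intro tendsto_intros) auto
  show "(\<lambda>n. norm (Gamma_series (Complex x y) n) / Gamma_series x n)
        \<longlonglongrightarrow> norm (Gamma (Complex x y)) / Gamma x"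
       "(\<lambda>n. norm (Gamma_series (Complex x' y) n) / Gamma_series x' n)
        \<longlonglongrightarrow> norm (Gamma (Complex x' y)) / Gamma x'"
    using assms by (auto intro!: lim)
  \<comment> \<open>In the quotient the factorial cancels, and so does the power of
    \<open>n\<close>, whose modulus depends only on the real part of the exponent.\<close>
  have eq: "norm (Gamma_series (Complex u y) n) / Gamma_series u n =
        (\<Prod>j = 0..<Suc n. (u + real j) / norm (Complex (u + real j) y))" if "u > 0" for u n
  proof -
    have "norm (pochhammer (Complex u y) (Suc n)) = (\<Prod>j = 0..<Suc n. norm (Complex (u + real j) y))"
      unfolding pochhammer_prod prod_norm [symmetric]
      by (intro prod.cong arg_cong[where f = norm]) (auto simp: complex_eq_iff)
    moreover have "pochhammer u (Suc n) = (\<Prod>j = 0..<Suc n. u + real j)"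
      unfolding pochhammer_prod by simp
    moreover have "norm (exp (Complex u y * of_real (ln (real n)))) = exp (u * ln (real n))"
      by simp
    ultimately show ?thesis
      unfolding Gamma_series_def norm_divide norm_mult
      by (simp add: prod_dividef field_simps flip: Suc_eq_plus1 del: prod.op_ivl_Suc)
  qed
  have "(x + real j) / norm (Complex (x + real j) y) \<le> (x' + real j) / norm (Complex (x' + real j) y)" for j
  proof -
    define u v where "u = x + real j" and "v = x' + real j"
    have uv: "0 < u" "u \<le> v" using assms by (auto simp: u_def v_def)
    have "u * norm (Complex v y) \<le> v * norm (Complex u y)"
    proof (rule power2_le_imp_le)
      have "u\<^sup>2 * y\<^sup>2 \<le> v\<^sup>2 * y\<^sup>2" using uv by (intro mult_right_mono power_mono) auto
      thus "(u * norm (Complex v y))\<^sup>2 \<le> (v * norm (Complex u y))\<^sup>2"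
        by (simp add: power_mult_distrib cmod_power2 algebra_simps)
    qed (use uv in auto)
    moreover have "norm (Complex u y) > 0" "norm (Complex v y) > 0"
      using uv by (auto simp: complex_eq_iff)
    ultimately show ?thesis unfolding u_def[symmetric] v_def[symmetric]
      by (simp add: field_simps)
  qed
  thus "\<exists>N. \<forall>n\<ge>N. norm (Gamma_series (Complex x y) n) / Gamma_series x n
          \<le> norm (Gamma_series (Complex x' y) n) / Gamma_series x' n"
    using assms by (auto simp: eq simp del: prod.op_ivl_Suc intro!: prod_mono)
qed

lemma not_nonpos_Ints_Im: "Im z \<noteq> 0 \<Longrightarrow> z \<notin> \<int>\<^sub>\<le>\<^sub>0"
  by (auto elim!: nonpos_Ints_cases)

text \<open>Each factor \<open>x + j + i y\<close> has modulus between \<open>\<bar>y\<bar>\<close>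
  and a constant times \<open>\<bar>y\<bar>\<close>. Since \<open>Gamma (z + N)\<close> is
  \<open>Gamma z\<close> times this product, shifts by integers are settled.\<close>

lemma norm_pochhammer_bounds:
  assumes "\<bar>y\<bar> \<ge> 1"
  shows "\<bar>y\<bar> ^ N \<le> norm (pochhammer (Complex x y) N)"
    and "norm (pochhammer (Complex x y) N) \<le> (\<bar>x\<bar> + real N + 1) ^ N * \<bar>y\<bar> ^ N"
proof -
  have eq: "norm (pochhammer (Complex x y) N) = (\<Prod>j = 0..<N. norm (Complex (x + real j) y))"
    unfolding pochhammer_prod prod_norm [symmetric]
    by (intro prod.cong arg_cong[where f = norm]) (auto simp: complex_eq_iff)
  have "(\<Prod>j = 0..<N. \<bar>y\<bar>) \<le> (\<Prod>j = 0..<N. norm (Complex (x + real j) y))"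
    using abs_Im_le_cmod[of "Complex _ y"] by (intro prod_mono) auto
  thus "\<bar>y\<bar> ^ N \<le> norm (pochhammer (Complex x y) N)" by (simp add: eq)
  have "(\<Prod>j = 0..<N. norm (Complex (x + real j) y)) \<le> (\<Prod>j = 0..<N. (\<bar>x\<bar> + real N + 1) * \<bar>y\<bar>)"
  proof (intro prod_mono conjI)
    fix j assume j: "j \<in> {0..<N}"
    have "norm (Complex (x + real j) y) \<le> \<bar>x + real j\<bar> + \<bar>y\<bar>"
      using cmod_le[of "Complex (x + real j) y"] by simp
    also have "\<dots> \<le> (\<bar>x\<bar> + real N) * 1 + \<bar>y\<bar>" using j by auto
    also have "\<dots> \<le> (\<bar>x\<bar> + real N) * \<bar>y\<bar> + \<bar>y\<bar>"
      using assms by (intro add_right_mono mult_left_mono) auto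
    finally show "norm (Complex (x + real j) y) \<le> (\<bar>x\<bar> + real N + 1) * \<bar>y\<bar>"
      by (simp add: algebra_simps)
  qed auto
  thus "norm (pochhammer (Complex x y) N) \<le> (\<bar>x\<bar> + real N + 1) ^ N * \<bar>y\<bar> ^ N"
    by (simp add: eq power_mult_distrib)
qed

text \<open>The recurrence handles shifts by the floor and the ceiling of \<open>h\<close>; the
  monotone quotient of \<open>norm_Gamma_ratio_mono\<close> squeezes the shift by \<open>h\<close>
  between them. Rounding costs at most one power of \<open>\<bar>y\<bar>\<close>, hence the
  exponents \<open>h - 1\<close> and \<open>h + 1\<close>.\<close>

lemma Gamma_shift_bounds:
  fixes x h :: real
  assumes h: "h \<ge> 0" "x + h > 1"
  obtains c C :: real where "c > 0" "C > 0"
    "\<And>y. \<bar>y\<bar> \<ge> 1 \<Longrightarrow> c * \<bar>y\<bar> powr (h - 1) * norm (Gamma (Complex x y)) \<le> norm (Gamma (Complex (x + h) y))"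
    "\<And>y. \<bar>y\<bar> \<ge> 1 \<Longrightarrow> norm (Gamma (Complex (x + h) y)) \<le> C * \<bar>y\<bar> powr (h + 1) * norm (Gamma (Complex x y))"
proof -
  define M where "M = nat \<lfloor>h\<rfloor>"
  define N where "N = nat \<lceil>h\<rceil>"
  have M: "real M \<le> h" "real M > h - 1" and N: "h \<le> real N" "real N < h + 1"
    using h unfolding M_def N_def by linarith+
  \<comment> \<open>The assumption \<open>x + h > 1\<close> places \<open>x + real M\<close> on the
    positive axis, where the monotonicity applies; \<open>x\<close> itself may be negative.\<close>
  have pos: "Gamma (x + h) > 0" "Gamma (x + real M) > 0" "Gamma (x + real N) > 0"
    using h M N by (auto intro!: Gamma_real_pos)
  have shift: "norm (Gamma (Complex (x + real n) y)) = norm (Gamma (Complex x y)) * norm (pochhammer (Complex x y) n)"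
    if "\<bar>y\<bar> \<ge> 1" for n y
  proof -
    have ni: "Complex x y \<notin> \<int>\<^sub>\<le>\<^sub>0" using that by (intro not_nonpos_Ints_Im) auto
    have "Complex (x + real n) y = Complex x y + of_nat n" by (simp add: complex_eq_iff)
    thus ?thesis using pochhammer_Gamma[OF ni, of n] ni
      by (simp add: norm_divide Gamma_eq_zero_iff)
  qed
  define c where "c = Gamma (x + h) / Gamma (x + real M)"
  define C where "C = Gamma (x + h) / Gamma (x + real N) * (\<bar>x\<bar> + real N + 1) ^ N"
  show ?thesis
  proof (rule that[of c C])
    show "c > 0" "C > 0"
      using pos by (auto simp: c_def C_def intro!: mult_pos_pos divide_pos_pos zero_less_power)
    fix y :: real assume y: "\<bar>y\<bar> \<ge> 1"
    have "c * \<bar>y\<bar> powr (h - 1) * norm (Gamma (Complex x y)) \<le> c * \<bar>y\<bar> powr (real M) * norm (Gamma (Complex x y))"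
      using y M \<open>c > 0\<close> by (intro mult_right_mono mult_left_mono powr_mono) auto
    also have "\<dots> = c * (norm (Gamma (Complex x y)) * \<bar>y\<bar> ^ M)"
      using y by (simp add: powr_realpow)
    also have "\<dots> \<le> c * (norm (Gamma (Complex x y)) * norm (pochhammer (Complex x y) M))"
      using y \<open>c > 0\<close> by (intro mult_left_mono norm_pochhammer_bounds) auto
    also have "\<dots> = c * norm (Gamma (Complex (x + real M) y))"
      using y by (simp add: shift)
    also have "\<dots> \<le> norm (Gamma (Complex (x + h) y))"
      using norm_Gamma_ratio_mono[of "x + real M" "x + h" y] pos M h
      by (simp add: c_def field_simps)
    finally show "c * \<bar>y\<bar> powr (h - 1) * norm (Gamma (Complex x y)) \<le> norm (Gamma (Complex (x + h) y))" .
    have "norm (Gamma (Complex (x + h) y)) \<le>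
          Gamma (x + h) / Gamma (x + real N) * norm (Gamma (Complex (x + real N) y))"
      using norm_Gamma_ratio_mono[of "x + h" "x + real N" y] pos N h
      by (simp add: field_simps)
    also have "\<dots> = Gamma (x + h) / Gamma (x + real N) * (norm (Gamma (Complex x y)) * norm (pochhammer (Complex x y) N))"
      using y by (simp add: shift)
    also have "\<dots> \<le> Gamma (x + h) / Gamma (x + real N) * (norm (Gamma (Complex x y)) * ((\<bar>x\<bar> + real N + 1) ^ N * \<bar>y\<bar> ^ N))"
      using y pos by (intro mult_left_mono norm_pochhammer_bounds) auto
    also have "\<dots> = C * \<bar>y\<bar> powr real N * norm (Gamma (Complex x y))"
      using y by (simp add: C_def powr_realpow)
    also have "\<dots> \<le> C * \<bar>y\<bar> powr (h + 1) * norm (Gamma (Complex x y))"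
      using y N \<open>C > 0\<close> by (intro mult_right_mono mult_left_mono powr_mono) auto
    finally show "norm (Gamma (Complex (x + h) y)) \<le> C * \<bar>y\<bar> powr (h + 1) * norm (Gamma (Complex x y))" .
  qed
qed

text \<open>The functional equation pairs the lines \<open>Re s = -A\<close> and
  \<open>Re s = 1 + A\<close>. At equal height the two arguments \<open>w s + \<mu>\<close> have the
  same imaginary part and differ by the real shift \<open>w (1 + 2 A)\<close>.\<close>

lemma Gamma_linear_bounds:
  fixes w A :: real and \<mu> :: complex
  assumes w: "w > 0" and \<mu>: "Re \<mu> \<ge> 0" and A: "A \<ge> 1 / w" "A \<ge> 0"
  obtains c C t0 :: real where "c > 0" "C > 0" "t0 \<ge> 1"
    "\<And>t. \<bar>t\<bar> \<ge> t0 \<Longrightarrow> Gamma (of_real w * Complex (-A) t + \<mu>) \<noteq> 0 \<and>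
       of_real w * Complex (-A) t + \<mu> \<notin> \<int>\<^sub>\<le>\<^sub>0 \<and> of_real w * Complex (1 + A) t + \<mu> \<notin> \<int>\<^sub>\<le>\<^sub>0 \<and>
       c * \<bar>t\<bar> powr (w * (1 + 2 * A) - 1) * norm (Gamma (of_real w * Complex (-A) t + \<mu>))
         \<le> norm (Gamma (of_real w * Complex (1 + A) t + \<mu>)) \<and>
       norm (Gamma (of_real w * Complex (1 + A) t + \<mu>))
         \<le> C * \<bar>t\<bar> powr (w * (1 + 2 * A) + 1) * norm (Gamma (of_real w * Complex (-A) t + \<mu>))"
proof -
  define h where "h = w * (1 + 2 * A)"
  define x where "x = - w * A + Re \<mu>"
  \<comment> \<open>The condition on \<open>A\<close> serves to give \<open>x + h > 1\<close>, as
    the shift estimate requires.\<close>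
  have wA: "w * A \<ge> 1" using w A(1) by (simp add: field_simps)
  have h_eq: "h = w + 2 * (w * A)" "x + h = w + w * A + Re \<mu>"
    by (simp_all add: x_def h_def algebra_simps)
  have xh: "x + h > 1" "h > 1" and h0: "h \<ge> 0"
    using w wA \<mu> h_eq by linarith+
  obtain c C :: real where cC: "c > 0" "C > 0"
    "\<And>y. \<bar>y\<bar> \<ge> 1 \<Longrightarrow> c * \<bar>y\<bar> powr (h - 1) * norm (Gamma (Complex x y)) \<le> norm (Gamma (Complex (x + h) y))"
    "\<And>y. \<bar>y\<bar> \<ge> 1 \<Longrightarrow> norm (Gamma (Complex (x + h) y)) \<le> C * \<bar>y\<bar> powr (h + 1) * norm (Gamma (Complex x y))"
    by (rule Gamma_shift_bounds[OF h0 xh(1)]) blast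
  \<comment> \<open>Beyond this height \<open>\<bar>Im \<mu>\<bar>\<close> is at most half of
    \<open>w * \<bar>t\<bar>\<close>, so \<open>\<bar>y\<bar>\<close> lies between half and twice
    \<open>w * \<bar>t\<bar>\<close> and is at least 1.\<close>
  define t0 where "t0 = max 1 ((2 / w) * (1 + \<bar>Im \<mu>\<bar>))"
  show ?thesis
  proof (rule that[of "c * (w / 2) powr (h - 1)" "C * (2 * w) powr (h + 1)" t0])
    show "c * (w / 2) powr (h - 1) > 0" "C * (2 * w) powr (h + 1) > 0" "t0 \<ge> 1"
      using cC w by (auto simp: t0_def)
    fix t :: real assume t: "\<bar>t\<bar> \<ge> t0"
    define y where "y = w * t + Im \<mu>"
    have "\<bar>t\<bar> \<ge> (2 / w) * (1 + \<bar>Im \<mu>\<bar>)" using t by (auto simp: t0_def)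
    hence wt: "w * \<bar>t\<bar> \<ge> 2 * (1 + \<bar>Im \<mu>\<bar>)" using w by (simp add: field_simps)
    have awt: "\<bar>w * t\<bar> = w * \<bar>t\<bar>" using w by (simp add: abs_mult)
    have y: "\<bar>y\<bar> \<ge> w / 2 * \<bar>t\<bar>" "\<bar>y\<bar> \<le> 2 * w * \<bar>t\<bar>" "\<bar>y\<bar> \<ge> 1"
    proof -
      have X: "w / 2 * \<bar>t\<bar> = \<bar>w * t\<bar> / 2" "2 * w * \<bar>t\<bar> = 2 * \<bar>w * t\<bar>" "2 * (1 + \<bar>Im \<mu>\<bar>) \<le> \<bar>w * t\<bar>"
        using wt awt by simp_all
      show "\<bar>y\<bar> \<ge> w / 2 * \<bar>t\<bar>" "\<bar>y\<bar> \<le> 2 * w * \<bar>t\<bar>" "\<bar>y\<bar> \<ge> 1"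
        using X(3) unfolding X(1,2) y_def by (smt (verit) field_sum_of_halves)+
    qed
    have t1: "\<bar>t\<bar> \<ge> 1" using t by (auto simp: t0_def)
    have z: "of_real w * Complex (-A) t + \<mu> = Complex x y"
        "of_real w * Complex (1 + A) t + \<mu> = Complex (x + h) y"
      by (auto simp: complex_eq_iff x_def y_def h_def algebra_simps)
    have ni: "Complex u y \<notin> \<int>\<^sub>\<le>\<^sub>0" for u
      using y by (intro not_nonpos_Ints_Im) auto
    have "c * (w / 2) powr (h - 1) * \<bar>t\<bar> powr (h - 1) = c * (w / 2 * \<bar>t\<bar>) powr (h - 1)"
      using w powr_mult[of "w / 2" "\<bar>t\<bar>" "h - 1"] by simp
    also have "\<dots> \<le> c * \<bar>y\<bar> powr (h - 1)"
      using cC w xh t1 by (intro mult_left_mono powr_mono2 y) auto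
    finally have "c * (w / 2) powr (h - 1) * \<bar>t\<bar> powr (h - 1) * norm (Gamma (Complex x y))
         \<le> c * \<bar>y\<bar> powr (h - 1) * norm (Gamma (Complex x y))"
      by (rule mult_right_mono) simp
    moreover have "C * \<bar>y\<bar> powr (h + 1) \<le> C * (2 * w * \<bar>t\<bar>) powr (h + 1)"
      using cC w xh t1 by (intro mult_left_mono powr_mono2 y) auto
    hence "C * \<bar>y\<bar> powr (h + 1) * norm (Gamma (Complex x y)) \<le>
        C * (2 * w) powr (h + 1) * \<bar>t\<bar> powr (h + 1) * norm (Gamma (Complex x y))"
      using w powr_mult[of "2 * w" "\<bar>t\<bar>" "h + 1"] by (intro mult_right_mono) simp_all
    ultimately show "Gamma (of_real w * Complex (-A) t + \<mu>) \<noteq> 0 \<and>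
       of_real w * Complex (-A) t + \<mu> \<notin> \<int>\<^sub>\<le>\<^sub>0 \<and> of_real w * Complex (1 + A) t + \<mu> \<notin> \<int>\<^sub>\<le>\<^sub>0 \<and>
       c * (w / 2) powr (h - 1) * \<bar>t\<bar> powr (w * (1 + 2 * A) - 1) * norm (Gamma (of_real w * Complex (-A) t + \<mu>))
         \<le> norm (Gamma (of_real w * Complex (1 + A) t + \<mu>)) \<and>
       norm (Gamma (of_real w * Complex (1 + A) t + \<mu>))
         \<le> C * (2 * w) powr (h + 1) * \<bar>t\<bar> powr (w * (1 + 2 * A) + 1) * norm (Gamma (of_real w * Complex (-A) t + \<mu>))"
      unfolding z h_def[symmetric]
      using cC(3)[OF y(3)] cC(4)[OF y(3)] ni by (auto simp: Gamma_eq_zero_iff)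
  qed
qed

text \<open>Exponents add over the factors. The accumulated error is the number \<open>k\<close> of
  factors and does not grow with \<open>A\<close>, which is what later makes the degree well
  defined.\<close>

lemma prod_Gamma_bounds:
  fixes w :: "nat \<Rightarrow> real" and \<mu> :: "nat \<Rightarrow> complex" and A :: real
  assumes "\<forall>i<k. w i > 0 \<and> Re (\<mu> i) \<ge> 0" "\<forall>i<k. A \<ge> 1 / w i" "A \<ge> 0"
  defines "P \<equiv> (\<lambda>k s. \<Prod>i<k. Gamma (of_real (w i) * s + \<mu> i))"
  shows "\<exists>c>0. \<exists>C>0. \<exists>t0\<ge>1. \<forall>t. \<bar>t\<bar> \<ge> t0 \<longrightarrow>
      (\<forall>i<k. of_real (w i) * Complex (-A) t + \<mu> i \<notin> \<int>\<^sub>\<le>\<^sub>0 \<and> of_real (w i) * Complex (1 + A) t + \<mu> i \<notin> \<int>\<^sub>\<le>\<^sub>0) \<and>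
      P k (Complex (-A) t) \<noteq> 0 \<and>
      c * \<bar>t\<bar> powr ((\<Sum>i<k. w i) * (1 + 2 * A) - real k) * norm (P k (Complex (-A) t)) \<le> norm (P k (Complex (1 + A) t)) \<and>
      norm (P k (Complex (1 + A) t)) \<le> C * \<bar>t\<bar> powr ((\<Sum>i<k. w i) * (1 + 2 * A) + real k) * norm (P k (Complex (-A) t))"
  using assms(1,2)
proof (induction k)
  case 0
  show ?case by (auto simp: P_def intro!: exI[of _ 1])
next
  case (Suc k)
  define e where "e = (\<Sum>i<k. w i) * (1 + 2 * A)"
  define u where "u = w k * (1 + 2 * A)"
  obtain c C t0 :: real where 1: "c > 0" "C > 0" "t0 \<ge> 1"
    "\<And>t. \<bar>t\<bar> \<ge> t0 \<Longrightarrow>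
      (\<forall>i<k. of_real (w i) * Complex (-A) t + \<mu> i \<notin> \<int>\<^sub>\<le>\<^sub>0 \<and> of_real (w i) * Complex (1 + A) t + \<mu> i \<notin> \<int>\<^sub>\<le>\<^sub>0) \<and>
      P k (Complex (-A) t) \<noteq> 0 \<and>
      c * \<bar>t\<bar> powr (e - real k) * norm (P k (Complex (-A) t)) \<le> norm (P k (Complex (1 + A) t)) \<and>
      norm (P k (Complex (1 + A) t)) \<le> C * \<bar>t\<bar> powr (e + real k) * norm (P k (Complex (-A) t))"
    using Suc unfolding e_def by (metis less_SucI)
  have k: "w k > 0" "Re (\<mu> k) \<ge> 0" "A \<ge> 1 / w k" using Suc.prems by auto
  obtain c' C' t0' :: real where 2: "c' > 0" "C' > 0" "t0' \<ge> 1"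
    "\<And>t. \<bar>t\<bar> \<ge> t0' \<Longrightarrow> Gamma (of_real (w k) * Complex (-A) t + \<mu> k) \<noteq> 0 \<and>
       of_real (w k) * Complex (-A) t + \<mu> k \<notin> \<int>\<^sub>\<le>\<^sub>0 \<and> of_real (w k) * Complex (1 + A) t + \<mu> k \<notin> \<int>\<^sub>\<le>\<^sub>0 \<and>
       c' * \<bar>t\<bar> powr (u - 1) * norm (Gamma (of_real (w k) * Complex (-A) t + \<mu> k))
         \<le> norm (Gamma (of_real (w k) * Complex (1 + A) t + \<mu> k)) \<and>
       norm (Gamma (of_real (w k) * Complex (1 + A) t + \<mu> k))
         \<le> C' * \<bar>t\<bar> powr (u + 1) * norm (Gamma (of_real (w k) * Complex (-A) t + \<mu> k))"
    unfolding u_def by (rule Gamma_linear_bounds[OF k assms(3)]) blast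
  have "c * c' > 0" "C * C' > 0" "max t0 t0' \<ge> 1" using 1 2 by auto
  moreover have "(\<forall>i<Suc k. of_real (w i) * Complex (-A) t + \<mu> i \<notin> \<int>\<^sub>\<le>\<^sub>0 \<and> of_real (w i) * Complex (1 + A) t + \<mu> i \<notin> \<int>\<^sub>\<le>\<^sub>0) \<and>
      P (Suc k) (Complex (-A) t) \<noteq> 0 \<and>
      (c * c') * \<bar>t\<bar> powr ((\<Sum>i<Suc k. w i) * (1 + 2 * A) - real (Suc k)) * norm (P (Suc k) (Complex (-A) t)) \<le> norm (P (Suc k) (Complex (1 + A) t)) \<and>
      norm (P (Suc k) (Complex (1 + A) t)) \<le> (C * C') * \<bar>t\<bar> powr ((\<Sum>i<Suc k. w i) * (1 + 2 * A) + real (Suc k)) * norm (P (Suc k) (Complex (-A) t))"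
    if t: "\<bar>t\<bar> \<ge> max t0 t0'" for t
  proof -
    have t': "\<bar>t\<bar> \<ge> t0" "\<bar>t\<bar> \<ge> t0'" "\<bar>t\<bar> > 0" using t 1 by auto
    note 3 = 1(4)[OF t'(1)] and 4 = 2(4)[OF t'(2)]
    define p p' g g' where "p = norm (P k (Complex (-A) t))" and "p' = norm (P k (Complex (1 + A) t))"
      and "g = norm (Gamma (of_real (w k) * Complex (-A) t + \<mu> k))"
      and "g' = norm (Gamma (of_real (w k) * Complex (1 + A) t + \<mu> k))"
    have Suc_P: "norm (P (Suc k) (Complex (-A) t)) = p * g" "norm (P (Suc k) (Complex (1 + A) t)) = p' * g'"
      by (simp_all add: P_def p_def p'_def g_def g'_def norm_mult)
    have "(c * \<bar>t\<bar> powr (e - real k) * p) * (c' * \<bar>t\<bar> powr (u - 1) * g) \<le> p' * g'"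
      using 3 4 1 2 by (intro mult_mono) (auto simp: p_def p'_def g_def g'_def)
    moreover have "p' * g' \<le> (C * \<bar>t\<bar> powr (e + real k) * p) * (C' * \<bar>t\<bar> powr (u + 1) * g)"
      using 3 4 1 2 by (intro mult_mono) (auto simp: p_def p'_def g_def g'_def)
    moreover have "(\<Sum>i<Suc k. w i) * (1 + 2 * A) - real (Suc k) = (e - real k) + (u - 1)"
        "(\<Sum>i<Suc k. w i) * (1 + 2 * A) + real (Suc k) = (e + real k) + (u + 1)"
      by (simp_all add: e_def u_def algebra_simps)
    ultimately have "(c * c') * \<bar>t\<bar> powr ((\<Sum>i<Suc k. w i) * (1 + 2 * A) - real (Suc k)) * norm (P (Suc k) (Complex (-A) t)) \<le> norm (P (Suc k) (Complex (1 + A) t)) \<and>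
      norm (P (Suc k) (Complex (1 + A) t)) \<le> (C * C') * \<bar>t\<bar> powr ((\<Sum>i<Suc k. w i) * (1 + 2 * A) + real (Suc k)) * norm (P (Suc k) (Complex (-A) t))"
      unfolding Suc_P by (simp only: powr_add mult_ac)
    moreover have "\<forall>i<Suc k. of_real (w i) * Complex (-A) t + \<mu> i \<notin> \<int>\<^sub>\<le>\<^sub>0 \<and> of_real (w i) * Complex (1 + A) t + \<mu> i \<notin> \<int>\<^sub>\<le>\<^sub>0"
      using 3 4 by (auto simp: less_Suc_eq)
    moreover have "P (Suc k) (Complex (-A) t) \<noteq> 0"
      using 3 4 by (simp add: P_def)
    ultimately show ?thesis by blast
  qed
  ultimately show ?case by blast
qed

text \<open>The slack \<open>K\<close> is fixed before \<open>A\<close>, whereas \<open>c\<close>,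
  \<open>C\<close> and \<open>t0\<close> may depend on \<open>A\<close>; letting \<open>A\<close>
  grow therefore determines \<open>d\<close>. The two-sided bound is what makes exponents comparable
  and additive under products.\<close>

definition vgrowth :: "(complex \<Rightarrow> complex) \<Rightarrow> real \<Rightarrow> bool" where
  "vgrowth F d \<longleftrightarrow> (\<exists>K A0. \<forall>A\<ge>A0. \<exists>c>0. \<exists>C>0. \<exists>t0\<ge>1. \<forall>t. \<bar>t\<bar> \<ge> t0 \<longrightarrow>
     c * \<bar>t\<bar> powr (d * A - K) \<le> norm (F (Complex (-A) t)) \<and>
     norm (F (Complex (-A) t)) \<le> C * \<bar>t\<bar> powr (d * A + K))"

text \<open>The axiom holds in a punctured neighbourhood of every point. Where both sides are
  continuous, limits extend it to the point itself; \<open>s \<noteq> 0\<close> keeps the reflected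
  point \<open>cnj (1 - s)\<close> away from the pole at 1.\<close>

lemma functional_equation_pointwise:
  assumes hol: "F holomorphic_on - {1}"
    and ev: "eventually (\<lambda>s. gamma_factor \<epsilon> Q k w \<mu> s * F s =
               cnj (gamma_factor \<epsilon> Q k w \<mu> (cnj (1 - s)) * F (cnj (1 - s)))) (cosparse UNIV)"
    and Q: "Q > 0" and s: "s \<noteq> 1" "s \<noteq> 0"
    and g: "\<forall>i<k. of_real (w i) * s + \<mu> i \<notin> \<int>\<^sub>\<le>\<^sub>0 \<and> of_real (w i) * cnj (1 - s) + \<mu> i \<notin> \<int>\<^sub>\<le>\<^sub>0"
  shows "gamma_factor \<epsilon> Q k w \<mu> s * F s = cnj (gamma_factor \<epsilon> Q k w \<mu> (cnj (1 - s)) * F (cnj (1 - s)))"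
proof -
  define \<Phi> where "\<Phi> = (\<lambda>s. gamma_factor \<epsilon> Q k w \<mu> s * F s)"
  have cont: "isCont \<Phi> z" if "z \<noteq> 1" "\<forall>i<k. of_real (w i) * z + \<mu> i \<notin> \<int>\<^sub>\<le>\<^sub>0" for z
  proof -
    have "isCont F z"
      using hol that(1) holomorphic_on_imp_continuous_on[OF hol]
      by (metis Compl_iff continuous_on_eq_continuous_at open_Compl closed_singleton singletonD)
    thus ?thesis unfolding \<Phi>_def gamma_factor_def using that(2) Q
      by (intro continuous_intros isCont_Gamma) auto
  qed
  have cs: "cnj (1 - s) \<noteq> 1" using s(2) by (auto simp: complex_eq_iff)
  have "isCont (\<lambda>s. cnj (\<Phi> (cnj (1 - s)))) s"
    by (intro continuous_cnj isCont_o2[of s "\<lambda>s. cnj (1 - s)" \<Phi>] cont cs continuous_intros) (use g in auto)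
  hence lim: "((\<lambda>s. cnj (\<Phi> (cnj (1 - s)))) \<longlongrightarrow> cnj (\<Phi> (cnj (1 - s)))) (at s)"
    unfolding isCont_def .
  have "(\<Phi> \<longlongrightarrow> \<Phi> s) (at s)"
    using cont[OF s(1)] g unfolding isCont_def by blast
  moreover have "eventually (\<lambda>s. \<Phi> s = cnj (\<Phi> (cnj (1 - s)))) (at s)"
    using eventually_cosparse_imp_eventually_at[OF ev, of s UNIV] by (simp add: \<Phi>_def)
  ultimately have "((\<lambda>s. cnj (\<Phi> (cnj (1 - s)))) \<longlongrightarrow> \<Phi> s) (at s)"
    by (rule Lim_transform_eventually)
  hence "\<Phi> s = cnj (\<Phi> (cnj (1 - s)))"
    using lim by (rule tendsto_unique[OF at_neq_bot])
  thus ?thesis by (simp add: \<Phi>_def)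
qed

lemma norm_gamma_factor:
  assumes "norm \<epsilon> = 1" "Q > 0"
  shows "norm (gamma_factor \<epsilon> Q k w \<mu> s) = Q powr Re s * norm (\<Prod>i<k. Gamma (of_real (w i) * s + \<mu> i))"
  using assms unfolding gamma_factor_def norm_mult by (subst norm_powr_real_powr) auto

text \<open>On \<open>Re s = 1 + A\<close> the function stays between two positive constants, so at
  the mirrored point on \<open>Re s = -A\<close> its size is that of a quotient of gamma factors.
  The exponent comes out as twice the sum of the \<open>w i\<close>, Selberg's degree, and it
  vanishes only if there are no gamma factors.\<close>

lemma selberg_functional_equation_vgrowth:
  assumes hol: "F holomorphic_on - {1}" and fe: "selberg_functional_equation F"
    and a: "dser_abs a 2" "a 1 = 1" "dser_equals a F"
  obtains d where "d \<ge> 0" "vgrowth F d"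
    "d = 0 \<Longrightarrow> \<exists>Q>0. \<forall>s. s \<noteq> 0 \<longrightarrow> s \<noteq> 1 \<longrightarrow> norm (F s) = Q powr (1 - 2 * Re s) * norm (F (cnj (1 - s)))"
proof -
  from fe obtain \<epsilon> Q k w \<mu> where fe:
    "norm \<epsilon> = 1" "Q > 0" "\<forall>i<k. w i > 0 \<and> Re (\<mu> i) \<ge> 0"
    and ev: "eventually (\<lambda>s. gamma_factor \<epsilon> Q k w \<mu> s * F s =
               cnj (gamma_factor \<epsilon> Q k w \<mu> (cnj (1 - s)) * F (cnj (1 - s)))) (cosparse UNIV)"
    unfolding selberg_functional_equation_def Let_def by blast
  define e where "e = (\<Sum>i<k. w i)"
  define P where "P = (\<lambda>s. \<Prod>i<k. Gamma (of_real (w i) * s + \<mu> i))"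
  have e0: "e \<ge> 0" unfolding e_def using fe(3) by (intro sum_nonneg) (auto intro: less_imp_le)
  have eq: "norm (P s) * norm (F s) = Q powr (1 - 2 * Re s) * norm (P (cnj (1 - s))) * norm (F (cnj (1 - s)))"
    if "s \<noteq> 1" "s \<noteq> 0"
      "\<forall>i<k. of_real (w i) * s + \<mu> i \<notin> \<int>\<^sub>\<le>\<^sub>0 \<and> of_real (w i) * cnj (1 - s) + \<mu> i \<notin> \<int>\<^sub>\<le>\<^sub>0" for s
  proof -
    have "norm (gamma_factor \<epsilon> Q k w \<mu> s * F s) =
          norm (cnj (gamma_factor \<epsilon> Q k w \<mu> (cnj (1 - s)) * F (cnj (1 - s))))"
      using functional_equation_pointwise[OF hol ev fe(2) that] by (rule arg_cong)
    hence "Q powr Re s * (norm (P s) * norm (F s)) =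
           Q powr (1 - Re s) * norm (P (cnj (1 - s))) * norm (F (cnj (1 - s)))"
      unfolding complex_mod_cnj norm_mult norm_gamma_factor[OF fe(1,2)] P_def by (simp add: mult.assoc)
    moreover have "Q powr (1 - Re s) = Q powr Re s * Q powr (1 - 2 * Re s)"
      by (simp flip: powr_add)
    ultimately have "Q powr Re s * (norm (P s) * norm (F s)) =
           Q powr Re s * (Q powr (1 - 2 * Re s) * norm (P (cnj (1 - s))) * norm (F (cnj (1 - s))))"
      by (simp only: mult.assoc)
    thus ?thesis using fe(2) unfolding mult_cancel_left by simp
  qed
  obtain B where B: "B > 0" "\<And>s. Re s \<ge> 2 \<Longrightarrow> norm (dser a s - a 1) \<le> B * 2 powr (2 - Re s)"
    using dser_minus_first_le[OF a(1)] by blast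
  \<comment> \<open>The threshold is solved from \<open>B * 2 powr (2 - Re s) \<le> 1 / 2\<close>,
    with \<open>max 0\<close> to stay in the half-plane \<open>Re s \<ge> 2\<close>.\<close>
  have near: "1 / 2 \<le> norm (F s) \<and> norm (F s) \<le> 3 / 2" if "Re s \<ge> 2 + max 0 (log 2 (2 * B))" for s
  proof -
    have s2: "Re s \<ge> 2" using that by auto
    have F: "F s = dser a s" using a(3) s2 by (auto simp: dser_equals_def)
    have "2 powr (2 - Re s) \<le> 2 powr (- log 2 (2 * B))" using that by (intro powr_mono) auto
    also have "\<dots> = 1 / (2 * B)" using B by (simp add: powr_minus field_simps)
    finally have "B * 2 powr (2 - Re s) \<le> 1 / 2" using B by (simp add: field_simps)
    with B(2)[OF s2] have n: "norm (F s - 1) \<le> 1 / 2" unfolding F a(2) by linarith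
    have "norm (F s) \<le> norm (F s - 1) + 1"
      using norm_triangle_ineq[of "F s - 1" 1] by simp
    moreover have "1 \<le> norm (F s) + norm (F s - 1)"
      using norm_triangle_ineq4[of "F s" "F s - 1"] by simp
    ultimately show ?thesis using n by linarith
  qed
  \<comment> \<open>The gamma bound has the exponent \<open>e * (1 + 2 * A)\<close> up to
    \<open>real k\<close>; the summand \<open>e\<close> absorbs the offset from
    \<open>2 * e * A\<close>.\<close>
  define K where "K = e + real k"
  \<comment> \<open>The sum dominates every single \<open>1 / w i\<close>, as the gamma bounds
    require, and the rest brings \<open>1 + A\<close> into the range of \<open>near\<close>.\<close>
  define A0 where "A0 = (\<Sum>i<k. 1 / w i) + (2 + max 0 (log 2 (2 * B)))"
  have S0: "(\<Sum>i<k. 1 / w i) \<ge> 0" using fe(3) by (intro sum_nonneg) (auto intro: less_imp_le)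
  have vg: "vgrowth F (2 * e)"
    unfolding vgrowth_def
  proof (rule exI[of _ K], rule exI[of _ A0], intro allI impI)
    fix A assume A: "A0 \<le> A"
    have A': "A \<ge> 0" "1 + A \<ge> 2 + max 0 (log 2 (2 * B))" using A S0 by (auto simp: A0_def)
    have Aw: "\<forall>i<k. 1 / w i \<le> A"
    proof (intro allI impI)
      fix i assume "i < k"
      hence "1 / w i \<le> (\<Sum>i<k. 1 / w i)"
        using fe(3) by (intro member_le_sum) (auto intro: less_imp_le)
      thus "1 / w i \<le> A" using A by (simp add: A0_def)
    qed
    obtain c C t0 :: real where b: "c > 0" "C > 0" "t0 \<ge> 1" "\<And>t. \<bar>t\<bar> \<ge> t0 \<Longrightarrow>
      (\<forall>i<k. of_real (w i) * Complex (-A) t + \<mu> i \<notin> \<int>\<^sub>\<le>\<^sub>0 \<and> of_real (w i) * Complex (1 + A) t + \<mu> i \<notin> \<int>\<^sub>\<le>\<^sub>0) \<and>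
      P (Complex (-A) t) \<noteq> 0 \<and>
      c * \<bar>t\<bar> powr (e * (1 + 2 * A) - real k) * norm (P (Complex (-A) t)) \<le> norm (P (Complex (1 + A) t)) \<and>
      norm (P (Complex (1 + A) t)) \<le> C * \<bar>t\<bar> powr (e * (1 + 2 * A) + real k) * norm (P (Complex (-A) t))"
      using prod_Gamma_bounds[OF fe(3) Aw A'(1)] unfolding P_def e_def by blast
    define q where "q = Q powr (1 + 2 * A)"
    have q: "q > 0" using fe by (simp add: q_def)
    have "c * q / 2 * \<bar>t\<bar> powr (2 * e * A - K) \<le> norm (F (Complex (-A) t)) \<and>
          norm (F (Complex (-A) t)) \<le> 2 * C * q * \<bar>t\<bar> powr (2 * e * A + K)" if t: "\<bar>t\<bar> \<ge> t0" for t
    proof -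
      have cs: "cnj (1 - Complex (-A) t) = Complex (1 + A) t" by (simp add: complex_eq_iff)
      have ne: "Complex (-A) t \<noteq> 1" "Complex (-A) t \<noteq> 0" using t b(3) by (auto simp: complex_eq_iff)
      define p p' f where "p = norm (P (Complex (-A) t))" and "p' = norm (P (Complex (1 + A) t))"
        and "f = norm (F (Complex (1 + A) t))"
      have p: "p > 0" "c * \<bar>t\<bar> powr (e * (1 + 2 * A) - real k) * p \<le> p'"
          "p' \<le> C * \<bar>t\<bar> powr (e * (1 + 2 * A) + real k) * p"
        using b(4)[OF t] by (auto simp: p_def p'_def)
      have f: "1 / 2 \<le> f" "f \<le> 3 / 2" using near[of "Complex (1 + A) t"] A'(2) by (auto simp: f_def)
      have main: "p * norm (F (Complex (-A) t)) = q * p' * f"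
        using eq[OF ne] b(4)[OF t] unfolding cs by (simp add: p_def p'_def f_def q_def)
      have t1: "\<bar>t\<bar> \<ge> 1" using t b by auto
      have "p * (c * q / 2 * \<bar>t\<bar> powr (2 * e * A - K)) \<le> p * (c * q / 2 * \<bar>t\<bar> powr (e * (1 + 2 * A) - real k))"
        using t1 p b q e0 by (intro mult_left_mono powr_mono) (auto simp: K_def algebra_simps)
      also have "\<dots> = q * (c * \<bar>t\<bar> powr (e * (1 + 2 * A) - real k) * p) * (1 / 2)" by simp
      also have "\<dots> \<le> q * p' * f"
        using p f q b by (intro mult_mono mult_left_mono) (auto simp: p'_def)
      also have "\<dots> = p * norm (F (Complex (-A) t))" by (simp add: main)
      finally have 1: "c * q / 2 * \<bar>t\<bar> powr (2 * e * A - K) \<le> norm (F (Complex (-A) t))"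
        using p(1) by (simp add: mult_le_cancel_left)
      have "p * norm (F (Complex (-A) t)) = q * p' * f" by (simp add: main)
      also have "\<dots> \<le> q * (C * \<bar>t\<bar> powr (e * (1 + 2 * A) + real k) * p) * 2"
        using p f q b by (intro mult_mono mult_left_mono) auto
      also have "\<dots> = p * (2 * C * q * \<bar>t\<bar> powr (e * (1 + 2 * A) + real k))" by simp
      also have "\<dots> \<le> p * (2 * C * q * \<bar>t\<bar> powr (2 * e * A + K))"
        using t1 p b q e0 by (intro mult_left_mono powr_mono) (auto simp: K_def algebra_simps)
      finally have "norm (F (Complex (-A) t)) \<le> 2 * C * q * \<bar>t\<bar> powr (2 * e * A + K)"
        using p(1) by (simp add: mult_le_cancel_left)
      with 1 show ?thesis by blast
    qed
    moreover have "c * q / 2 > 0" "2 * C * q > 0" using b q by auto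
    ultimately show "\<exists>c>0. \<exists>C>0. \<exists>t0\<ge>1. \<forall>t. \<bar>t\<bar> \<ge> t0 \<longrightarrow>
         c * \<bar>t\<bar> powr (2 * e * A - K) \<le> norm (F (Complex (-A) t)) \<and>
         norm (F (Complex (-A) t)) \<le> C * \<bar>t\<bar> powr (2 * e * A + K)"
      using b(3) by blast
  qed
  have deg0: "\<exists>Q>0. \<forall>s. s \<noteq> 0 \<longrightarrow> s \<noteq> 1 \<longrightarrow> norm (F s) = Q powr (1 - 2 * Re s) * norm (F (cnj (1 - s)))"
    if "2 * e = 0"
  proof -
    have "k = 0"
    proof (rule ccontr)
      assume "k \<noteq> 0"
      hence "e > 0" unfolding e_def using fe(3) by (intro sum_pos) auto
      thus False using that by simp
    qed
    hence "norm (F s) = Q powr (1 - 2 * Re s) * norm (F (cnj (1 - s)))" if "s \<noteq> 0" "s \<noteq> 1" for s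
      using eq[OF that(2,1)] by (simp add: P_def)
    thus ?thesis using fe(2) by blast
  qed
  show ?thesis by (rule that[OF _ vg deg0]) (use e0 in simp_all)
qed

section \<open>Shifting a vertical line of integration\<close>

lemma integrable_inverse_square: "integrable lborel (\<lambda>t::real. M / (1 + t\<^sup>2))"
proof -
  have "integrable lborel (\<lambda>t::real. inverse (1 + t\<^sup>2))"
    using integrable_inverse_1_plus_square unfolding set_integrable_def by simp
  thus ?thesis unfolding divide_inverse by (rule integrable_mult_right)
qed

lemma integrable_line:
  assumes "f holomorphic_on UNIV" "\<And>t. norm (f (Complex x t)) \<le> M / (1 + t\<^sup>2)"
  shows "integrable lborel (\<lambda>t. f (Complex x t))"
proof (rule Bochner_Integration.integrable_bound[OF integrable_inverse_square[of M]])
  have "continuous_on UNIV (\<lambda>t. f (Complex x t))"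
    unfolding Complex_eq
    by (intro continuous_on_compose2[OF holomorphic_on_imp_continuous_on[OF assms(1)]] continuous_intros) auto
  thus "(\<lambda>t. f (Complex x t)) \<in> borel_measurable lborel"
    by (simp add: borel_measurable_continuous_onI)
  show "AE t in lborel. norm (f (Complex x t)) \<le> norm (M / (1 + t\<^sup>2))"
    using assms(2) by (intro AE_I2) (metis abs_ge_self order_trans real_norm_def)
qed

lemma norm_integral_line_le:
  fixes f :: "real \<Rightarrow> complex"
  assumes "\<And>t. norm (f t) \<le> M / (1 + t\<^sup>2)" "integrable lborel f"
  shows "norm (\<integral>t. f t \<partial>lborel) \<le> M * (\<integral>t. 1 / (1 + t\<^sup>2) \<partial>lborel)"
proof -
  have "norm (\<integral>t. f t \<partial>lborel) \<le> (\<integral>t. norm (f t) \<partial>lborel)" by (rule integral_norm_bound)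
  also have "\<dots> \<le> (\<integral>t. M * (1 / (1 + t\<^sup>2)) \<partial>lborel)"
    using assms integrable_inverse_square[of M] by (intro integral_mono integrable_norm) auto
  finally show ?thesis by (simp only: integral_mult_right_zero)
qed

text \<open>
  If \<open>P\<close> is a primitive of \<open>f\<close>, the integrals along \<open>[x + i(-T), x + iT]\<close> for two values of \<open>x\<close>
  differ by increments of \<open>P\<close> along two short horizontal segments on which \<open>f\<close> is small.
\<close>

lemma integral_line_shift:
  assumes hol: "f holomorphic_on UNIV" and x: "x1 \<in> {a..b}" "x2 \<in> {a..b}"
    and bd: "\<And>z. a \<le> Re z \<Longrightarrow> Re z \<le> b \<Longrightarrow> norm (f z) \<le> M / (1 + (Im z)\<^sup>2)"
  shows "(\<integral>t. f (Complex x1 t) \<partial>lborel) = (\<integral>t. f (Complex x2 t) \<partial>lborel)"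
proof -
  obtain P where P: "\<And>z. (P has_field_derivative f z) (at z)"
    using holomorphic_convex_primitive'[OF convex_UNIV open_UNIV hol] by auto
  have int: "integrable lborel (\<lambda>t. f (Complex x t))" if "x \<in> {a..b}" for x
    using that bd[of "Complex x _"] by (intro integrable_line[OF hol, of x M]) auto
  \<comment> \<open>Along \<open>x + i t\<close> the chain rule gives the derivative
    \<open>\<i> * f\<close>, so the primitive in \<open>t\<close> is
    \<open>P / \<i>\<close>.\<close>
  have FTC: "(\<integral>t. indicator {-T..T} t *\<^sub>R f (Complex x t) \<partial>lborel) = (P (Complex x T) - P (Complex x (-T))) / \<i>"
    if "T \<ge> 0" for x T
  proof -
    have "(\<integral>t. indicator {-T..T} t *\<^sub>R f (Complex x t) \<partial>lborel) = P (Complex x T) / \<i> - P (Complex x (-T)) / \<i>"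
    proof (rule integral_FTC_atLeastAtMost)
      fix t assume "-T \<le> t" "t \<le> T"
      have "((\<lambda>t. P (Complex x t) / \<i>) has_vector_derivative (\<i> * f (Complex x t) / \<i>)) (at t within {-T..T})"
      proof (rule has_vector_derivative_divide, rule field_vector_diff_chain_within[where f = "Complex x" and g = P, unfolded o_def])
        show "(Complex x has_vector_derivative \<i>) (at t within {-T..T})"
          unfolding Complex_eq has_vector_derivative_def
          by (auto intro!: derivative_eq_intros simp: scaleR_conv_of_real)
        show "(P has_field_derivative f (Complex x t)) (at (Complex x t) within Complex x ` {- T..T})"
          by (rule has_field_derivative_at_within[OF P])
      qed
      thus "((\<lambda>t. P (Complex x t) / \<i>) has_vector_derivative f (Complex x t)) (at t within {-T..T})" by simp
    next
      show "continuous_on {-T..T} (\<lambda>t. f (Complex x t))"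
        unfolding Complex_eq
        by (intro continuous_on_compose2[OF holomorphic_on_imp_continuous_on[OF hol]] continuous_intros) auto
    qed (use that in auto)
    thus ?thesis unfolding diff_divide_distrib .
  qed
  have lim: "((\<lambda>T. (P (Complex x T) - P (Complex x (-T))) / \<i>) \<longlongrightarrow> (\<integral>t. f (Complex x t) \<partial>lborel)) at_top"
    if "x \<in> {a..b}" for x
  proof (rule Lim_transform_eventually)
    show "((\<lambda>T. \<integral>t. indicator {-T..T} t *\<^sub>R f (Complex x t) \<partial>lborel) \<longlongrightarrow> (\<integral>t. f (Complex x t) \<partial>lborel)) at_top"
    proof (rule integral_dominated_convergence_at_top[where w = "\<lambda>t. norm (f (Complex x t))"])
      show "AE t in lborel. ((\<lambda>T. indicator {-T..T} t *\<^sub>R f (Complex x t)) \<longlongrightarrow> f (Complex x t)) at_top"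
      proof (intro AE_I2 tendsto_eventually)
        fix t :: real
        show "eventually (\<lambda>T. indicator {-T..T} t *\<^sub>R f (Complex x t) = f (Complex x t)) at_top"
          using eventually_ge_at_top[of "\<bar>t\<bar>"] by eventually_elim (auto simp: indicator_def)
      qed
      have m: "(\<lambda>t. f (Complex x t)) \<in> borel_measurable lborel"
        using int[OF that] by auto
      thus "(\<lambda>t. f (Complex x t)) \<in> borel_measurable lborel" .
      show "(\<lambda>t. indicator {-T..T} t *\<^sub>R f (Complex x t)) \<in> borel_measurable lborel" for T :: real
        using m by simp
      show "eventually (\<lambda>T. AE t in lborel. norm (indicator {-T..T} t *\<^sub>R f (Complex x t)) \<le> norm (f (Complex x t))) at_top"
        by (intro always_eventually allI AE_I2) (auto simp: indicator_def)
    qed (use int[OF that] in auto)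
    show "eventually (\<lambda>T. (\<integral>t. indicator {-T..T} t *\<^sub>R f (Complex x t) \<partial>lborel) = (P (Complex x T) - P (Complex x (-T))) / \<i>) at_top"
      using eventually_ge_at_top[of 0] by eventually_elim (rule FTC)
  qed
  have horiz: "norm (P (Complex x1 t) - P (Complex x2 t)) \<le> M / (1 + t\<^sup>2) * \<bar>x1 - x2\<bar>" for t
  proof -
    have "norm (P (Complex x1 t) - P (Complex x2 t)) \<le> M / (1 + t\<^sup>2) * norm (Complex x1 t - Complex x2 t)"
    proof (rule field_differentiable_bound[where S = "{z. a \<le> Re z \<and> Re z \<le> b \<and> Im z = t}"])
      have "{z. a \<le> Re z \<and> Re z \<le> b \<and> Im z = t} = {z. Re z \<ge> a} \<inter> {z. Re z \<le> b} \<inter> ({z. Im z \<ge> t} \<inter> {z. Im z \<le> t})" by auto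
      thus "convex {z. a \<le> Re z \<and> Re z \<le> b \<and> Im z = t}"
        by (simp only:) (intro convex_Int convex_halfspace_Re_ge convex_halfspace_Re_le convex_halfspace_Im_ge convex_halfspace_Im_le)
      fix z assume "z \<in> {z. a \<le> Re z \<and> Re z \<le> b \<and> Im z = t}"
      thus "norm (f z) \<le> M / (1 + t\<^sup>2)" using bd[of z] by auto
      show "(P has_field_derivative f z) (at z within {z. a \<le> Re z \<and> Re z \<le> b \<and> Im z = t})"
        by (rule has_field_derivative_at_within[OF P])
    qed (use x in auto)
    also have "norm (Complex x1 t - Complex x2 t) = \<bar>x1 - x2\<bar>" by (simp add: cmod_def)
    finally show ?thesis .
  qed
  have "((\<lambda>T. (P (Complex x1 T) - P (Complex x1 (-T))) / \<i> - (P (Complex x2 T) - P (Complex x2 (-T))) / \<i>) \<longlongrightarrow> 0) at_top"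
  proof (rule Lim_null_comparison)
    show "eventually (\<lambda>T. norm ((P (Complex x1 T) - P (Complex x1 (-T))) / \<i> - (P (Complex x2 T) - P (Complex x2 (-T))) / \<i>)
             \<le> 2 * M * \<bar>x1 - x2\<bar> / (1 + T\<^sup>2)) at_top"
    proof (intro always_eventually allI)
      fix T
      have "norm ((P (Complex x1 T) - P (Complex x1 (-T))) / \<i> - (P (Complex x2 T) - P (Complex x2 (-T))) / \<i>)
          = norm ((P (Complex x1 T) - P (Complex x2 T)) - (P (Complex x1 (-T)) - P (Complex x2 (-T))))"
      proof -
        have eq: "(p - q) / \<i> - (u - v) / \<i> = ((p - u) - (q - v)) / \<i>" for p q u v :: complex
          unfolding diff_divide_distrib[symmetric] by (simp add: algebra_simps)
        show ?thesis unfolding eq norm_divide by simp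
      qed
      also have "\<dots> \<le> M / (1 + T\<^sup>2) * \<bar>x1 - x2\<bar> + M / (1 + (-T)\<^sup>2) * \<bar>x1 - x2\<bar>"
        by (rule order_trans[OF norm_triangle_ineq4 add_mono[OF horiz horiz]])
      finally show "norm ((P (Complex x1 T) - P (Complex x1 (-T))) / \<i> - (P (Complex x2 T) - P (Complex x2 (-T))) / \<i>)
             \<le> 2 * M * \<bar>x1 - x2\<bar> / (1 + T\<^sup>2)" by simp
    qed
    show "((\<lambda>T. 2 * M * \<bar>x1 - x2\<bar> / (1 + T\<^sup>2)) \<longlongrightarrow> 0) at_top" by real_asymp
  qed
  moreover have "((\<lambda>T. (P (Complex x1 T) - P (Complex x1 (-T))) / \<i> - (P (Complex x2 T) - P (Complex x2 (-T))) / \<i>)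
      \<longlongrightarrow> (\<integral>t. f (Complex x1 t) \<partial>lborel) - (\<integral>t. f (Complex x2 t) \<partial>lborel)) at_top"
    using x by (intro tendsto_diff lim) auto
  ultimately show ?thesis
    using tendsto_unique[OF trivial_limit_at_top_linorder] by fastforce
qed

section \<open>An entire kernel that beats every finite order\<close>

lemma double_exp_decay:
  fixes c \<rho> \<kappa> \<delta> :: real
  assumes "c > 0" "\<rho> > 0" "\<delta> > 0"
  obtains M where "M > 0"
    "\<And>u. u \<ge> 0 \<Longrightarrow> exp ((c * (1 + u)) powr \<rho>) * (1 + u) powr \<kappa> * exp (- exp (\<delta> * u) / 4) \<le> M / (1 + u\<^sup>2)"
proof -
  define h where "h u = exp ((c * (1 + u)) powr \<rho>) * (1 + u) powr \<kappa> * exp (- exp (\<delta> * u) / 4) * (1 + u\<^sup>2)" for u :: real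
  \<comment> \<open>The exponent of \<open>h\<close>: the term \<open>exp (\<delta> * u) / 4\<close>
    wins over the power and the logarithms. The compact interval left over contributes only to the
    constant.\<close>
  have "filterlim (\<lambda>u. (c * (1 + u)) powr \<rho> + \<kappa> * ln (1 + u) - exp (\<delta> * u) / 4 + ln (1 + u\<^sup>2)) at_bot at_top"
    using assms by real_asymp
  hence "((\<lambda>u. exp ((c * (1 + u)) powr \<rho> + \<kappa> * ln (1 + u) - exp (\<delta> * u) / 4 + ln (1 + u\<^sup>2))) \<longlongrightarrow> 0) at_top"
    by (rule filterlim_compose[OF exp_at_bot])
  moreover have "eventually (\<lambda>u. exp ((c * (1 + u)) powr \<rho> + \<kappa> * ln (1 + u) - exp (\<delta> * u) / 4 + ln (1 + u\<^sup>2)) = h u) at_top"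
    using eventually_gt_at_top[of 0]
  proof eventually_elim
    case (elim u)
    moreover have "1 + u\<^sup>2 > 0" by (simp add: add_pos_nonneg)
    ultimately have "h u = exp ((c * (1 + u)) powr \<rho>) * exp (\<kappa> * ln (1 + u)) * exp (- exp (\<delta> * u) / 4) * exp (ln (1 + u\<^sup>2))"
      by (simp add: h_def powr_def[of "1 + u" \<kappa>])
    thus ?case unfolding mult_exp_exp by (simp add: algebra_simps)
  qed
  ultimately have "(h \<longlongrightarrow> 0) at_top" by (rule Lim_transform_eventually)
  hence "eventually (\<lambda>u. h u < 1) at_top" by (rule order_tendstoD) simp
  then obtain U where U: "\<And>u. u \<ge> U \<Longrightarrow> h u < 1" by (auto simp: eventually_at_top_linorder)
  have "continuous_on {0..max 0 U} h"
    unfolding h_def using assms by (intro continuous_intros) auto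
  hence "compact (h ` {0..max 0 U})" by (rule compact_continuous_image) simp
  hence "bounded (h ` {0..max 0 U})" by (rule compact_imp_bounded)
  then obtain B where "\<forall>x\<in>h ` {0..max 0 U}. norm x \<le> B" unfolding bounded_iff by blast
  hence B: "norm (h u) \<le> B" if "u \<in> {0..max 0 U}" for u using that by blast
  show ?thesis
  proof (rule that[of "max 1 B"])
    fix u :: real assume "u \<ge> 0"
    hence "h u \<le> max 1 B" using U[of u] B[of u] by (cases "u \<le> max 0 U") fastforce+
    moreover have "1 + u\<^sup>2 > 0" by (simp add: add_pos_nonneg)
    ultimately show "exp ((c * (1 + u)) powr \<rho>) * (1 + u) powr \<kappa> * exp (- exp (\<delta> * u) / 4) \<le> max 1 B / (1 + u\<^sup>2)"
      by (simp add: h_def field_simps)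
  qed simp
qed

text \<open>\<open>Re (cos w)\<close> is \<open>cos (Re w) * cosh (Im w)\<close>. The first factor
  is at least 1/2 because 1 is below \<open>pi / 3\<close>, the second at least
  \<open>exp \<bar>Im w\<bar> / 2\<close>; hence the 1/4.\<close>

lemma norm_exp_minus_cos_le:
  assumes "\<bar>Re w\<bar> \<le> 1"
  shows "norm (exp (- cos w)) \<le> exp (- exp \<bar>Im w\<bar> / 4)"
proof -
  have "cos (Re w) \<ge> cos 1"
    using assms cos_monotone_0_pi_le[of "\<bar>Re w\<bar>" 1] pi_gt3 by simp
  moreover have "cos (1::real) \<ge> cos (pi / 3)"
    using pi_gt3 by (intro cos_monotone_0_pi_le) auto
  ultimately have c: "cos (Re w) \<ge> 1 / 2" by (simp add: cos_60)
  have ch: "cosh (Im w) \<ge> exp \<bar>Im w\<bar> / 2"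
    by (cases "Im w \<ge> 0") (auto simp: cosh_def field_simps)
  have "Re (cos w) = cos (Re w) * cosh (Im w)"
    by (simp add: Re_cos cosh_def field_simps)
  also have "\<dots> \<ge> (1 / 2) * (exp \<bar>Im w\<bar> / 2)"
    using c ch by (intro mult_mono) auto
  finally show ?thesis by simp
qed

text \<open>
  The kernel \<open>exp (- cos (\<delta> z))\<close> decays doubly exponentially on vertical strips, hence beats every
  function of finite order; on the imaginary axis it is \<open>exp (- cosh (\<delta> t)) > 0\<close>.
\<close>

lemma strip_kernel_exists:
  fixes R :: real
  assumes "R > 0"
  obtains E :: "complex \<Rightarrow> complex" where "E holomorphic_on UNIV"
    "\<And>c r p. c > 0 \<Longrightarrow> r > 0 \<Longrightarrow> \<exists>M>0. \<forall>z. \<bar>Re z\<bar> \<le> R \<longrightarrow>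
       exp ((c * (1 + \<bar>Im z\<bar>)) powr r) * (1 + \<bar>Im z\<bar>) powr p * norm (E z) \<le> M / (1 + (Im z)\<^sup>2)"
    "\<And>m. (\<integral>t. Complex 0 t ^ (2 * m) * E (Complex 0 t) \<partial>lborel) \<noteq> 0"
proof -
  \<comment> \<open>Scales the strip \<open>\<bar>Re z\<bar> \<le> R\<close> into
    \<open>\<bar>Re w\<bar> \<le> 1\<close>, where the cosine of the real part is bounded
    below.\<close>
  define \<delta> where "\<delta> = 1 / R"
  have \<delta>: "\<delta> > 0" using assms by (simp add: \<delta>_def)
  define E :: "complex \<Rightarrow> complex" where "E z = exp (- cos (of_real \<delta> * z))" for z
  have hol: "E holomorphic_on UNIV" unfolding E_def by (intro holomorphic_intros)
  have bd: "\<exists>M>0. \<forall>z. \<bar>Re z\<bar> \<le> R \<longrightarrow>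
       exp ((c * (1 + \<bar>Im z\<bar>)) powr r) * (1 + \<bar>Im z\<bar>) powr p * norm (E z) \<le> M / (1 + (Im z)\<^sup>2)"
    if cr: "c > 0" "r > 0" for c r p :: real
  proof -
    obtain M where M: "M > 0" "\<And>u. u \<ge> 0 \<Longrightarrow> exp ((c * (1 + u)) powr r) * (1 + u) powr p * exp (- exp (\<delta> * u) / 4) \<le> M / (1 + u\<^sup>2)"
      by (rule double_exp_decay[OF cr \<delta>, of p]) blast
    have "exp ((c * (1 + \<bar>Im z\<bar>)) powr r) * (1 + \<bar>Im z\<bar>) powr p * norm (E z) \<le> M / (1 + (Im z)\<^sup>2)"
      if z: "\<bar>Re z\<bar> \<le> R" for z
    proof -
      have "\<bar>Re (of_real \<delta> * z)\<bar> \<le> 1" using z assms by (simp add: \<delta>_def abs_mult field_simps)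
      from norm_exp_minus_cos_le[OF this] have "norm (E z) \<le> exp (- exp (\<delta> * \<bar>Im z\<bar>) / 4)"
        using \<delta> by (simp add: E_def abs_mult)
      hence "exp ((c * (1 + \<bar>Im z\<bar>)) powr r) * (1 + \<bar>Im z\<bar>) powr p * norm (E z) \<le>
             exp ((c * (1 + \<bar>Im z\<bar>)) powr r) * (1 + \<bar>Im z\<bar>) powr p * exp (- exp (\<delta> * \<bar>Im z\<bar>) / 4)"
        by (intro mult_left_mono) auto
      also have "\<dots> \<le> M / (1 + \<bar>Im z\<bar>\<^sup>2)" by (rule M(2)) simp
      finally show ?thesis by simp
    qed
    thus ?thesis using M(1) by blast
  qed
  have nz: "(\<integral>t. Complex 0 t ^ (2 * m) * E (Complex 0 t) \<partial>lborel) \<noteq> 0" for m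
  proof -
    define r where "r t = t ^ (2 * m) * exp (- cosh (\<delta> * t))" for t :: real
    \<comment> \<open>On the imaginary axis an even power has the constant sign
      \<open>(-1) ^ m\<close>, so nothing can cancel in the integral.\<close>
    have eq: "Complex 0 t ^ (2 * m) * E (Complex 0 t) = (-1) ^ m * of_real (r t)" for t
    proof -
      have "cos (of_real \<delta> * Complex 0 t) = of_real (cosh (\<delta> * t))"
        by (simp add: complex_eq_iff Re_cos Im_cos cosh_def)
      moreover have "Complex 0 t ^ 2 = - of_real (t ^ 2)"
        by (simp add: complex_eq_iff power2_eq_square)
      hence "Complex 0 t ^ (2 * m) = (-1) ^ m * of_real (t ^ (2 * m))"
        unfolding power_mult by (simp add: power_minus[of "(complex_of_real t)\<^sup>2" m])
      ultimately show ?thesis by (simp add: E_def r_def flip: exp_of_real)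
    qed
    have r0: "r t \<ge> 0" for t by (simp add: r_def)
    obtain M where M: "\<And>z. \<bar>Re z\<bar> \<le> R \<Longrightarrow> exp ((1 * (1 + \<bar>Im z\<bar>)) powr 1) * (1 + \<bar>Im z\<bar>) powr real (2 * m) * norm (E z) \<le> M / (1 + (Im z)\<^sup>2)"
      using bd[of 1 1 "real (2 * m)"] by auto
    have int_c: "integrable lborel (\<lambda>t. Complex 0 t ^ (2 * m) * E (Complex 0 t))"
    proof (rule integrable_line[where f = "\<lambda>z. z ^ (2 * m) * E z"])
      show "(\<lambda>z. z ^ (2 * m) * E z) holomorphic_on UNIV" by (intro holomorphic_intros hol)
      fix t
      have "norm (Complex 0 t ^ (2 * m) * E (Complex 0 t)) = \<bar>t\<bar> ^ (2 * m) * norm (E (Complex 0 t))"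
      proof -
        have "norm (Complex 0 t) = \<bar>t\<bar>" by (simp add: cmod_def)
        thus ?thesis by (simp add: norm_mult norm_power)
      qed
      also have "\<dots> \<le> exp ((1 * (1 + \<bar>t\<bar>)) powr 1) * (1 + \<bar>t\<bar>) powr real (2 * m) * norm (E (Complex 0 t))"
      proof (rule mult_right_mono)
        have "1 * \<bar>t\<bar> ^ (2 * m) \<le> exp ((1 * (1 + \<bar>t\<bar>)) powr 1) * (1 + \<bar>t\<bar>) ^ (2 * m)"
          by (intro mult_mono power_mono) auto
        thus "\<bar>t\<bar> ^ (2 * m) \<le> exp ((1 * (1 + \<bar>t\<bar>)) powr 1) * (1 + \<bar>t\<bar>) powr real (2 * m)"
          by (subst powr_realpow) auto
      qed auto
      also have "\<dots> \<le> M / (1 + t\<^sup>2)" using M[of "Complex 0 t"] assms by simp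
      finally show "norm (Complex 0 t ^ (2 * m) * E (Complex 0 t)) \<le> M / (1 + t\<^sup>2)" .
    qed
    have "norm (Complex 0 t ^ (2 * m) * E (Complex 0 t)) = r t" for t
      unfolding eq using r0[of t] by (simp add: norm_mult norm_power)
    hence int_r: "integrable lborel r" using integrable_norm[OF int_c] by simp
    have "(\<integral>t. indicator {1..2::real} t * exp (- cosh (\<delta> * 2)) \<partial>lborel) \<le> (\<integral>t. r t \<partial>lborel)"
    proof (rule integral_mono)
      show "integrable lborel (\<lambda>t. indicator {1..2::real} t * exp (- cosh (\<delta> * 2)))" by simp
      fix t :: real
      have "1 * exp (- cosh (\<delta> * 2)) \<le> t ^ (2 * m) * exp (- cosh (\<delta> * t))" if "1 \<le> t" "t \<le> 2"
        using that \<delta> by (intro mult_mono one_le_power) (auto simp: cosh_real_nonneg_le_iff)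
      thus "indicator {1..2::real} t * exp (- cosh (\<delta> * 2)) \<le> r t"
        using r0[of t] by (auto simp: indicator_def r_def)
    qed (rule int_r)
    hence "(\<integral>t. r t \<partial>lborel) > 0" by (simp add: less_le_trans[OF exp_gt_zero])
    thus ?thesis unfolding eq by (simp add: int_r)
  qed
  show ?thesis by (rule that[OF hol bd nz])
qed

text \<open>The order hypothesis speaks only of large arguments and of an arbitrary real exponent.
  Compactness covers the ball left out, and raising the exponent to \<open>max 1 \<rho>\<close>
  makes it positive, as the kernel estimate wants.\<close>

lemma entire_order_bound:
  assumes "g holomorphic_on UNIV" "eventually (\<lambda>s. norm (g s) \<le> exp (norm s powr \<rho>)) at_infinity"
  obtains G r where "G > 0" "r > 0" "\<And>s. norm (g s) \<le> G * exp (norm s powr r)"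
proof -
  obtain b where b: "\<And>s. norm s \<ge> b \<Longrightarrow> norm (g s) \<le> exp (norm s powr \<rho>)"
    using assms(2) by (auto simp: eventually_at_infinity)
  have "compact (g ` cball 0 (max 1 b))"
    by (intro compact_continuous_image holomorphic_on_imp_continuous_on holomorphic_on_subset[OF assms(1)]) auto
  hence "bounded (g ` cball 0 (max 1 b))" by (rule compact_imp_bounded)
  then obtain B where "\<forall>x\<in>g ` cball 0 (max 1 b). norm x \<le> B"
    unfolding bounded_iff by blast
  hence B: "norm (g s) \<le> B" if "norm s \<le> max 1 b" for s using that by auto
  show ?thesis
  proof (rule that[of "max 1 B" "max 1 \<rho>"])
    fix s
    show "norm (g s) \<le> max 1 B * exp (norm s powr max 1 \<rho>)"
    proof (cases "norm s \<le> max 1 b")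
      case True
      have "norm (g s) \<le> max 1 B * 1" using B[OF True] by simp
      also have "\<dots> \<le> max 1 B * exp (norm s powr max 1 \<rho>)" by (intro mult_left_mono) auto
      finally show ?thesis .
    next
      case False
      have "norm (g s) \<le> 1 * exp (norm s powr \<rho>)" using b False by simp
      also have "\<dots> \<le> max 1 B * exp (norm s powr max 1 \<rho>)"
        using False by (intro mult_mono) (auto intro!: powr_mono)
      finally show ?thesis .
    qed
  qed auto
qed

section \<open>Isolating one coefficient by a contour shift\<close>

lemma off_diagonal_exponent:
  fixes n k :: nat
  assumes "n \<ge> 2" "k \<ge> 1" "k \<noteq> n"
  defines "l \<equiv> ln (real n) - ln (real k)"
  shows "l - (real n)\<^sup>2 * \<bar>l\<bar> \<le> 2 * ln (real n) - 2 * ln (real k) + (1 - real n)"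
proof -
  \<comment> \<open>The gap between the logarithms of \<open>n\<close> and of another integer; the
    critical case is \<open>k = n + 1\<close>.\<close>
  have l: "\<bar>l\<bar> \<ge> 1 / (real n + 1)"
  proof (cases "k < n")
    case True
    have "ln (real k / real n) \<le> real k / real n - 1" using assms by (intro ln_le_minus_one) auto
    hence "l \<ge> 1 - real k / real n" using assms by (simp add: l_def ln_div)
    moreover have "1 - real k / real n \<ge> 1 / real n" using True assms by (simp add: field_simps)
    moreover have "1 / real n \<ge> 1 / (real n + 1)" using assms by (intro divide_left_mono) auto
    ultimately show ?thesis by linarith
  next
    case False
    have "ln (real n / real k) \<le> real n / real k - 1" using assms by (intro ln_le_minus_one) auto
    hence "l \<le> real n / real k - 1" using assms by (simp add: l_def ln_div)
    moreover have "real n / real k \<le> real n / (real n + 1)"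
      using False assms by (intro divide_left_mono) auto
    moreover have "real n / (real n + 1) - 1 = - (1 / (real n + 1))" by (simp add: field_simps)
    ultimately show ?thesis by linarith
  qed
  \<comment> \<open>The scale \<open>n^2\<close> is matched to this gap through
    \<open>n^2 - 1 = (n - 1) (n + 1)\<close>. The part \<open>2 ln n - 2 ln k\<close> of the bound
    keeps it summable against the coefficients, in the form \<open>a k / k^2\<close>.\<close>
  have "real n - 1 = ((real n)\<^sup>2 - 1) * (1 / (real n + 1))"
    by (simp add: field_simps power2_eq_square)
  also have "\<dots> \<le> ((real n)\<^sup>2 - 1) * \<bar>l\<bar>"
    using l assms by (intro mult_left_mono) auto
  finally have "real n - 1 \<le> (real n)\<^sup>2 * \<bar>l\<bar> - \<bar>l\<bar>" by (simp add: algebra_simps)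
  thus ?thesis unfolding l_def by linarith
qed

text \<open>
  The coefficient is isolated by integrating \<open>F(1 + T z) n\<^bsup>1 + T z\<^esup>\<close> with \<open>T = n\<^sup>2\<close> against a kernel:
  on \<open>Re z = 1\<close> the terms of the series separate, and each of them except the \<open>n\<close>-th is exponentially
  small after a shift to the right or to the left; on the other hand the line can be moved
  to \<open>Re (1 + T z) = -A\<close>, where only the growth of \<open>F\<close> matters. The factor \<open>z\<^bsup>2 m\<^esup>\<close> of the kernel
  cancels the pole of \<open>F\<close>.
\<close>

lemma dser_coeff_decay_aux:
  fixes F g :: "complex \<Rightarrow> complex" and a :: "nat \<Rightarrow> complex" and A \<kappa> C \<rho> :: real and m :: nat
  assumes abs: "dser_abs a 2" and eq: "\<And>s. Re s > 1 \<Longrightarrow> dser a s = F s"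
    and hol: "g holomorphic_on UNIV" and g: "\<And>s. s \<noteq> 1 \<Longrightarrow> g s = (s - 1) ^ m * F s"
    and ord: "eventually (\<lambda>s. norm (g s) \<le> exp (norm s powr \<rho>)) at_infinity"
    and A: "A \<ge> 0" and \<kappa>: "\<kappa> \<ge> 0"
    and line: "\<And>t. norm (F (Complex (-A) t)) \<le> C * (1 + \<bar>t\<bar>) powr \<kappa>"
  shows "\<exists>C1 C2. \<forall>n\<ge>2.
    norm (a n) \<le> C1 * real n powr (2 * \<kappa> - A) + C2 * ((real n)\<^sup>2 * exp (1 - real n))"
proof -
  \<comment> \<open>Wide enough for the lines \<open>Re z = 1\<close>, \<open>Re z = -1\<close> and
    \<open>Re z = -(A + 1) / T\<close> with \<open>T \<ge> 1\<close>.\<close>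
  define R where "R = A + 2"
  have R: "R > 0" "R \<ge> 1" "R \<ge> A + 1" using A by (auto simp: R_def)
  obtain E :: "complex \<Rightarrow> complex" where E: "E holomorphic_on UNIV"
    "\<And>c r p. c > 0 \<Longrightarrow> r > 0 \<Longrightarrow> \<exists>M>0. \<forall>z. \<bar>Re z\<bar> \<le> R \<longrightarrow>
       exp ((c * (1 + \<bar>Im z\<bar>)) powr r) * (1 + \<bar>Im z\<bar>) powr p * norm (E z) \<le> M / (1 + (Im z)\<^sup>2)"
    "\<And>m. (\<integral>t. Complex 0 t ^ (2 * m) * E (Complex 0 t) \<partial>lborel) \<noteq> 0"
    by (rule strip_kernel_exists[OF R(1)]) blast
  obtain G r where G: "G > 0" "r > 0" "\<And>s. norm (g s) \<le> G * exp (norm s powr r)"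
    by (rule entire_order_bound[OF hol ord]) blast
  \<comment> \<open>One half of the power cancels the pole; the other half makes the exponent even,
    so that the constant \<open>\<Lambda>\<close> below is nonzero.\<close>
  define K where "K z = z ^ (2 * m) * E z" for z
  have holK: "K holomorphic_on UNIV" unfolding K_def by (intro holomorphic_intros E)
  define \<Lambda> where "\<Lambda> = (\<integral>t. K (Complex 0 t) \<partial>lborel)"
  have \<Lambda>: "\<Lambda> \<noteq> 0" unfolding \<Lambda>_def K_def by (rule E(3))
  define J :: real where "J = (\<integral>t. 1 / (1 + t\<^sup>2) \<partial>lborel)"
  have J0: "J \<ge> 0" unfolding J_def by (intro integral_nonneg_AE AE_I2) auto
  have norm_z: "norm z \<le> (R + 1) * (1 + \<bar>Im z\<bar>)" if "\<bar>Re z\<bar> \<le> R" for z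
  proof -
    have "norm z \<le> \<bar>Re z\<bar> + \<bar>Im z\<bar>" by (rule cmod_le)
    also have "\<dots> \<le> R + \<bar>Im z\<bar> + (1 + R * \<bar>Im z\<bar>)"
      using that R mult_nonneg_nonneg[of R "\<bar>Im z\<bar>"] by linarith
    finally show ?thesis by (simp add: algebra_simps)
  qed
  obtain MK where MK: "MK > 0" "\<And>z. \<bar>Re z\<bar> \<le> R \<Longrightarrow> (1 + \<bar>Im z\<bar>) powr \<kappa> * norm (K z) \<le> MK / (1 + (Im z)\<^sup>2)"
  proof -
    obtain M where M: "M > 0" "\<And>z. \<bar>Re z\<bar> \<le> R \<Longrightarrow>
       exp ((1 * (1 + \<bar>Im z\<bar>)) powr 1) * (1 + \<bar>Im z\<bar>) powr (\<kappa> + real (2 * m)) * norm (E z) \<le> M / (1 + (Im z)\<^sup>2)"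
      using E(2)[of 1 1 "\<kappa> + real (2 * m)"] by auto
    show ?thesis
    proof (rule that[of "(R + 1) ^ (2 * m) * M"])
      fix z assume z: "\<bar>Re z\<bar> \<le> R"
      define u where "u = 1 + \<bar>Im z\<bar>"
      have u: "u > 0" by (simp add: u_def)
      have "u powr \<kappa> * norm (K z) \<le> u powr \<kappa> * (((R + 1) * u) ^ (2 * m) * norm (E z))"
        unfolding K_def norm_mult norm_power u_def
        by (intro mult_left_mono mult_right_mono power_mono norm_z[OF z]) auto
      also have "\<dots> = (R + 1) ^ (2 * m) * (1 * (u powr (\<kappa> + real (2 * m))) * norm (E z))"
        using u powr_realpow[OF u, of "2 * m"] unfolding powr_add power_mult_distrib by simp
      also have "\<dots> \<le> (R + 1) ^ (2 * m) * (exp ((1 * u) powr 1) * u powr (\<kappa> + real (2 * m)) * norm (E z))"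
        using R u by (intro mult_left_mono mult_right_mono) auto
      also have "\<dots> \<le> (R + 1) ^ (2 * m) * (M / (1 + (Im z)\<^sup>2))"
        using R unfolding u_def by (intro mult_left_mono M(2) z) auto
      finally show "(1 + \<bar>Im z\<bar>) powr \<kappa> * norm (K z) \<le> (R + 1) ^ (2 * m) * M / (1 + (Im z)\<^sup>2)"
        by (simp add: u_def)
    qed (use M R in auto)
  qed
  have K_le: "norm (K z) \<le> MK / (1 + (Im z)\<^sup>2)" if "\<bar>Re z\<bar> \<le> R" for z
  proof -
    have "1 * norm (K z) \<le> (1 + \<bar>Im z\<bar>) powr \<kappa> * norm (K z)"
      using \<kappa> by (intro mult_right_mono ge_one_powr_ge_zero) auto
    with MK(2)[OF that] show ?thesis by simp
  qed
  define S where "S = (\<Sum>j. norm (a (Suc j)) / real (Suc j) powr 2)"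
  have sumS: "summable (\<lambda>j. norm (a (Suc j)) / real (Suc j) powr 2)"
    using abs unfolding dser_abs_def .
  have C0: "C \<ge> 0"
    using order_trans[OF norm_ge_zero line[of 0]] by simp
  have main: "norm \<Lambda> * norm (a n) \<le> C * MK * J * real n powr (2 * \<kappa> - A) + MK * J * S * ((real n)\<^sup>2 * exp (1 - real n))"
    if n: "n \<ge> 2" for n
  proof -
    define T where "T = (real n)\<^sup>2"
    have T: "T \<ge> 1" using n by (simp add: T_def)
    define X where "X z = exp (of_real (ln (real n)) * (1 + of_real T * z))" for z :: complex
    \<comment> \<open>Written with \<open>g\<close> to be visibly entire: away from 0,
      \<open>g (1 + T z)\<close> is \<open>(T z) ^ m * F (1 + T z)\<close>, so dividing by
      \<open>T ^ m\<close> and multiplying by one more \<open>z ^ m\<close> produces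
      \<open>F * K\<close>.\<close>
    define f where "f z = X z * (g (1 + of_real T * z) / of_real T ^ m * z ^ m * E z)" for z
    have holf: "f holomorphic_on UNIV"
      unfolding f_def X_def using T
      by (intro holomorphic_intros holomorphic_on_compose_gen[OF _ hol, unfolded o_def] E) auto
    have f_eq: "f z = X z * (F (1 + of_real T * z) * K z)" if "z \<noteq> 0" for z
    proof -
      have "g (1 + of_real T * z) = (of_real T * z) ^ m * F (1 + of_real T * z)"
        using g[of "1 + of_real T * z"] that T by simp
      thus ?thesis using T by (simp add: f_def K_def power_mult_distrib mult_2 power_add)
    qed
    have norm_X: "norm (X z) = exp (ln (real n) * (1 + T * Re z))" for z
      by (simp add: X_def)
    \<comment> \<open>This bound depends on \<open>n\<close>: it only justifies integrability and
      the shift of the line, and does not enter the final estimate.\<close>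
    obtain Mf where Mf: "\<And>z. \<bar>Re z\<bar> \<le> R \<Longrightarrow> norm (f z) \<le> Mf / (1 + (Im z)\<^sup>2)"
    proof -
      define c where "c = 1 + T * (R + 1)"
      have c: "c > 0" using T R by (simp add: c_def add_pos_nonneg)
      obtain M where M: "M > 0" "\<And>z. \<bar>Re z\<bar> \<le> R \<Longrightarrow>
         exp ((c * (1 + \<bar>Im z\<bar>)) powr r) * (1 + \<bar>Im z\<bar>) powr real m * norm (E z) \<le> M / (1 + (Im z)\<^sup>2)"
        using E(2)[OF c G(2), of "real m"] by auto
      define B where "B = exp (ln (real n) * (1 + T * R))"
      show ?thesis
      proof (rule that[of "B * G * (R + 1) ^ m * M"])
        fix z assume z: "\<bar>Re z\<bar> \<le> R"
        define u where "u = 1 + \<bar>Im z\<bar>"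
        have u: "u \<ge> 1" by (simp add: u_def)
        have 1: "norm (X z) \<le> B"
        proof -
          have "T * Re z \<le> T * R" using z T by (intro mult_left_mono) auto
          thus ?thesis unfolding norm_X B_def using n by (auto intro!: mult_left_mono)
        qed
        have "norm (1 + of_real T * z) \<le> 1 + T * norm z"
          using T norm_triangle_ineq[of 1 "of_real T * z"] by (simp add: norm_mult)
        also have "\<dots> \<le> 1 * u + T * ((R + 1) * u)"
          using T norm_z[OF z] u by (intro add_mono mult_left_mono) (auto simp: u_def)
        finally have "norm (1 + of_real T * z) \<le> c * u" by (simp add: c_def algebra_simps)
        hence "norm (1 + of_real T * z) powr r \<le> (c * u) powr r"
          using G by (intro powr_mono2) auto
        hence "G * exp (norm (1 + of_real T * z) powr r) \<le> G * exp ((c * u) powr r)"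
          using G by simp
        with G(3)[of "1 + of_real T * z"] have 2: "norm (g (1 + of_real T * z)) \<le> G * exp ((c * u) powr r)"
          by (rule order_trans)
        have "1 \<le> T ^ m" using T by (rule one_le_power)
        hence "norm (g (1 + of_real T * z)) / T ^ m \<le> norm (g (1 + of_real T * z)) / 1"
          by (intro divide_left_mono) auto
        hence 3: "norm (g (1 + of_real T * z) / of_real T ^ m) \<le> G * exp ((c * u) powr r)"
          using 2 T by (simp add: norm_divide norm_power)
        have 4: "norm (z ^ m) \<le> (R + 1) ^ m * u powr real m"
        proof -
          have "norm (z ^ m) \<le> ((R + 1) * u) ^ m"
            unfolding norm_power u_def by (intro power_mono norm_z[OF z]) auto
          thus ?thesis using u by (simp add: power_mult_distrib powr_realpow)
        qed
        have "norm (f z) \<le> B * ((G * exp ((c * u) powr r)) * ((R + 1) ^ m * u powr real m) * norm (E z))"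
          unfolding f_def norm_mult[of "X z"] norm_mult[of _ "E z"] norm_mult[of _ "z ^ m"]
          using 1 3 4 G R by (intro mult_mono mult_nonneg_nonneg) (auto simp: B_def)
        also have "\<dots> = B * G * (R + 1) ^ m * (exp ((c * u) powr r) * u powr real m * norm (E z))"
          by (simp add: mult_ac)
        also have "\<dots> \<le> B * G * (R + 1) ^ m * (M / (1 + (Im z)\<^sup>2))"
          unfolding u_def using G R by (intro mult_left_mono M z) (auto simp: B_def)
        finally show "norm (f z) \<le> B * G * (R + 1) ^ m * M / (1 + (Im z)\<^sup>2)" by simp
      qed
    qed
    \<comment> \<open>Chosen so that \<open>1 + T * x0 = -A\<close>.\<close>
    define x0 where "x0 = - (A + 1) / T"
    have x0: "\<bar>x0\<bar> \<le> R" "x0 \<noteq> 0"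
    proof -
      have "\<bar>x0\<bar> = (A + 1) / T" using A T by (simp add: x0_def)
      also have "\<dots> \<le> (A + 1) / 1" using T A by (intro divide_left_mono) auto
      also have "\<dots> \<le> R" using R by simp
      finally show "\<bar>x0\<bar> \<le> R" .
      show "x0 \<noteq> 0" using A T by (auto simp: x0_def)
    qed
    have shift: "(\<integral>t. f (Complex 1 t) \<partial>lborel) = (\<integral>t. f (Complex x0 t) \<partial>lborel)"
      by (rule integral_line_shift[OF holf, of _ "-R" R _ Mf]) (use x0 R Mf in auto)
    \<comment> \<open>The factor \<open>X\<close> contributes \<open>n powr (-A)\<close>, and
      stretching heights by \<open>T\<close> costs
      \<open>T powr \<kappa> = n powr (2 * \<kappa>)\<close>.\<close>
    have left: "norm (\<integral>t. f (Complex x0 t) \<partial>lborel) \<le> C * MK * J * real n powr (2 * \<kappa> - A)"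
    proof -
      define B where "B = real n powr (2 * \<kappa> - A) * C * MK"
      have "norm (f (Complex x0 t)) \<le> B / (1 + t\<^sup>2)" for t
      proof -
        have ne: "Complex x0 t \<noteq> 0" using x0(2) by (auto simp: complex_eq_iff)
        have z: "1 + of_real T * Complex x0 t = Complex (-A) (T * t)"
          using T by (simp add: complex_eq_iff x0_def)
        have "norm (X (Complex x0 t)) = real n powr (-A)"
          using n T by (simp add: norm_X x0_def powr_def mult.commute)
        moreover have "norm (F (Complex (-A) (T * t))) \<le> C * (T * (1 + \<bar>t\<bar>)) powr \<kappa>"
        proof -
          have "1 + \<bar>T * t\<bar> \<le> T * (1 + \<bar>t\<bar>)" using T by (simp add: abs_mult algebra_simps)
          hence "(1 + \<bar>T * t\<bar>) powr \<kappa> \<le> (T * (1 + \<bar>t\<bar>)) powr \<kappa>"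
            using \<kappa> by (intro powr_mono2) auto
          hence "C * (1 + \<bar>T * t\<bar>) powr \<kappa> \<le> C * (T * (1 + \<bar>t\<bar>)) powr \<kappa>"
            using C0 by (rule mult_left_mono)
          with line[of "T * t"] show ?thesis by (rule order_trans)
        qed
        ultimately have "norm (f (Complex x0 t)) \<le> real n powr (-A) * ((C * (T * (1 + \<bar>t\<bar>)) powr \<kappa>) * norm (K (Complex x0 t)))"
          unfolding f_eq[OF ne] z norm_mult by (intro mult_mono mult_right_mono) auto
        also have "(T * (1 + \<bar>t\<bar>)) powr \<kappa> = T powr \<kappa> * (1 + \<bar>t\<bar>) powr \<kappa>"
          by (rule powr_mult)
        also have "T powr \<kappa> = real n powr (2 * \<kappa>)"
          using n by (simp add: T_def powr_powr flip: powr_numeral)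
        also have "real n powr (-A) * ((C * (real n powr (2 * \<kappa>) * (1 + \<bar>t\<bar>) powr \<kappa>)) * norm (K (Complex x0 t)))
            = real n powr (2 * \<kappa> - A) * C * ((1 + \<bar>t\<bar>) powr \<kappa> * norm (K (Complex x0 t)))"
          by (simp add: powr_diff powr_minus field_simps)
        also have "\<dots> \<le> real n powr (2 * \<kappa> - A) * C * (MK / (1 + t\<^sup>2))"
          using MK(2)[of "Complex x0 t"] x0 C0 by (intro mult_left_mono) auto
        finally show ?thesis by (simp add: B_def)
      qed
      moreover have "integrable lborel (\<lambda>t. f (Complex x0 t))"
        using Mf[of "Complex x0 _"] x0 by (intro integrable_line[OF holf, of _ Mf]) auto
      ultimately have "norm (\<integral>t. f (Complex x0 t) \<partial>lborel) \<le> B * J"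
        unfolding J_def by (rule norm_integral_line_le)
      thus ?thesis by (simp add: B_def mult_ac)
    qed
    define l where "l j = ln (real n) - ln (real (Suc j))" for j
    define w where "w j z = a (Suc j) * (exp (of_real (l j) * (1 + of_real T * z)) * K z)" for j z
    have holw: "w j holomorphic_on UNIV" for j
      unfolding w_def by (intro holomorphic_intros holK)
    have norm_w: "norm (w j z) = norm (a (Suc j)) * exp (l j * (1 + T * Re z)) * norm (K z)" for j z
      by (simp add: w_def norm_mult mult.assoc)
    have w_le: "norm (w j (Complex x t)) \<le> norm (a (Suc j)) * exp (l j * (1 + T * x)) * MK / (1 + t\<^sup>2)"
      if "\<bar>x\<bar> \<le> R" for j x t
      using mult_left_mono[OF K_le[of "Complex x t"], of "norm (a (Suc j)) * exp (l j * (1 + T * x))"] that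
      by (simp add: norm_w)
    have int_w: "integrable lborel (\<lambda>t. w j (Complex x t))" if "\<bar>x\<bar> \<le> R" for j x
      by (rule integrable_line[OF holw w_le[OF that]])
    have shift_w: "(\<integral>t. w j (Complex 1 t) \<partial>lborel) = (\<integral>t. w j (Complex x t) \<partial>lborel)" if "\<bar>x\<bar> \<le> R" for j x
    proof (rule integral_line_shift[OF holw])
      show "1 \<in> {-R..R}" "x \<in> {-R..R}" using that R by auto
      fix z assume "-R \<le> Re z" "Re z \<le> R"
      hence z: "\<bar>Re z\<bar> \<le> R" by auto
      have "norm (w j z) \<le> norm (a (Suc j)) * exp (l j * (1 + T * Re z)) * (MK / (1 + (Im z)\<^sup>2))"
        unfolding norm_w by (intro mult_left_mono K_le z) auto
      also have "\<dots> \<le> norm (a (Suc j)) * exp (\<bar>l j\<bar> * (1 + T * R)) * (MK / (1 + (Im z)\<^sup>2))"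
      proof -
        have "l j * (1 + T * Re z) \<le> \<bar>l j\<bar> * \<bar>1 + T * Re z\<bar>"
          by (metis abs_ge_self abs_mult)
        also have "\<bar>1 + T * Re z\<bar> \<le> 1 + T * R"
        proof -
          have "\<bar>T * Re z\<bar> \<le> T * R" using z T by (simp add: abs_mult mult_left_mono)
          thus ?thesis by linarith
        qed
        hence "\<bar>l j\<bar> * \<bar>1 + T * Re z\<bar> \<le> \<bar>l j\<bar> * (1 + T * R)" by (intro mult_left_mono) auto
        finally have "exp (l j * (1 + T * Re z)) \<le> exp (\<bar>l j\<bar> * (1 + T * R))" by simp
        thus ?thesis using MK(1) by (intro mult_right_mono mult_left_mono) (auto simp: add_nonneg_nonneg)
      qed
      finally show "norm (w j z) \<le> norm (a (Suc j)) * exp (\<bar>l j\<bar> * (1 + T * R)) * MK / (1 + (Im z)\<^sup>2)"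
        by simp
    qed
    have w_int_le: "norm (\<integral>t. w j (Complex 1 t) \<partial>lborel) \<le> norm (a (Suc j)) * exp (l j * (1 + T * x)) * MK * J"
      if "\<bar>x\<bar> \<le> R" for j x
      unfolding shift_w[OF that] J_def by (rule norm_integral_line_le[OF w_le[OF that] int_w[OF that]])
    have off: "norm (\<integral>t. w j (Complex 1 t) \<partial>lborel)
        \<le> norm (a (Suc j)) / real (Suc j) powr 2 * (MK * J * ((real n)\<^sup>2 * exp (1 - real n)))"
      if j: "Suc j \<noteq> n" for j
    proof -
      \<comment> \<open>Each term is moved to the side on which \<open>exp (l j * T * x)\<close>
        decreases.\<close>
      define x where "x = (if l j \<ge> 0 then - 1 else 1 :: real)"
      have "l j * (1 + T * x) = l j - (real n)\<^sup>2 * \<bar>l j\<bar>"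
        by (auto simp: x_def T_def algebra_simps)
      also have "\<dots> \<le> 2 * ln (real n) - 2 * ln (real (Suc j)) + (1 - real n)"
        unfolding l_def by (rule off_diagonal_exponent) (use n j in auto)
      finally have "exp (l j * (1 + T * x)) \<le> exp (2 * ln (real n) - 2 * ln (real (Suc j)) + (1 - real n))"
        by simp
      also have "\<dots> = (real n)\<^sup>2 * exp (1 - real n) / real (Suc j) powr 2"
      proof -
        have "exp (2 * ln (real n)) = (real n)\<^sup>2" using n by (simp add: exp_double)
        thus ?thesis unfolding exp_add exp_diff by (simp add: powr_def del: of_nat_Suc)
      qed
      finally have "norm (a (Suc j)) * exp (l j * (1 + T * x)) * MK * J \<le>
          norm (a (Suc j)) * ((real n)\<^sup>2 * exp (1 - real n) / real (Suc j) powr 2) * MK * J"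
        using MK(1) J0 by (intro mult_right_mono mult_left_mono) auto
      moreover have "\<bar>x\<bar> \<le> R" using R by (simp add: x_def)
      ultimately show ?thesis using w_int_le[of x j] by (simp add: mult_ac del: of_nat_Suc)
    qed
    \<comment> \<open>Here \<open>l\<close> is 0, so the exponential disappears, and moving the term
      to the imaginary axis gives \<open>\<Lambda>\<close>.\<close>
    have diag: "(\<integral>t. w (n - 1) (Complex 1 t) \<partial>lborel) = a n * \<Lambda>"
    proof -
      have "w (n - 1) z = a n * K z" for z using n by (simp add: w_def l_def)
      thus ?thesis using shift_w[of 0 "n - 1"] R by (simp add: \<Lambda>_def)
    qed
    have expand: "(\<lambda>j. w j (Complex 1 t)) sums f (Complex 1 t) \<and> summable (\<lambda>j. norm (w j (Complex 1 t)))" for t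
    proof -
      define s where "s = 1 + of_real T * Complex 1 t"
      have s: "Re s \<ge> 2" using T by (simp add: s_def)
      have ne: "Complex 1 t \<noteq> 0" by (auto simp: complex_eq_iff)
      have sm: "summable (\<lambda>j. norm (a (Suc j) / of_nat (Suc j) powr s))"
        by (rule dser_abs_norm_summable[OF abs s])
      have w_eq: "w j (Complex 1 t) = X (Complex 1 t) * K (Complex 1 t) * (a (Suc j) / of_nat (Suc j) powr s)" for j
        unfolding dser_term_exp w_def X_def s_def[symmetric] l_def
        by (simp add: left_diff_distrib exp_diff exp_minus field_simps del: of_nat_Suc)
      have sa: "(\<lambda>j. a (Suc j) / of_nat (Suc j) powr s) sums dser a s"
        unfolding dser_def by (rule summable_sums[OF summable_norm_cancel[OF sm]])
      have "X (Complex 1 t) * K (Complex 1 t) * dser a s = f (Complex 1 t)"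
        using f_eq[OF ne] eq[of s] s by (simp add: s_def)
      hence "(\<lambda>j. w j (Complex 1 t)) sums f (Complex 1 t)"
        using sums_mult[OF sa, of "X (Complex 1 t) * K (Complex 1 t)"] unfolding w_eq by (simp only:)
      moreover have "summable (\<lambda>j. norm (w j (Complex 1 t)))"
        using summable_mult[OF sm, of "norm (X (Complex 1 t) * K (Complex 1 t))"]
        unfolding w_eq norm_mult[of "X (Complex 1 t) * K (Complex 1 t)"] .
      ultimately show ?thesis by blast
    qed
    have sums_int: "(\<lambda>j. \<integral>t. w j (Complex 1 t) \<partial>lborel) sums (\<integral>t. f (Complex 1 t) \<partial>lborel)"
    proof -
      have "(\<lambda>j. \<integral>t. w j (Complex 1 t) \<partial>lborel) sums (\<integral>t. (\<Sum>j. w j (Complex 1 t)) \<partial>lborel)"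
      proof (rule sums_integral)
        show "integrable lborel (\<lambda>t. w j (Complex 1 t))" for j using int_w R by simp
        show "AE t in lborel. summable (\<lambda>j. norm (w j (Complex 1 t)))"
          using expand by (intro AE_I2) blast
        show "summable (\<lambda>j. \<integral>t. norm (w j (Complex 1 t)) \<partial>lborel)"
        proof (rule summable_comparison_test'[where N = 0])
          show "summable (\<lambda>j. norm (a (Suc j)) / real (Suc j) powr 2 * (exp (ln (real n) * (1 + T)) * MK * J))"
            using sumS by (rule summable_mult2)
          fix j
          have "norm (\<integral>t. norm (w j (Complex 1 t)) \<partial>lborel) = (\<integral>t. norm (w j (Complex 1 t)) \<partial>lborel)"
            by (simp add: integral_nonneg_AE)
          also have "\<dots> \<le> (\<integral>t. norm (a (Suc j)) * exp (l j * (1 + T * 1)) * MK * (1 / (1 + t\<^sup>2)) \<partial>lborel)"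
          proof (rule integral_mono)
            show "integrable lborel (\<lambda>t. norm (w j (Complex 1 t)))" using int_w R by simp
            show "integrable lborel (\<lambda>t. norm (a (Suc j)) * exp (l j * (1 + T * 1)) * MK * (1 / (1 + t\<^sup>2)))"
              using integrable_inverse_square[of "norm (a (Suc j)) * exp (l j * (1 + T * 1)) * MK"] by simp
            fix t show "norm (w j (Complex 1 t)) \<le> norm (a (Suc j)) * exp (l j * (1 + T * 1)) * MK * (1 / (1 + t\<^sup>2))"
              using w_le[of 1 j t] R by simp
          qed
          also have "\<dots> = norm (a (Suc j)) * exp (l j * (1 + T)) * MK * J"
            unfolding J_def integral_mult_right_zero by simp
          \<comment> \<open>Since \<open>1 + T \<ge> 2\<close>, the power of \<open>Suc j\<close>
            can be lowered to 2, where the coefficients are summable by assumption; this justifies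
            exchanging sum and integral.\<close>
          also have "\<dots> \<le> norm (a (Suc j)) * (exp (ln (real n) * (1 + T)) / real (Suc j) powr 2) * MK * J"
          proof -
            have "2 * ln (real (Suc j)) \<le> (1 + T) * ln (real (Suc j))"
              using T by (intro mult_right_mono) auto
            hence "exp (l j * (1 + T)) \<le> exp (ln (real n) * (1 + T) - 2 * ln (real (Suc j)))"
              by (simp add: l_def algebra_simps del: of_nat_Suc)
            also have "\<dots> = exp (ln (real n) * (1 + T)) / real (Suc j) powr 2"
              unfolding exp_diff by (simp add: powr_def del: of_nat_Suc)
            finally show ?thesis using MK(1) J0 by (intro mult_right_mono mult_left_mono) auto
          qed
          finally show "norm (\<integral>t. norm (w j (Complex 1 t)) \<partial>lborel) \<le>
              norm (a (Suc j)) / real (Suc j) powr 2 * (exp (ln (real n) * (1 + T)) * MK * J)"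
            by (simp add: mult_ac del: of_nat_Suc)
        qed
      qed
      moreover have "(\<Sum>j. w j (Complex 1 t)) = f (Complex 1 t)" for t
        using expand[of t] by (simp add: sums_iff)
      ultimately show ?thesis by simp
    qed
    have "(\<lambda>j. if j = n - 1 then a n * \<Lambda> else 0) sums (a n * \<Lambda>)"
      by (rule sums_single)
    from sums_diff[OF sums_int this]
    have d: "(\<lambda>j. if j = n - 1 then 0 else \<integral>t. w j (Complex 1 t) \<partial>lborel) sums ((\<integral>t. f (Complex 1 t) \<partial>lborel) - a n * \<Lambda>)"
      by (rule sums_cong[THEN iffD1, rotated]) (use diag in auto)
    have "norm ((\<integral>t. f (Complex 1 t) \<partial>lborel) - a n * \<Lambda>) \<le> S * (MK * J * ((real n)\<^sup>2 * exp (1 - real n)))"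
    proof -
      have "norm (\<Sum>j. if j = n - 1 then 0 else \<integral>t. w j (Complex 1 t) \<partial>lborel) \<le>
         (\<Sum>j. norm (a (Suc j)) / real (Suc j) powr 2 * (MK * J * ((real n)\<^sup>2 * exp (1 - real n))))"
      proof (rule norm_suminf_le)
        show "summable (\<lambda>j. norm (a (Suc j)) / real (Suc j) powr 2 * (MK * J * ((real n)\<^sup>2 * exp (1 - real n))))"
          using sumS by (rule summable_mult2)
        fix j
        show "norm (if j = n - 1 then 0 else \<integral>t. w j (Complex 1 t) \<partial>lborel) \<le>
             norm (a (Suc j)) / real (Suc j) powr 2 * (MK * J * ((real n)\<^sup>2 * exp (1 - real n)))"
        proof (cases "j = n - 1")
          case True
          thus ?thesis using MK(1) J0 by simp
        next
          case False
          hence "Suc j \<noteq> n" by auto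
          from off[OF this] show ?thesis using False by simp
        qed
      qed
      also have "\<dots> = S * (MK * J * ((real n)\<^sup>2 * exp (1 - real n)))"
        unfolding S_def by (rule suminf_mult2[OF sumS, symmetric])
      finally show ?thesis using d by (simp add: sums_iff)
    qed
    moreover have "norm \<Lambda> * norm (a n) = norm (a n * \<Lambda>)" by (simp add: norm_mult)
    moreover have "norm (a n * \<Lambda>) \<le> norm (\<integral>t. f (Complex 1 t) \<partial>lborel) + norm ((\<integral>t. f (Complex 1 t) \<partial>lborel) - a n * \<Lambda>)"
      by (metis add_diff_cancel_left' diff_add_cancel norm_minus_commute norm_triangle_sub)
    ultimately show ?thesis using left unfolding shift by (simp add: mult_ac)
  qed
  show ?thesis
  proof (rule exI[of _ "C * MK * J / norm \<Lambda>"], rule exI[of _ "MK * J * S / norm \<Lambda>"], intro allI impI)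
    fix n :: nat assume "n \<ge> 2"
    from main[OF this] \<Lambda> show "norm (a n) \<le> C * MK * J / norm \<Lambda> * real n powr (2 * \<kappa> - A) +
        MK * J * S / norm \<Lambda> * ((real n)\<^sup>2 * exp (1 - real n))"
      by (simp add: field_simps)
  qed
qed

text \<open>The error \<open>n^2 exp (1 - n)\<close> from the other terms lies below every power of
  \<open>n\<close>, so only the contribution of the shifted line remains.\<close>

lemma dser_coeff_decay:
  fixes F g :: "complex \<Rightarrow> complex" and a :: "nat \<Rightarrow> complex" and A \<kappa> C \<rho> :: real and m :: nat
  assumes "dser_abs a 2" "\<And>s. Re s > 1 \<Longrightarrow> dser a s = F s"
    and "g holomorphic_on UNIV" "\<And>s. s \<noteq> 1 \<Longrightarrow> g s = (s - 1) ^ m * F s"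
    and "eventually (\<lambda>s. norm (g s) \<le> exp (norm s powr \<rho>)) at_infinity"
    and "A \<ge> 0" "\<kappa> \<ge> 0"
    and "\<And>t. norm (F (Complex (-A) t)) \<le> C * (1 + \<bar>t\<bar>) powr \<kappa>"
  shows "(\<lambda>n. norm (a n)) \<in> O(\<lambda>n. real n powr (2 * \<kappa> - A))"
proof -
  obtain C1 C2 where C: "\<And>n. n \<ge> 2 \<Longrightarrow>
    norm (a n) \<le> C1 * real n powr (2 * \<kappa> - A) + C2 * ((real n)\<^sup>2 * exp (1 - real n))"
    using dser_coeff_decay_aux[OF assms] by blast
  have "(\<lambda>n. norm (a n)) \<in> O(\<lambda>n. C1 * real n powr (2 * \<kappa> - A) + C2 * ((real n)\<^sup>2 * exp (1 - real n)))"
  proof (rule bigoI[where c = 1])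
    show "eventually (\<lambda>n. norm (norm (a n)) \<le> 1 * norm (C1 * real n powr (2 * \<kappa> - A) + C2 * ((real n)\<^sup>2 * exp (1 - real n)))) at_top"
      using eventually_ge_at_top[of 2]
    proof eventually_elim
      case (elim n)
      from C[OF elim] show ?case by (simp add: abs_ge_self[THEN order_trans[rotated]])
    qed
  qed
  also have "(\<lambda>n. C1 * real n powr (2 * \<kappa> - A) + C2 * ((real n)\<^sup>2 * exp (1 - real n))) \<in> O(\<lambda>n. real n powr (2 * \<kappa> - A))"
  proof (intro sum_in_bigo)
    have "(\<lambda>n. (real n)\<^sup>2 * exp (1 - real n)) \<in> O(\<lambda>n. real n powr (2 * \<kappa> - A))"
      by real_asymp
    thus "(\<lambda>n. C2 * ((real n)\<^sup>2 * exp (1 - real n))) \<in> O(\<lambda>n. real n powr (2 * \<kappa> - A))" by simp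
  qed simp
  finally show ?thesis .
qed

section \<open>Small degree\<close>

text \<open>\<open>vgrowth\<close> is silent about small \<open>\<bar>t\<bar>\<close>; there a
  compact segment suffices, which misses the pole because \<open>A \<ge> 0\<close>. Replacing
  \<open>K\<close> by \<open>max 0 K\<close> makes the exponent nonnegative, so that
  \<open>1 + \<bar>t\<bar>\<close> can replace \<open>\<bar>t\<bar>\<close>.\<close>

lemma vgrowth_line_bound:
  assumes hol: "F holomorphic_on - {1}" and d: "d \<ge> 0" and gr: "vgrowth F d"
  obtains K A0 where "K \<ge> 0" "A0 \<ge> 0"
    "\<And>A. A \<ge> A0 \<Longrightarrow> \<exists>C. \<forall>t. norm (F (Complex (-A) t)) \<le> C * (1 + \<bar>t\<bar>) powr (d * A + K)"
proof -
  obtain K A0 where gr: "\<And>A. A \<ge> A0 \<Longrightarrow> \<exists>c>0. \<exists>C>0. \<exists>t0\<ge>1. \<forall>t. \<bar>t\<bar> \<ge> t0 \<longrightarrow>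
     c * \<bar>t\<bar> powr (d * A - K) \<le> norm (F (Complex (-A) t)) \<and>
     norm (F (Complex (-A) t)) \<le> C * \<bar>t\<bar> powr (d * A + K)"
    using gr unfolding vgrowth_def by blast
  show ?thesis
  proof (rule that[of "max 0 K" "max 0 A0"])
    fix A assume A: "A \<ge> max 0 A0"
    then obtain C t0 where C: "C > 0" "t0 \<ge> 1" "\<And>t. \<bar>t\<bar> \<ge> t0 \<Longrightarrow> norm (F (Complex (-A) t)) \<le> C * \<bar>t\<bar> powr (d * A + K)"
      using gr[of A] by auto
    have "continuous_on {-t0..t0} (\<lambda>t. F (Complex (-A) t))"
      unfolding Complex_eq using A
      by (intro continuous_on_compose2[OF holomorphic_on_imp_continuous_on[OF hol]] continuous_intros)
         (auto simp: complex_eq_iff)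
    hence "bounded ((\<lambda>t. F (Complex (-A) t)) ` {-t0..t0})"
      by (intro compact_imp_bounded compact_continuous_image) auto
    then obtain B where "\<forall>x\<in>(\<lambda>t. F (Complex (-A) t)) ` {-t0..t0}. norm x \<le> B"
      unfolding bounded_iff by blast
    hence B: "norm (F (Complex (-A) t)) \<le> B" if "\<bar>t\<bar> \<le> t0" for t
      using that by (auto simp: abs_le_iff)
    have ex: "d * A + max 0 K \<ge> 0" using d A by (auto intro!: add_nonneg_nonneg mult_nonneg_nonneg)
    have "norm (F (Complex (-A) t)) \<le> max B C * (1 + \<bar>t\<bar>) powr (d * A + max 0 K)" for t
    proof (cases "\<bar>t\<bar> \<le> t0")
      case True
      have "norm (F (Complex (-A) t)) \<le> max B C * 1" using B[OF True] by simp
      also have "\<dots> \<le> max B C * (1 + \<bar>t\<bar>) powr (d * A + max 0 K)"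
        using C(1) ex by (intro mult_left_mono ge_one_powr_ge_zero) auto
      finally show ?thesis .
    next
      case False
      hence t: "\<bar>t\<bar> \<ge> t0" "\<bar>t\<bar> \<ge> 1" using C(2) by auto
      have "norm (F (Complex (-A) t)) \<le> C * \<bar>t\<bar> powr (d * A + K)" by (rule C(3)[OF t(1)])
      also have "\<dots> \<le> max B C * \<bar>t\<bar> powr (d * A + max 0 K)"
        using t C(1) by (intro mult_mono powr_mono) auto
      also have "\<dots> \<le> max B C * (1 + \<bar>t\<bar>) powr (d * A + max 0 K)"
        using C(1) ex by (intro mult_left_mono powr_mono2) auto
      finally show ?thesis .
    qed
    thus "\<exists>C. \<forall>t. norm (F (Complex (-A) t)) \<le> C * (1 + \<bar>t\<bar>) powr (d * A + max 0 K)" by blast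
  qed auto
qed

text \<open>With the growth exponent \<open>\<kappa> = d * A + K\<close> the coefficient bound has
  the exponent \<open>2 * K - (1 - 2 * d) * A\<close>, which tends to minus infinity with growing
  \<open>A\<close> because \<open>d < 1 / 2\<close>.\<close>

lemma small_degree_rapid_decay:
  assumes abs: "dser_abs a 2" and eq: "dser_equals a F" and hol: "F holomorphic_on - {1}"
    and an: "selberg_analyticity F" and d: "d \<ge> 0" "d < 1 / 2" and gr: "vgrowth F d"
  shows "(\<lambda>n. norm (a n)) \<in> O(\<lambda>n. real n powr r)"
proof -
  obtain m g where g: "entire_finite_order g" "\<And>s. s \<noteq> 1 \<Longrightarrow> g s = (s - 1) ^ m * F s"
    using an unfolding selberg_analyticity_def by blast
  obtain \<rho> where g': "g holomorphic_on UNIV" "eventually (\<lambda>s. norm (g s) \<le> exp (norm s powr \<rho>)) at_infinity"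
    using g(1) unfolding entire_finite_order_def by blast
  obtain K A0 where K: "K \<ge> 0" "A0 \<ge> 0"
    "\<And>A. A \<ge> A0 \<Longrightarrow> \<exists>C. \<forall>t. norm (F (Complex (-A) t)) \<le> C * (1 + \<bar>t\<bar>) powr (d * A + K)"
    using vgrowth_line_bound[OF hol d(1) gr] by metis
  \<comment> \<open>The second entry solves \<open>2 * K - (1 - 2 * d) * A = r\<close>.\<close>
  define A where "A = max A0 ((2 * K - r) / (1 - 2 * d))"
  have A: "A \<ge> A0" "A \<ge> 0" using K by (auto simp: A_def)
  have "(2 * K - r) / (1 - 2 * d) \<le> A" by (simp add: A_def)
  hence "2 * K - r \<le> A * (1 - 2 * d)" using d(2) by (simp add: pos_divide_le_eq)
  hence ex: "2 * (d * A + K) - A \<le> r" by (simp add: algebra_simps)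
  obtain C where C: "\<And>t. norm (F (Complex (-A) t)) \<le> C * (1 + \<bar>t\<bar>) powr (d * A + K)"
    using K(3)[OF A(1)] by blast
  have "(\<lambda>n. norm (a n)) \<in> O(\<lambda>n. real n powr (2 * (d * A + K) - A))"
  proof (rule dser_coeff_decay[OF abs _ g'(1) g(2) g'(2) A(2) _ C])
    show "dser a s = F s" if "Re s > 1" for s using eq that by (simp add: dser_equals_def)
    show "0 \<le> d * A + K" using d K A by simp
  qed auto
  also have "(\<lambda>n. real n powr (2 * (d * A + K) - A)) \<in> O(\<lambda>n. real n powr r)"
  proof (rule bigoI[where c = 1])
    show "eventually (\<lambda>n. norm (real n powr (2 * (d * A + K) - A)) \<le> 1 * norm (real n powr r)) at_top"
      using eventually_ge_at_top[of 1]
    proof eventually_elim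
      case (elim n)
      thus ?case using ex by (auto intro!: powr_mono)
    qed
  qed
  finally show ?thesis .
qed

lemma dser_equals_everywhere:
  assumes "\<And>\<sigma>. dser_abs a \<sigma>" "dser_equals a F" "F holomorphic_on - {1}" "s \<noteq> 1"
  shows "dser a s = F s"
proof (rule analytic_continuation_open[where s = "{s. Re s > 1}" and s' = "- {1}"
      and f = "dser a" and g = F])
  show "dser a holomorphic_on - {1}"
    unfolding holomorphic_on_def field_differentiable_def
  proof
    fix x
    show "\<exists>f'. (dser a has_field_derivative f') (at x within - {1})"
      by (rule exI, rule has_field_derivative_at_within,
          rule has_field_derivative_dser[OF assms(1)[of "Re x - 1"]]) simp
  qed
  show "connected (- {1 :: complex})" by (rule connected_punctured_universe) simp
  show "{s. Re s > 1} \<noteq> {}" by (auto intro!: exI[of _ 2])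
qed (use assms in \<open>auto simp: open_halfspace_Re_gt dser_equals_def\<close>)

text \<open>Absolute convergence bounds the series on each vertical line, while for
  \<open>d > 0\<close> the lower growth bound becomes unbounded on a line far enough to the
  left.\<close>

lemma bounded_lines_degree_zero:
  assumes "\<And>\<sigma>. dser_abs a \<sigma>" "\<And>s. s \<noteq> 1 \<Longrightarrow> dser a s = F s" "d \<ge> 0" "vgrowth F d"
  shows "d = 0"
proof (rule ccontr)
  assume "d \<noteq> 0"
  hence d: "d > 0" using assms(3) by simp
  obtain K A0 where gr: "\<And>A. A \<ge> A0 \<Longrightarrow> \<exists>c>0. \<exists>C>0. \<exists>t0\<ge>1. \<forall>t. \<bar>t\<bar> \<ge> t0 \<longrightarrow>
     c * \<bar>t\<bar> powr (d * A - K) \<le> norm (F (Complex (-A) t)) \<and>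
     norm (F (Complex (-A) t)) \<le> C * \<bar>t\<bar> powr (d * A + K)"
    using assms(4) unfolding vgrowth_def by blast
  \<comment> \<open>With this \<open>A\<close> the lower bound grows at least linearly in
    \<open>\<bar>t\<bar>\<close>.\<close>
  define A where "A = max A0 (max 0 ((K + 1) / d))"
  have A: "A \<ge> A0" "A \<ge> 0" "(K + 1) / d \<le> A" by (auto simp: A_def)
  from A(3) have p: "d * A - K \<ge> 1" using d by (simp add: field_simps)
  obtain c t0 where c: "c > 0" "t0 \<ge> 1" "\<And>t. \<bar>t\<bar> \<ge> t0 \<Longrightarrow> c * \<bar>t\<bar> powr (d * A - K) \<le> norm (F (Complex (-A) t))"
    using gr[OF A(1)] by blast
  define M where "M = (\<Sum>n. norm (a (Suc n)) / real (Suc n) powr (-A))"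
  define t where "t = max t0 ((M + 1) / c)"
  have t: "t \<ge> t0" "t \<ge> 1" using c by (auto simp: t_def)
  have "(M + 1) / c \<le> t" by (simp add: t_def)
  hence "M + 1 \<le> c * t" using c by (simp add: field_simps)
  also have "c * t = c * \<bar>t\<bar> powr 1" using t by simp
  also have "\<dots> \<le> c * \<bar>t\<bar> powr (d * A - K)" using t p c by (intro mult_left_mono powr_mono) auto
  also have "\<dots> \<le> norm (F (Complex (-A) t))" using t by (intro c(3)) auto
  also have "F (Complex (-A) t) = dser a (Complex (-A) t)"
    using A(2) by (intro assms(2)[symmetric]) (auto simp: complex_eq_iff)
  also have "norm \<dots> \<le> M" unfolding M_def by (intro norm_dser_le assms(1)) simp
  finally show False by simp
qed

text \<open>The powers of one prime give a series dominated by a geometric one with ratio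
  \<open>p powr (\<theta> - \<sigma>)\<close>, so with finitely many primes convergence begins at
  \<open>\<theta>\<close>, a full unit to the left of the general range.\<close>

lemma dser_abs_finitely_many_primes:
  fixes P :: real
  assumes b: "\<And>n. n \<ge> 1 \<Longrightarrow> b n \<noteq> 0 \<Longrightarrow> \<exists>p k. prime p \<and> real p \<le> P \<and> k > 0 \<and> n = p ^ k"
    and bigo: "(\<lambda>n. norm (b n)) \<in> O(\<lambda>n. real n powr \<theta>)" and \<sigma>: "\<theta> < \<sigma>"
  shows "dser_abs b \<sigma>"
proof -
  define h where "h n = norm (b n) / real n powr \<sigma>" for n
  define \<P> where "\<P> = {p::nat. prime p \<and> real p \<le> P}"
  have "\<P> \<subseteq> {..nat \<lfloor>P\<rfloor>}" unfolding \<P>_def by (auto simp: le_nat_floor)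
  hence fin: "finite \<P>" by (rule finite_subset) simp
  obtain C where C: "eventually (\<lambda>n. norm (b n) \<le> C * real n powr \<theta>) at_top"
    using bigo by (auto elim!: landau_o.bigE)
  then obtain N where N: "\<And>n. n \<ge> N \<Longrightarrow> norm (b n) \<le> C * real n powr \<theta>"
    by (auto simp: eventually_at_top_linorder)
  define f where "f p n = (if n \<in> range (\<lambda>k. p ^ k) then h n else 0)" for p n :: nat
  have "summable (f p)" if p: "p \<in> \<P>" for p
  proof -
    have p2: "p \<ge> 2" using p prime_ge_2_nat by (auto simp: \<P>_def)
    have "summable (\<lambda>k. h (p ^ k))"
    proof (rule summable_comparison_test'[where N = N])
      have "real p powr (\<theta> - \<sigma>) < real p powr 0"
        using p2 \<sigma> by (intro powr_less_mono) auto
      hence "norm (real p powr (\<theta> - \<sigma>)) < 1" using p2 by simp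
      thus "summable (\<lambda>k. C * (real p powr (\<theta> - \<sigma>)) ^ k)"
        by (intro summable_mult summable_geometric)
      fix k assume k: "k \<ge> N"
      have "k < p ^ k" using p2 by (intro power_gt_expt) auto
      hence "norm (b (p ^ k)) \<le> C * real (p ^ k) powr \<theta>" using k by (intro N) auto
      hence "norm (h (p ^ k)) \<le> C * real (p ^ k) powr \<theta> / real (p ^ k) powr \<sigma>"
        unfolding h_def by (simp add: divide_right_mono)
      also have "\<dots> = C * real (p ^ k) powr (\<theta> - \<sigma>)" by (simp add: powr_diff)
      also have "real (p ^ k) powr (\<theta> - \<sigma>) = (real p powr (\<theta> - \<sigma>)) ^ k"
        using p2 by (simp add: powr_powr mult.commute flip: powr_realpow)
      finally show "norm (h (p ^ k)) \<le> C * (real p powr (\<theta> - \<sigma>)) ^ k" .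
    qed
    hence "summable (\<lambda>k. f p (p ^ k))" by (simp add: f_def)
    moreover have "strict_mono (\<lambda>k. p ^ k)" using p2 by (intro strict_monoI power_strict_increasing) auto
    ultimately show ?thesis
      by (subst (asm) summable_mono_reindex) (auto simp: f_def)
  qed
  hence "summable (\<lambda>n. \<Sum>p\<in>\<P>. f p n)" by (rule summable_sum)
  hence "summable h"
  proof (rule summable_comparison_test'[where N = 1])
    fix n :: nat assume n: "n \<ge> 1"
    have f0: "f p n \<ge> 0" for p by (simp add: f_def h_def)
    show "norm (h n) \<le> (\<Sum>p\<in>\<P>. f p n)"
    proof (cases "b n = 0")
      case True
      thus ?thesis using f0 by (simp add: h_def sum_nonneg)
    next
      case False
      from b[OF n this] obtain p k where p: "p \<in> \<P>" "n = p ^ k" by (auto simp: \<P>_def)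
      have "norm (h n) = f p n" using p(2) by (simp add: f_def h_def)
      also have "\<dots> \<le> (\<Sum>p\<in>\<P>. f p n)" using fin p f0 by (intro member_le_sum) auto
      finally show ?thesis .
    qed
  qed
  thus ?thesis unfolding dser_abs_def h_def by (subst (asm) summable_Suc_iff[symmetric])
qed

text \<open>The identity theorem on a connected half-plane carries the logarithm as far left as both
  series converge absolutely; in the application this crosses the critical line.\<close>

lemma exp_dser_continuation:
  assumes "dser_abs a \<sigma>1" "dser_abs b \<sigma>1" "\<And>s. Re s > 1 \<Longrightarrow> exp (dser b s) = dser a s" "\<sigma>1 < 1" "Re s > \<sigma>1"
  shows "exp (dser b s) = dser a s"
proof (rule analytic_continuation_open[where s = "{s. Re s > 1}" and s' = "{s. Re s > \<sigma>1}"
      and f = "\<lambda>s. exp (dser b s)" and g = "dser a"])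
  show "(\<lambda>s. exp (dser b s)) holomorphic_on {s. Re s > \<sigma>1}"
    by (intro holomorphic_on_exp' holomorphic_dser[OF assms(2)]) auto
  show "dser a holomorphic_on {s. Re s > \<sigma>1}" by (rule holomorphic_dser[OF assms(1)]) auto
  show "connected {s. Re s > \<sigma>1}" by (intro convex_connected convex_halfspace_Re_gt)
  show "{s. Re s > 1} \<noteq> {}" by (auto intro!: exI[of _ 2])
qed (use assms in \<open>auto simp: open_halfspace_Re_gt\<close>)

text \<open>
  The mean value of \<open>log |D(\<sigma> + i t)| = Re (\<Sum> b\<^sub>n n\<^sup>-\<^sup>s)\<close> over \<open>t\<close> is \<open>b\<^sub>1 = 0\<close> for every \<open>\<sigma>\<close> to the right of
  \<open>\<sigma>1\<close>; comparing \<open>\<sigma>\<close> and \<open>1 - \<sigma>\<close> through the functional equation forces \<open>Q = 1\<close>.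
\<close>

lemma functional_equation_conductor_one:
  assumes b: "dser_abs b \<sigma>1" "b 1 = 0" "\<sigma>1 < 1 / 2" and Q: "Q > 0"
    and ex: "\<And>s. Re s > \<sigma>1 \<Longrightarrow> exp (dser b s) = D s"
    and fe: "\<And>s. s \<noteq> 0 \<Longrightarrow> s \<noteq> 1 \<Longrightarrow> norm (D s) = Q powr (1 - 2 * Re s) * norm (D (cnj (1 - s)))"
  shows "Q = 1"
proof -
  \<comment> \<open>Strictly between \<open>max 0 \<sigma>1\<close> and 1/2: both
    \<open>\<sigma>\<close> and \<open>1 - \<sigma>\<close> then lie to the right of
    \<open>\<sigma>1\<close>, and neither line meets 0 or 1.\<close>
  define \<sigma> where "\<sigma> = (max 0 \<sigma>1 + 1 / 2) / 2"
  have \<sigma>: "\<sigma> > \<sigma>1" "\<sigma> > 0" "\<sigma> < 1 / 2" using b(3) by (auto simp: \<sigma>_def)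
  define h where "h t = dser b (Complex \<sigma> t) - dser b (Complex (1 - \<sigma>) t)" for t
  define q where "q = (1 - 2 * \<sigma>) * ln Q"
  have Re_b: "Re (dser b s) = ln (norm (D s))" if "Re s > \<sigma>1" for s
    using arg_cong[OF ex[OF that], of norm] ln_unique[of "Re (dser b s)"] by simp
  \<comment> \<open>The functional equation makes the real part of \<open>h\<close> constant, while
    its mean value will be 0.\<close>
  have Re_h: "Re (h t) = q" for t
  proof -
    have D: "norm (D s) > 0" if "Re s > \<sigma>1" for s
      using ex[OF that] by (metis exp_not_eq_zero zero_less_norm_iff)
    have cs: "cnj (1 - Complex \<sigma> t) = Complex (1 - \<sigma>) t" by (simp add: complex_eq_iff)
    have "norm (D (Complex \<sigma> t)) = Q powr (1 - 2 * \<sigma>) * norm (D (Complex (1 - \<sigma>) t))"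
      using fe[of "Complex \<sigma> t"] \<sigma> unfolding cs by (simp add: complex_eq_iff)
    hence "ln (norm (D (Complex \<sigma> t))) = q + ln (norm (D (Complex (1 - \<sigma>) t)))"
      using D[of "Complex (1 - \<sigma>) t"] \<sigma> Q by (simp add: ln_mult q_def ln_powr)
    thus ?thesis using \<sigma> by (simp add: h_def Re_b)
  qed
  have cont: "continuous_on S (\<lambda>t. dser b (Complex \<tau> t))" if "\<tau> > \<sigma>1" for \<tau> S
    by (rule continuous_on_dser_line[OF b(1) that])
  have mean: "((\<lambda>T. integral {0..T} (\<lambda>t. dser b (Complex \<tau> t)) / of_real T) \<longlongrightarrow> 0) at_top" if "\<tau> > \<sigma>1" for \<tau>
    using dser_mean_value[OF dser_abs_mono[OF b(1)], of \<tau> 1] that b(2) by simp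
  have "((\<lambda>T. integral {0..T} h / of_real T) \<longlongrightarrow> 0) at_top"
  proof -
    have "((\<lambda>T. integral {0..T} (\<lambda>t. dser b (Complex \<sigma> t)) / of_real T -
              integral {0..T} (\<lambda>t. dser b (Complex (1 - \<sigma>) t)) / of_real T) \<longlongrightarrow> 0 - 0) at_top"
      using \<sigma> by (intro tendsto_diff mean) auto
    moreover have "integral {0..T} h = integral {0..T} (\<lambda>t. dser b (Complex \<sigma> t)) - integral {0..T} (\<lambda>t. dser b (Complex (1 - \<sigma>) t))" for T
      unfolding h_def using \<sigma> by (intro integral_diff integrable_continuous_interval cont) auto
    ultimately show ?thesis by (simp add: diff_divide_distrib)
  qed
  hence "((\<lambda>T. Re (integral {0..T} h / of_real T)) \<longlongrightarrow> Re 0) at_top" by (rule tendsto_Re)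
  moreover have "eventually (\<lambda>T. Re (integral {0..T} h / of_real T) = q) at_top"
    using eventually_gt_at_top[of 0]
  proof eventually_elim
    case (elim T)
    have "h integrable_on {0..T}"
      unfolding h_def using \<sigma> by (intro integrable_diff integrable_continuous_interval cont) auto
    hence "Re (integral {0..T} h) = integral {0..T} (\<lambda>t. Re (h t))"
      using integral_linear[OF _ bounded_linear_Re, of h "{0..T}"] by (simp add: o_def)
    also have "\<dots> = T * q" using elim by (simp add: Re_h)
    finally show ?case using elim by (simp add: Re_divide_of_real)
  qed
  ultimately have "((\<lambda>_. q) \<longlongrightarrow> 0) (at_top :: real filter)"
    by (simp add: tendsto_cong)
  hence "q = 0" by (simp add: tendsto_const_iff)
  thus ?thesis using \<sigma> Q by (simp add: q_def)
qed

lemma dser_eq_first: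
  assumes "\<And>n. n > 1 \<Longrightarrow> a n = 0" "a 1 = 1"
  shows "dser a s = 1"
proof -
  have "dser a s = (\<Sum>n. if n = 0 then 1 else 0)"
    unfolding dser_def using assms by (intro suminf_cong) auto
  thus ?thesis using sums_single[of 0 "\<lambda>_. 1 :: complex"] by (simp add: sums_iff)
qed

text \<open>Without gamma factors, the reflected lines bound \<open>a n\<close> by powers of
  \<open>Q^2 / n\<close>, so only finitely many coefficients survive. By the recursion for the
  logarithm only finitely many primes do, which moves the convergence of \<open>b\<close> to the
  left of 1/2 and forces the conductor to be 1.\<close>

lemma degree_zero_trivial:
  assumes abs: "\<And>\<sigma>. dser_abs a \<sigma>" and ep: "selberg_euler_product a" and Q: "Q > 0"
    and fe: "\<And>s. s \<noteq> 0 \<Longrightarrow> s \<noteq> 1 \<Longrightarrow> norm (dser a s) = Q powr (1 - 2 * Re s) * norm (dser a (cnj (1 - s)))"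
  shows "dser a s = 1"
proof -
  obtain b \<theta> where a1: "a 1 = 1"
    and ex: "\<And>s. Re s > 1 \<Longrightarrow> exp (dser b s) = dser a s"
    and bp: "\<And>n. n \<ge> 1 \<Longrightarrow> b n \<noteq> 0 \<Longrightarrow> \<exists>p k. prime p \<and> k > 0 \<and> n = p ^ k"
    and \<theta>: "\<theta> < 1 / 2" "(\<lambda>n. norm (b n)) \<in> O(\<lambda>n. real n powr \<theta>)"
    using ep unfolding selberg_euler_product_def by blast
  have b1: "b 1 = 0"
  proof (rule ccontr)
    assume "b 1 \<noteq> 0"
    then obtain p k where "prime p" "k > 0" "(1::nat) = p ^ k" using bp[of 1] by auto
    thus False using one_less_power[of p k] prime_gt_1_nat[of p] by simp
  qed
  have a0: "a n = 0" if n: "real n > Q\<^sup>2" for n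
  proof -
    have n1: "n \<ge> 1" using n Q by (cases n) auto
    define M where "M = (\<Sum>n. norm (a (Suc n)) / real (Suc n) powr 2)"
    \<comment> \<open>For \<open>k \<ge> 1\<close> the mirrored line \<open>Re s = 1 + k\<close>
      lies in \<open>Re s \<ge> 2\<close>, where \<open>M\<close> is a bound;
      \<open>Q powr (1 + 2 * k)\<close> against \<open>n powr (- k)\<close> gives the geometric
      ratio \<open>Q^2 / n\<close>.\<close>
    have bd: "norm (a n) \<le> Q * M * (Q\<^sup>2 / real n) ^ k" if "k \<ge> 1" for k
    proof -
      have "norm (dser a (Complex (- real k) t)) \<le> Q powr (1 + 2 * real k) * M" for t
      proof -
        have "norm (dser a (Complex (- real k) t)) = Q powr (1 + 2 * real k) * norm (dser a (cnj (1 - Complex (- real k) t)))"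
          using fe[of "Complex (- real k) t"] that by (auto simp: complex_eq_iff)
        also have "\<dots> \<le> Q powr (1 + 2 * real k) * M"
          unfolding M_def using that by (intro mult_left_mono norm_dser_le abs) auto
        finally show ?thesis .
      qed
      hence "norm (a n) \<le> Q powr (1 + 2 * real k) * M * real n powr (- real k)"
        by (rule dser_coeff_bound[OF abs[of "- real k - 1"], rotated]) (use n1 in auto)
      also have "\<dots> = Q * M * (Q\<^sup>2 / real n) ^ k"
      proof -
        have "Q powr (2 * real k) = (Q\<^sup>2) ^ k"
          using Q powr_realpow[of Q "2 * k"] by (simp add: power_mult)
        thus ?thesis using Q n1 by (simp add: powr_add powr_minus powr_realpow field_simps)
      qed
      finally show ?thesis .
    qed
    have "(\<lambda>k. Q * M * (Q\<^sup>2 / real n) ^ k) \<longlonglongrightarrow> Q * M * 0"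
      using n n1 Q by (intro tendsto_mult tendsto_const LIMSEQ_realpow_zero) auto
    moreover have "eventually (\<lambda>k. norm (a n) \<le> Q * M * (Q\<^sup>2 / real n) ^ k) sequentially"
      using eventually_ge_at_top[of 1] by eventually_elim (rule bd)
    ultimately have "norm (a n) \<le> Q * M * 0"
      by (intro tendsto_lowerbound) auto
    thus ?thesis by simp
  qed
  have abs_b: "dser_abs b 2" using \<theta> by (intro dser_abs_bigo[OF \<theta>(2)]) auto
  have b0: "real p \<le> Q\<^sup>2" if p: "prime p" "k > 0" "b (p ^ k) \<noteq> 0" for p k
  proof (rule ccontr)
    assume "\<not> real p \<le> Q\<^sup>2"
    hence pQ: "real p > Q\<^sup>2" by simp
    define n where "n = p ^ k"
    have p2: "p \<ge> 2" using p(1) by (rule prime_ge_2_nat)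
    have n1: "n > 1" unfolding n_def using p p2 by (intro one_less_power) auto
    \<comment> \<open>Every divisor of \<open>p ^ k\<close> other than 1 is at least
      \<open>p\<close>, hence beyond the cut-off \<open>Q^2\<close>; only the divisor 1 contributes
      to the convolution.\<close>
    have ad: "a d = 0" if dvd: "d dvd n" "d \<noteq> 1" for d
    proof -
      obtain i where i: "d = p ^ i" using dvd(1) p(1) unfolding n_def by (auto simp: divides_primepow_nat)
      have "i \<noteq> 0" using dvd(2) i by (cases i) auto
      hence "p ^ 1 \<le> d" unfolding i using p2 by (intro power_increasing) auto
      thus ?thesis using pQ by (intro a0) auto
    qed
    have "of_real (ln (real n)) * a n = dconv a (\<lambda>n. of_real (ln (real n)) * b n) n"
      using n1 by (intro exp_dser_recursion[of a 2 b] abs abs_b ex) auto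
    also have "\<dots> = (\<Sum>d\<in>{1}. a d * (of_real (ln (real (n div d))) * b (n div d)))"
      unfolding dconv_def using n1 ad by (intro sum.mono_neutral_right) auto
    also have "\<dots> = of_real (ln (real n)) * b n" using a1 by simp
    finally have "ln (real n) = 0 \<or> b n = 0" using ad[of n] n1 by simp
    moreover have "ln (real n) \<noteq> 0" using ln_gt_zero[of "real n"] n1 by simp
    ultimately have "b n = 0" by blast
    thus False using p(3) unfolding n_def by contradiction
  qed
  \<comment> \<open>Strictly between \<open>\<theta>\<close> and 1/2: the bound
    \<open>\<theta> < 1 / 2\<close> in the Euler product axiom is what makes room for it.\<close>
  define \<sigma>1 where "\<sigma>1 = (\<theta> + 1 / 2) / 2"
  have \<sigma>1: "\<theta> < \<sigma>1" "\<sigma>1 < 1 / 2" using \<theta> by (auto simp: \<sigma>1_def)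
  have abs_b1: "dser_abs b \<sigma>1"
    by (rule dser_abs_finitely_many_primes[where P = "Q\<^sup>2", OF _ \<theta>(2) \<sigma>1(1)]) (use bp b0 in blast)
  have "Q = 1"
  proof (rule functional_equation_conductor_one[OF abs_b1 b1 \<sigma>1(2) Q _ fe])
    show "exp (dser b s) = dser a s" if "Re s > \<sigma>1" for s
      using \<sigma>1 by (intro exp_dser_continuation[OF abs abs_b1 ex _ that]) auto
  qed auto
  \<comment> \<open>With \<open>Q = 1\<close> the cut-off \<open>n > Q^2\<close> reads
    \<open>n > 1\<close>.\<close>
  hence "a n = 0" if "n > 1" for n using a0[of n] that by simp
  thus ?thesis using a1 by (rule dser_eq_first)
qed

lemma selberg_class_vgrowth:
  assumes "a \<in> selberg_class"
  obtains F d where "F holomorphic_on - {1}" "dser_equals a F" "d \<ge> 0" "vgrowth F d"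
    "d < 1 / 2 \<Longrightarrow> dser_equals a (\<lambda>_. 1)"
proof -
  obtain F where F: "F holomorphic_on - {1}" "dser_equals a F" "selberg_analyticity F" "selberg_functional_equation F"
    and ra: "ramanujan_hypothesis a" and ep: "selberg_euler_product a"
    using assms unfolding selberg_class_def by blast
  have abs: "dser_abs a 2" by (rule dser_abs_ramanujan[OF ra]) simp
  have a1: "a 1 = 1" using ep by (simp add: selberg_euler_product_def)
  obtain d where d: "d \<ge> 0" "vgrowth F d"
    "d = 0 \<Longrightarrow> \<exists>Q>0. \<forall>s. s \<noteq> 0 \<longrightarrow> s \<noteq> 1 \<longrightarrow> norm (F s) = Q powr (1 - 2 * Re s) * norm (F (cnj (1 - s)))"
    using selberg_functional_equation_vgrowth[OF F(1,4) abs a1 F(2)] by metis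
  have "dser_equals a (\<lambda>_. 1)" if d2: "d < 1 / 2"
  proof -
    \<comment> \<open>The decay exponent \<open>\<sigma> - 2\<close> leaves one unit to spare for
      absolute convergence at \<open>\<sigma>\<close>.\<close>
    have all: "dser_abs a \<sigma>" for \<sigma>
      by (rule dser_abs_bigo[OF small_degree_rapid_decay[OF abs F(2,1,3) d(1) d2 d(2), of "\<sigma> - 2"]]) simp
    have eq: "dser a s = F s" if "s \<noteq> 1" for s by (rule dser_equals_everywhere[OF all F(2,1) that])
    have "d = 0" by (rule bounded_lines_degree_zero[OF all eq d(1,2)])
    then obtain Q where Q: "Q > 0" "\<And>s. s \<noteq> 0 \<Longrightarrow> s \<noteq> 1 \<Longrightarrow> norm (F s) = Q powr (1 - 2 * Re s) * norm (F (cnj (1 - s)))"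
      using d(3) by blast
    have "dser a s = 1" for s
    proof (rule degree_zero_trivial[OF all ep Q(1)])
      fix s :: complex assume s: "s \<noteq> 0" "s \<noteq> 1"
      have "cnj (1 - s) \<noteq> 1" using s(1) by (auto simp: complex_eq_iff)
      thus "norm (dser a s) = Q powr (1 - 2 * Re s) * norm (dser a (cnj (1 - s)))"
        using Q(2)[OF s] s by (simp add: eq del: complex_cnj_diff)
    qed
    thus ?thesis by (simp add: dser_equals_def)
  qed
  thus ?thesis by (rule that[OF F(1,2) d(1,2)])
qed

section \<open>Factorization into primitive elements\<close>

lemma vgrowth_mult:
  assumes "vgrowth F1 d1" "vgrowth F2 d2"
  shows "vgrowth (\<lambda>s. F1 s * F2 s) (d1 + d2)"
proof -
  obtain K1 A1 where 1: "\<And>A. A \<ge> A1 \<Longrightarrow> \<exists>c>0. \<exists>C>0. \<exists>t0\<ge>1. \<forall>t. \<bar>t\<bar> \<ge> t0 \<longrightarrow>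
     c * \<bar>t\<bar> powr (d1 * A - K1) \<le> norm (F1 (Complex (-A) t)) \<and>
     norm (F1 (Complex (-A) t)) \<le> C * \<bar>t\<bar> powr (d1 * A + K1)"
    using assms(1) unfolding vgrowth_def by blast
  obtain K2 A2 where 2: "\<And>A. A \<ge> A2 \<Longrightarrow> \<exists>c>0. \<exists>C>0. \<exists>t0\<ge>1. \<forall>t. \<bar>t\<bar> \<ge> t0 \<longrightarrow>
     c * \<bar>t\<bar> powr (d2 * A - K2) \<le> norm (F2 (Complex (-A) t)) \<and>
     norm (F2 (Complex (-A) t)) \<le> C * \<bar>t\<bar> powr (d2 * A + K2)"
    using assms(2) unfolding vgrowth_def by blast
  show ?thesis
    unfolding vgrowth_def
  proof (rule exI[of _ "K1 + K2"], rule exI[of _ "max A1 A2"], intro allI impI)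
    fix A assume A: "max A1 A2 \<le> A"
    obtain c1 C1 t1 where c1: "c1 > 0" "C1 > 0" "t1 \<ge> 1"
      "\<And>t. \<bar>t\<bar> \<ge> t1 \<Longrightarrow> c1 * \<bar>t\<bar> powr (d1 * A - K1) \<le> norm (F1 (Complex (-A) t))"
      "\<And>t. \<bar>t\<bar> \<ge> t1 \<Longrightarrow> norm (F1 (Complex (-A) t)) \<le> C1 * \<bar>t\<bar> powr (d1 * A + K1)"
      using 1[of A] A by auto
    obtain c2 C2 t2 where c2: "c2 > 0" "C2 > 0" "t2 \<ge> 1"
      "\<And>t. \<bar>t\<bar> \<ge> t2 \<Longrightarrow> c2 * \<bar>t\<bar> powr (d2 * A - K2) \<le> norm (F2 (Complex (-A) t))"
      "\<And>t. \<bar>t\<bar> \<ge> t2 \<Longrightarrow> norm (F2 (Complex (-A) t)) \<le> C2 * \<bar>t\<bar> powr (d2 * A + K2)"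
      using 2[of A] A by auto
    have "c1 * c2 * \<bar>t\<bar> powr ((d1 + d2) * A - (K1 + K2)) \<le> norm (F1 (Complex (-A) t) * F2 (Complex (-A) t)) \<and>
       norm (F1 (Complex (-A) t) * F2 (Complex (-A) t)) \<le> C1 * C2 * \<bar>t\<bar> powr ((d1 + d2) * A + (K1 + K2))"
      if t: "\<bar>t\<bar> \<ge> max t1 t2" for t
    proof -
      have e: "(d1 + d2) * A - (K1 + K2) = (d1 * A - K1) + (d2 * A - K2)"
          "(d1 + d2) * A + (K1 + K2) = (d1 * A + K1) + (d2 * A + K2)" by (simp_all add: algebra_simps)
      have "(c1 * \<bar>t\<bar> powr (d1 * A - K1)) * (c2 * \<bar>t\<bar> powr (d2 * A - K2)) \<le> norm (F1 (Complex (-A) t)) * norm (F2 (Complex (-A) t))"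
        using t c1 c2 by (intro mult_mono) auto
      moreover have "norm (F1 (Complex (-A) t)) * norm (F2 (Complex (-A) t)) \<le> (C1 * \<bar>t\<bar> powr (d1 * A + K1)) * (C2 * \<bar>t\<bar> powr (d2 * A + K2))"
        using t c1 c2 by (intro mult_mono) auto
      ultimately show ?thesis unfolding e norm_mult powr_add by (simp only: mult_ac)
    qed
    moreover have "c1 * c2 > 0" "C1 * C2 > 0" "max t1 t2 \<ge> 1" using c1 c2 by auto
    ultimately show "\<exists>c>0. \<exists>C>0. \<exists>t0\<ge>1. \<forall>t. \<bar>t\<bar> \<ge> t0 \<longrightarrow>
       c * \<bar>t\<bar> powr ((d1 + d2) * A - (K1 + K2)) \<le> norm (F1 (Complex (-A) t) * F2 (Complex (-A) t)) \<and>
       norm (F1 (Complex (-A) t) * F2 (Complex (-A) t)) \<le> C * \<bar>t\<bar> powr ((d1 + d2) * A + (K1 + K2))"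
      by blast
  qed
qed

lemma powr_le_powr_exponent:
  fixes c C p q t0 :: real
  assumes "c > 0" "\<And>t. t \<ge> t0 \<Longrightarrow> c * t powr p \<le> C * t powr q"
  shows "p \<le> q"
proof (rule ccontr)
  assume "\<not> p \<le> q"
  hence "p - q > 0" by simp
  hence "filterlim (\<lambda>t::real. t powr (p - q)) at_top at_top" by real_asymp
  hence "eventually (\<lambda>t. t powr (p - q) > C / c) at_top" by (simp add: filterlim_at_top_dense)
  moreover have "eventually (\<lambda>t. t powr (p - q) \<le> C / c) at_top"
    using eventually_ge_at_top[of "max 1 t0"]
  proof eventually_elim
    case (elim t)
    have "c * t powr p \<le> C * t powr q" using elim by (intro assms(2)) auto
    thus ?case using assms(1) elim by (simp add: powr_diff field_simps)
  qed
  ultimately have "eventually (\<lambda>_::real. False) at_top" by eventually_elim simp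
  thus False by simp
qed

text \<open>At a single large \<open>A\<close> the bounds give
  \<open>(d - d') * A \<le> K1 + K2\<close>; since the slacks do not depend on \<open>A\<close>, a
  positive \<open>d - d'\<close> contradicts this once \<open>A\<close> is large enough.\<close>

lemma vgrowth_le:
  assumes "vgrowth F d" "vgrowth G d'" "\<And>s. s \<noteq> 1 \<Longrightarrow> F s = G s"
  shows "d \<le> d'"
proof (rule ccontr)
  assume "\<not> d \<le> d'"
  hence dd: "d - d' > 0" by simp
  obtain K1 A1 where 1: "\<And>A. A \<ge> A1 \<Longrightarrow> \<exists>c>0. \<exists>C>0. \<exists>t0\<ge>1. \<forall>t. \<bar>t\<bar> \<ge> t0 \<longrightarrow>
     c * \<bar>t\<bar> powr (d * A - K1) \<le> norm (F (Complex (-A) t)) \<and>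
     norm (F (Complex (-A) t)) \<le> C * \<bar>t\<bar> powr (d * A + K1)"
    using assms(1) unfolding vgrowth_def by blast
  obtain K2 A2 where 2: "\<And>A. A \<ge> A2 \<Longrightarrow> \<exists>c>0. \<exists>C>0. \<exists>t0\<ge>1. \<forall>t. \<bar>t\<bar> \<ge> t0 \<longrightarrow>
     c * \<bar>t\<bar> powr (d' * A - K2) \<le> norm (G (Complex (-A) t)) \<and>
     norm (G (Complex (-A) t)) \<le> C * \<bar>t\<bar> powr (d' * A + K2)"
    using assms(2) unfolding vgrowth_def by blast
  define A where "A = max (max A1 A2) (max 0 ((K1 + K2 + 1) / (d - d')))"
  have A: "A \<ge> A1" "A \<ge> A2" "A \<ge> 0" "(K1 + K2 + 1) / (d - d') \<le> A" by (auto simp: A_def)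
  obtain c t1 where c: "c > 0" "t1 \<ge> 1" "\<And>t. \<bar>t\<bar> \<ge> t1 \<Longrightarrow> c * \<bar>t\<bar> powr (d * A - K1) \<le> norm (F (Complex (-A) t))"
    using 1[OF A(1)] by blast
  obtain C t2 where C: "t2 \<ge> 1" "\<And>t. \<bar>t\<bar> \<ge> t2 \<Longrightarrow> norm (G (Complex (-A) t)) \<le> C * \<bar>t\<bar> powr (d' * A + K2)"
    using 2[OF A(2)] by blast
  have "d * A - K1 \<le> d' * A + K2"
  proof (rule powr_le_powr_exponent[OF c(1)])
    fix t assume t: "t \<ge> max t1 t2"
    have "c * \<bar>t\<bar> powr (d * A - K1) \<le> norm (F (Complex (-A) t))" using t by (intro c(3)) auto
    also have "F (Complex (-A) t) = G (Complex (-A) t)"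
      using A(3) by (intro assms(3)) (auto simp: complex_eq_iff)
    also have "norm \<dots> \<le> C * \<bar>t\<bar> powr (d' * A + K2)" using t by (intro C(2)) auto
    finally show "c * t powr (d * A - K1) \<le> C * t powr (d' * A + K2)" using t c(2) by simp
  qed
  moreover have "K1 + K2 + 1 \<le> A * (d - d')" using A(4) dd by (simp add: pos_divide_le_eq)
  ultimately show False by (simp add: algebra_simps)
qed

text \<open>A relation rather than a function: any continuation with the right growth witnesses
  \<open>d\<close>, and uniqueness enters only through the comparison of growth rates.\<close>

definition selberg_degree :: "(nat \<Rightarrow> complex) \<Rightarrow> real \<Rightarrow> bool" where
  "selberg_degree a d \<longleftrightarrow> d \<ge> 0 \<and> (\<exists>F. F holomorphic_on - {1} \<and> dser_equals a F \<and> vgrowth F d)"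

text \<open>By the identity theorem the continuations satisfy the product relation on the whole
  punctured plane, and comparing growth in both directions fixes the exponent.\<close>

lemma selberg_degree_mult:
  assumes "selberg_degree a d" "selberg_degree a1 d1" "selberg_degree a2 d2"
    and "dser_equals a (\<lambda>s. dser a1 s * dser a2 s)"
  shows "d = d1 + d2"
proof -
  obtain F where F: "F holomorphic_on - {1}" "dser_equals a F" "vgrowth F d"
    using assms(1) by (auto simp: selberg_degree_def)
  obtain F1 where F1: "F1 holomorphic_on - {1}" "dser_equals a1 F1" "vgrowth F1 d1"
    using assms(2) by (auto simp: selberg_degree_def)
  obtain F2 where F2: "F2 holomorphic_on - {1}" "dser_equals a2 F2" "vgrowth F2 d2"
    using assms(3) by (auto simp: selberg_degree_def)
  have eq: "F s = F1 s * F2 s" if "s \<noteq> 1" for s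
  proof (rule analytic_continuation_open[where s = "{s. Re s > 1}" and s' = "- {1}"
        and f = F and g = "\<lambda>s. F1 s * F2 s"])
    show "connected (- {1 :: complex})" by (rule connected_punctured_universe) simp
    show "{s. Re s > 1} \<noteq> {}" by (auto intro!: exI[of _ 2])
    show "(\<lambda>s. F1 s * F2 s) holomorphic_on - {1}" by (intro holomorphic_intros F1 F2)
    fix s assume "s \<in> {s. Re s > 1}"
    thus "F s = F1 s * F2 s" using F(2) F1(2) F2(2) assms(4) by (simp add: dser_equals_def)
  qed (use F that in \<open>auto simp: open_halfspace_Re_gt\<close>)
  note gr = vgrowth_mult[OF F1(3) F2(3)]
  show ?thesis
    using vgrowth_le[OF F(3) gr eq] vgrowth_le[OF gr F(3) eq[symmetric]] by simp
qed

lemma ex_selberg_degree: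
  assumes "a \<in> selberg_class"
  shows "\<exists>d. selberg_degree a d \<and> (d < 1 / 2 \<longrightarrow> dser_equals a (\<lambda>_. 1))"
proof -
  obtain F d where "F holomorphic_on - {1}" "dser_equals a F" "d \<ge> 0" "vgrowth F d"
    "d < 1 / 2 \<longrightarrow> dser_equals a (\<lambda>_. 1)"
    by (rule selberg_class_vgrowth[OF assms]) blast
  thus ?thesis unfolding selberg_degree_def by blast
qed

text \<open>Induction on a bound for \<open>2 * d\<close>: a nontrivial factor has degree at least
  1/2, so in a proper factorization each factor has degree at most \<open>d - 1 / 2\<close> and
  falls under the previous bound.\<close>

lemma primitive_factorization_aux:
  assumes "a \<in> selberg_class" "selberg_degree a d" "d < real N / 2"
  shows "\<exists>(k::nat) f. (\<forall>i<k. selberg_primitive (f i)) \<and> dser_equals a (\<lambda>s. \<Prod>i<k. dser (f i) s)"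
  using assms
proof (induction N arbitrary: a d)
  case 0
  thus ?case by (simp add: selberg_degree_def)
next
  case (Suc N)
  show ?case
  proof (cases "dser_equals a (\<lambda>_. 1)")
    case True
    \<comment> \<open>The constant 1 is the empty product.\<close>
    thus ?thesis by (intro exI[of _ 0]) simp
  next
    case ne1: False
    show ?thesis
    proof (cases "selberg_primitive a")
      case True
      thus ?thesis by (intro exI[of _ 1] exI[of _ "\<lambda>_. a"]) (simp add: dser_equals_def)
    next
      case False
      then obtain a1 a2 where a12: "a1 \<in> selberg_class" "a2 \<in> selberg_class"
        "dser_equals a (\<lambda>s. dser a1 s * dser a2 s)"
        "\<not> dser_equals a1 (\<lambda>_. 1)" "\<not> dser_equals a2 (\<lambda>_. 1)"
        using ne1 Suc.prems(1) unfolding selberg_primitive_def by blast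
      obtain d1 where d1: "selberg_degree a1 d1" "d1 < 1 / 2 \<longrightarrow> dser_equals a1 (\<lambda>_. 1)"
        using ex_selberg_degree[OF a12(1)] by blast
      obtain d2 where d2: "selberg_degree a2 d2" "d2 < 1 / 2 \<longrightarrow> dser_equals a2 (\<lambda>_. 1)"
        using ex_selberg_degree[OF a12(2)] by blast
      have ge: "d1 \<ge> 1 / 2" "d2 \<ge> 1 / 2" using d1(2) d2(2) a12(4,5) by fastforce+
      have d: "d = d1 + d2" by (rule selberg_degree_mult[OF Suc.prems(2) d1(1) d2(1) a12(3)])
      have lt: "d1 < real N / 2" "d2 < real N / 2"
        using ge d Suc.prems(3) by (simp_all add: field_simps)
      obtain k1 :: nat and f1 where f1: "\<forall>i<k1. selberg_primitive (f1 i)" "dser_equals a1 (\<lambda>s. \<Prod>i<k1. dser (f1 i) s)"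
        using Suc.IH[OF a12(1) d1(1) lt(1)] by blast
      obtain k2 :: nat and f2 where f2: "\<forall>i<k2. selberg_primitive (f2 i)" "dser_equals a2 (\<lambda>s. \<Prod>i<k2. dser (f2 i) s)"
        using Suc.IH[OF a12(2) d2(1) lt(2)] by blast
      define f where "f i = (if i < k1 then f1 i else f2 (i - k1))" for i
      have "(\<Prod>i<k1 + k. dser (f i) s) = (\<Prod>i<k1. dser (f1 i) s) * (\<Prod>i<k. dser (f2 i) s)" for k s
        by (induction k) (simp_all add: f_def mult.assoc)
      hence "dser_equals a (\<lambda>s. \<Prod>i<k1 + k2. dser (f i) s)"
        using a12(3) f1(2) f2(2) by (simp add: dser_equals_def)
      moreover have "\<forall>i<k1 + k2. selberg_primitive (f i)"
        using f1(1) f2(1) by (auto simp: f_def)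
      ultimately show ?thesis by blast
    qed
  qed
qed

lemma primitive_factorization:
  assumes "a \<in> selberg_class"
  shows "\<exists>(k::nat) f. (\<forall>i<k. selberg_primitive (f i)) \<and> dser_equals a (\<lambda>s. \<Prod>i<k. dser (f i) s)"
proof -
  obtain d where "selberg_degree a d" using ex_selberg_degree[OF assms] by blast
  moreover obtain N :: nat where "2 * d < real N" using reals_Archimedean2 by blast
  ultimately show ?thesis by (intro primitive_factorization_aux[OF assms, of d N]) auto
qed

section \<open>Counting prime coefficients\<close>

lemma selberg_class_abs:
  assumes "a \<in> selberg_class" "\<sigma> > 1"
  shows "dser_abs a \<sigma>"
  using assms by (intro dser_abs_ramanujan) (auto simp: selberg_class_def)

lemma selberg_class_first:
  assumes "a \<in> selberg_class"
  shows "a 1 = 1"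
  using assms by (auto simp: selberg_class_def selberg_euler_product_def)

lemma selberg_coeff_unique:
  assumes "a \<in> selberg_class" "b \<in> selberg_class" "dser_equals a (dser b)" "n \<ge> 1"
  shows "a n = b n"
proof (rule dser_unique[OF _ _ _ assms(4)])
  show "dser_abs a 2" "dser_abs b 2" using assms(1,2) by (auto intro: selberg_class_abs)
  show "dser a s = dser b s" if "Re s > 2" for s
    using assms(3) that by (simp add: dser_equals_def)
qed

text \<open>A prime has only the divisors 1 and \<open>p\<close>; as leading coefficients are 1,
  multiplication of series becomes addition at \<open>p\<close>.\<close>

lemma prod_coeff_prime:
  assumes a: "a \<in> selberg_class" and f: "\<forall>i<k. f i \<in> selberg_class"
    and eq: "dser_equals a (\<lambda>s. \<Prod>i<k::nat. dser (f i) s)" and p: "prime p"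
  shows "a p = (\<Sum>i<k. f i p)"
proof -
  \<comment> \<open>The induction carries absolute convergence and leading coefficient 1, which is
    what \<open>dser_mult\<close> and \<open>dconv_prime\<close> use of a partial product.\<close>
  have "\<exists>c. (\<forall>\<sigma>>1. dser_abs c \<sigma>) \<and> (\<forall>s. Re s > 1 \<longrightarrow> dser c s = (\<Prod>i<k. dser (f i) s)) \<and>
          c 1 = 1 \<and> c p = (\<Sum>i<k. f i p)"
    using f
  proof (induction k)
    case 0
    define c :: "nat \<Rightarrow> complex" where "c n = (if n = 1 then 1 else 0)" for n
    have "dser_abs c \<sigma>" for \<sigma>
      unfolding dser_abs_def by (rule summable_finite[of "{0}"]) (auto simp: c_def)
    moreover have "dser c s = 1" for s by (rule dser_eq_first) (auto simp: c_def)
    moreover have "c p = 0" "c 1 = 1" using p by (auto simp: c_def)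
    ultimately show ?case by (intro exI[of _ c]) auto
  next
    case (Suc k)
    then obtain c where c: "\<forall>\<sigma>>1. dser_abs c \<sigma>" "\<forall>s. Re s > 1 \<longrightarrow> dser c s = (\<Prod>i<k. dser (f i) s)"
      "c 1 = 1" "c p = (\<Sum>i<k. f i p)" by auto
    have fk: "f k \<in> selberg_class" using Suc.prems by simp
    have "dser_abs (dconv c (f k)) \<sigma>" if "\<sigma> > 1" for \<sigma>
      using dser_mult(1)[of c "of_real \<sigma>" "f k"] c(1) selberg_class_abs[OF fk] that by simp
    moreover have "dser (dconv c (f k)) s = (\<Prod>i<Suc k. dser (f i) s)" if "Re s > 1" for s
      using dser_mult(2)[of c s "f k"] c(1,2) selberg_class_abs[OF fk] that by simp
    moreover have "dconv c (f k) 1 = 1"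
      using c(3) selberg_class_first[OF fk] by (simp add: dconv_def)
    moreover have "dconv c (f k) p = (\<Sum>i<Suc k. f i p)"
      using c(3,4) selberg_class_first[OF fk] by (simp add: dconv_prime[OF p] add.commute)
    ultimately show ?case by blast
  qed
  then obtain c where c: "\<forall>\<sigma>>1. dser_abs c \<sigma>" "\<forall>s. Re s > 1 \<longrightarrow> dser c s = (\<Prod>i<k. dser (f i) s)"
      "c p = (\<Sum>i<k. f i p)" by blast
  have "a p = c p"
  proof (rule dser_unique)
    show "dser_abs a 2" "dser_abs c 2" using a c(1) by (auto intro: selberg_class_abs)
    show "dser a s = dser c s" if "Re s > 2" for s
      using eq c(2) that by (simp add: dser_equals_def)
    show "p \<ge> 1" using prime_ge_1_nat[OF p] .
  qed
  thus ?thesis using c(3) by simp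
qed

lemma selberg_regular_cong:
  assumes "\<And>p. prime p \<Longrightarrow> a p = b p" "selberg_regular a n"
  shows "selberg_regular b n"
proof -
  have "(\<Sum>p | prime p \<and> real p \<le> x. (norm (a p))\<^sup>2 / real p) = (\<Sum>p | prime p \<and> real p \<le> x. (norm (b p))\<^sup>2 / real p)" for x
    using assms(1) by (intro sum.cong) auto
  thus ?thesis using assms(2) by (simp add: selberg_regular_def)
qed

lemma norm_square_sum:
  fixes z :: "nat \<Rightarrow> complex"
  shows "(norm (\<Sum>i<k. z i))\<^sup>2 = (\<Sum>i<k. \<Sum>j<k. Re (z i * cnj (z j)))"
proof -
  have "of_real ((norm (\<Sum>i<k. z i))\<^sup>2) = (\<Sum>i<k. z i) * cnj (\<Sum>i<k. z i)"
    by (rule complex_norm_square)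
  also have "\<dots> = (\<Sum>i<k. \<Sum>j<k. z i * cnj (z j))"
    by (simp add: sum_product)
  finally have "Re (of_real ((norm (\<Sum>i<k. z i))\<^sup>2)) = Re (\<Sum>i<k. \<Sum>j<k. z i * cnj (z j))"
    by (rule arg_cong)
  thus ?thesis by simp
qed

text \<open>Expanding the squared modulus of the coefficient at \<open>p\<close> gives one sum per
  ordered pair of factors. Pairs equal as functions have equal coefficients and contribute their
  \<open>n\<close> times \<open>ln (ln x)\<close>, the others \<open>O(1)\<close> by
  orthonormality.\<close>

lemma selberg_regular_factorization:
  assumes B: "selberg_conjecture_B" and a: "a \<in> selberg_class"
    and f: "\<forall>i<k. selberg_primitive (f i)"
    and reg: "\<forall>i<k. selberg_regular (f i) (n i)"
    and eq: "dser_equals a (\<lambda>s. \<Prod>i<k::nat. dser (f i) s)"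
  shows "selberg_regular a (\<Sum>i<k. \<Sum>j<k. if dser_equals (f i) (dser (f j)) then n i else 0)"
proof -
  define e where "e i j = (if dser_equals (f i) (dser (f j)) then n i else 0)" for i j
  define R where "R i j x = (\<Sum>p | prime p \<and> real p \<le> x. Re (f i p * cnj (f j p)) / real p)" for i j and x :: real
  have fS: "\<forall>i<k. f i \<in> selberg_class" using f by (auto simp: selberg_primitive_def)
  have bigo: "(\<lambda>x. R i j x - of_int (e i j) * ln (ln x)) \<in> O[at_top](\<lambda>_. 1)" if ij: "i < k" "j < k" for i j
  proof (cases "dser_equals (f i) (dser (f j))")
    case True
    have "f i p = f j p" if "prime p" for p
      using fS ij True prime_ge_1_nat[OF that] by (intro selberg_coeff_unique) auto
    hence "R i j x = (\<Sum>p | prime p \<and> real p \<le> x. (norm (f i p))\<^sup>2 / real p)" for x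
      unfolding R_def by (intro sum.cong refl) (auto simp flip: complex_norm_square)
    thus ?thesis using reg ij True by (simp add: selberg_regular_def e_def)
  next
    case False
    have "(\<lambda>x::real. \<Sum>p | prime p \<and> real p \<le> x. f i p * cnj (f j p) / of_nat p) \<in> O[at_top](\<lambda>_. 1)"
      using B f ij False unfolding selberg_conjecture_B_def by blast
    then obtain C where "eventually (\<lambda>x::real. norm (\<Sum>p | prime p \<and> real p \<le> x. f i p * cnj (f j p) / of_nat p) \<le> C * norm (1::complex)) at_top"
      by (elim landau_o.bigE) auto
    \<comment> \<open>Conjecture (B) bounds a complex sum; its real part is what enters the
      square.\<close>
    hence "eventually (\<lambda>x. norm (R i j x) \<le> C * norm (1::real)) at_top"
    proof eventually_elim
      case (elim x)
      have "R i j x = Re (\<Sum>p | prime p \<and> real p \<le> x. f i p * cnj (f j p) / of_nat p)"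
        unfolding R_def Re_sum by (intro sum.cong refl) (simp only: Re_divide_of_nat)
      also have "norm \<dots> \<le> norm (\<Sum>p | prime p \<and> real p \<le> x. f i p * cnj (f j p) / of_nat p)"
        unfolding real_norm_def by (rule abs_Re_le_cmod)
      finally show ?case using elim by simp
    qed
    hence "R i j \<in> O[at_top](\<lambda>_. 1)" by (rule bigoI)
    thus ?thesis using False by (simp add: e_def)
  qed
  have "(\<Sum>p | prime p \<and> real p \<le> x. (norm (a p))\<^sup>2 / real p) = (\<Sum>i<k. \<Sum>j<k. R i j x)" for x
  proof -
    have "(\<Sum>p | prime p \<and> real p \<le> x. (norm (a p))\<^sup>2 / real p) =
          (\<Sum>p | prime p \<and> real p \<le> x. \<Sum>i<k. \<Sum>j<k. Re (f i p * cnj (f j p)) / real p)"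
      by (intro sum.cong refl)
         (simp add: prod_coeff_prime[OF a fS eq] norm_square_sum sum_divide_distrib del: times_complex.sel)
    also have "\<dots> = (\<Sum>i<k. \<Sum>p | prime p \<and> real p \<le> x. \<Sum>j<k. Re (f i p * cnj (f j p)) / real p)"
      by (rule sum.swap)
    also have "\<dots> = (\<Sum>i<k. \<Sum>j<k. R i j x)"
      unfolding R_def by (intro sum.cong refl sum.swap)
    finally show ?thesis .
  qed
  moreover have "(\<lambda>x. \<Sum>i<k. \<Sum>j<k. R i j x - of_int (e i j) * ln (ln x)) \<in> O[at_top](\<lambda>_. 1)"
    by (intro big_sum_in_bigo bigo) auto
  ultimately show ?thesis
    unfolding selberg_regular_def e_def[symmetric] by (simp add: sum_subtractf sum_distrib_right)
qed

theorem proposition4p2: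
  fixes F :: "nat \<Rightarrow> complex"
  assumes "selberg_conjecture_A" and "selberg_conjecture_B" and "selberg_conjecture_C"
    and "F \<in> selberg_class"
    and "selberg_n F = 1"
  shows "selberg_primitive F"
proof -
  obtain k :: nat and f where f: "\<forall>i<k. selberg_primitive (f i)" and eq: "dser_equals F (\<lambda>s. \<Prod>i<k. dser (f i) s)"
    using primitive_factorization[OF assms(4)] by blast
  define n where "n i = selberg_n (f i)" for i
  have fS: "\<forall>i<k. f i \<in> selberg_class" using f by (auto simp: selberg_primitive_def)
  have reg: "\<forall>i<k. selberg_regular (f i) (n i)"
  proof (intro allI impI)
    fix i assume "i < k"
    then obtain m where m: "selberg_regular (f i) m"
      using assms(1) fS unfolding selberg_conjecture_A_def by blast
    thus "selberg_regular (f i) (n i)" using selberg_n_eqI[OF m] by (simp add: n_def)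
  qed
  define e where "e i j = (if dser_equals (f i) (dser (f j)) then n i else 0)" for i j
  have total: "(\<Sum>i<k. \<Sum>j<k. e i j) = 1"
    using selberg_n_eqI[OF selberg_regular_factorization[OF assms(2,4) f reg eq]] assms(5)
    by (simp add: e_def)
  have "k = 1"
  \<comment> \<open>Conjecture (B) determines \<open>n\<close> only for a primitive element that has
    a different one beside it, so coinciding factors form a case of their own, with
    \<open>n 0\<close> an unknown integer.\<close>
  proof (cases "\<forall>i<k. \<forall>j<k. dser_equals (f i) (dser (f j))")
    case True
    have n0: "n i = n 0" if i: "i < k" for i
    proof -
      have "f i p = f 0 p" if "prime p" for p
        using fS True i prime_ge_1_nat[OF that] by (intro selberg_coeff_unique) auto
      hence "selberg_regular (f 0) (n i)"
        by (rule selberg_regular_cong) (use reg i in auto)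
      from selberg_n_eqI[OF this] show ?thesis by (simp add: n_def)
    qed
    have "e i j = n 0" if "i < k" "j < k" for i j
      using True that n0[OF that(1)] by (simp add: e_def)
    hence "(\<Sum>i<k. \<Sum>j<k. e i j) = (\<Sum>i<k. \<Sum>j<k. n 0)"
      by (intro sum.cong refl) auto
    \<comment> \<open>In the integers this leaves only \<open>k = 1\<close>, whatever
      \<open>n 0\<close> is.\<close>
    hence "int k * (int k * n 0) = 1" using total by simp
    thus ?thesis using zmult_eq_1_iff[of "int k"] by auto
  next
    case False
    then obtain i0 j0 where ij: "i0 < k" "j0 < k" "\<not> dser_equals (f i0) (dser (f j0))" by blast
    have n1: "n i = 1" if i: "i < k" for i
    proof -
      \<comment> \<open>A factor cannot agree with both \<open>f i0\<close> and \<open>f j0\<close>,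
        which differ; one of them is the partner that (B) asks for.\<close>
      have "\<not> dser_equals (f i) (dser (f i0)) \<or> \<not> dser_equals (f i) (dser (f j0))"
        using ij(3) by (auto simp: dser_equals_def)
      thus ?thesis using assms(2) f i ij(1,2) unfolding selberg_conjecture_B_def n_def by blast
    qed
    have "e i j \<ge> 0" if "i < k" for i j using n1[OF that] by (simp add: e_def)
    \<comment> \<open>All entries are nonnegative, and the diagonal alone contributes
      \<open>k\<close> to a total of 1.\<close>
    hence "(\<Sum>i<k. e i i) \<le> (\<Sum>i<k. \<Sum>j<k. e i j)"
      by (intro sum_mono member_le_sum) auto
    moreover have "(\<Sum>i<k. e i i) = (\<Sum>i<k. 1)"
      using n1 by (intro sum.cong refl) (simp add: e_def dser_equals_def)
    ultimately have "k \<le> 1" using total by simp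
    thus ?thesis using ij(1) by simp
  qed
  hence f0: "selberg_primitive (f 0)" and F: "\<And>s. Re s > 1 \<Longrightarrow> dser F s = dser (f 0) s"
    using f eq by (auto simp: dser_equals_def)
  \<comment> \<open>Apart from membership in the class, primitivity sees an element only through its
    function on \<open>Re s > 1\<close>, so it passes from \<open>f 0\<close> to
    \<open>F\<close>.\<close>
  have "dser_equals F G \<longleftrightarrow> dser_equals (f 0) G" for G
    using F by (simp add: dser_equals_def)
  thus ?thesis using f0 assms(4) unfolding selberg_primitive_def by simp
qed

end
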